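(* Let $n\ge 2$, let $P$ be the germ of divisors of $c$ in $W(\tilde A_{2n-1})$, where $c=s_2s_4\cdots s_{2n}s_1s_3\cdots s_{2n-1}$, and let $\sigma$ be the automorphism of $P$ induced by $i\mapsto 1-i$ on $\mathbb Z$. Then the germ $P^\sigma$ of $\sigma$-fixed elements of $P$ is a Garside germ.
   Context: A permutation $w$ of $\mathbb Z$ is $2n$-periodic if $w(i+2n)=w(i)+2n$ for all $i$; its total shift is $\frac1{2n}\sum_{x=1}^{2n}(w(x)-x)$. $W(\tilde A_{2n-1})$ is the group (under composition, $(ww')(i)=w(w'(i))$) of $2n$-periodic permutations of $\mathbb Z$ of total shift $0$. For $a\not\equiv b\pmod{2n}$, $(a,b)$ denotes the $2n$-periodic permutation exchanging $a+2nk$ and $b+2nk$ for all $k\in\mathbb Z$ and fixing all other integers. This is a Coxeter group with simple reflections $s_i=(i,i+1)$, $i=1,\dots,2n$, and its reflections are exactly the $(a,b)$. Let $l_A$ be the length with respect to the set of all reflections, and write $v\preccurlyeq_A w$ if $l_A(v)+l_A(v^{-1}w)=l_A(w)$. The element $c=s_2s_4\cdots s_{2n}s_1s_3\cdots s_{2n-1}$ is the permutation $i\mapsto i+2$ for $i$ odd, $i\mapsto i-2$ for $i$ even. A germ is a set $Q$ with a partially defined product having a unit $1$ ($1p$ and $p1$ are defined and equal to $p$ for all $p$). It is associative if whenever one of $a(bc)$, $(ab)c$ is defined, so is the other and they are equal. In a germ, $a$ left divides $b$ (and $b$ is a right multiple of $a$) if $b=ac$ for some $c\in Q$; right divisibility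 and left multiples are defined similarly. An associative germ is Noetherian if there is no infinite strictly decreasing sequence for left divisibility, nor for right divisibility. $M(Q)$ is the monoid generated by $Q$ with only relations the equalities of products in $Q$ (the unit of $Q$ becoming the unit of $M(Q)$). A germ $Q$ is called a Garside germ if it is associative, Noetherian and satisfies: (1) any two elements of $Q$ have a least right common multiple in $Q$; (2) for all $m\in M(Q)$ and $a,b\in Q$, if $am=bm$ or $ma=mb$ in $M(Q)$, then $a=b$; (3) there is an element $\Delta\in Q$ which is both a left and a right common multiple of all elements of $Q$. The germ $P$ is the set $\{w\in W(\tilde A_{2n-1})\mid w\preccurlyeq_A c\}$, the product of $w,w'\in P$ being defined, and equal to $ww'$, if $ww'\in P$ and $l_A(ww')=l_A(w)+l_A(w')$. The automorphism $\sigma$ of $P$ is conjugation by the map $i\mapsto1-i$ of $\mathbb Z$ (it maps $s_i$ to $s_{2n-i}$, indices mod $2n$). $P^\sigma=\{w\in P\mid\sigma(w)=w\}$ carries the restricted partial product. *)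

theory Defs
  imports Complex_Main "HOL-Number_Theory.Cong" "HOL-Algebra.Group"
begin

section \<open>Germs\<close>

text \<open>The product is partial: \<^term>\<open>None\<close> means undefined. Only its values on the carrier
  are relevant.\<close>

record 'a germ = "'a partial_object" +
  gprod :: "'a \<Rightarrow> 'a \<Rightarrow> 'a option"
  gunit :: 'a

locale germ =
  fixes Q :: "('a, 'm) germ_scheme"
  assumes gprod_closed:
      "\<lbrakk>a \<in> carrier Q; b \<in> carrier Q; gprod Q a b = Some c\<rbrakk> \<Longrightarrow> c \<in> carrier Q"
    and gunit_closed: "gunit Q \<in> carrier Q"
    and gunit_left: "p \<in> carrier Q \<Longrightarrow> gprod Q (gunit Q) p = Some p"
    and gunit_right: "p \<in> carrier Q \<Longrightarrow> gprod Q p (gunit Q) = Some p"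

definition gdvd_left :: "('a, 'm) germ_scheme \<Rightarrow> 'a \<Rightarrow> 'a \<Rightarrow> bool" where
  "gdvd_left Q a b \<longleftrightarrow> (\<exists>c \<in> carrier Q. gprod Q a c = Some b)"

definition gdvd_right :: "('a, 'm) germ_scheme \<Rightarrow> 'a \<Rightarrow> 'a \<Rightarrow> bool" where
  "gdvd_right Q a b \<longleftrightarrow> (\<exists>c \<in> carrier Q. gprod Q c a = Some b)"

text \<open>Equality in \<^typ>\<open>'a option\<close> says that one side is defined if and only if the other one
  is, and that in this case their values agree.\<close>

locale associative_germ = germ +
  assumes gprod_assoc:
    "\<lbrakk>a \<in> carrier Q; b \<in> carrier Q; c \<in> carrier Q\<rbrakk> \<Longrightarrow>
      Option.bind (gprod Q b c) (\<lambda>x. gprod Q a x) = Option.bind (gprod Q a b) (\<lambda>y. gprod Q y c)"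

text \<open>Strictly decreasing means that each term divides the previous one and differs from it; this
  excludes nontrivial cycles of divisibility as well.\<close>

locale noetherian_germ = associative_germ +
  assumes noetherian_left:
      "\<nexists>f :: nat \<Rightarrow> 'a. range f \<subseteq> carrier Q \<and>
         (\<forall>i. gdvd_left Q (f (Suc i)) (f i) \<and> f (Suc i) \<noteq> f i)"
    and noetherian_right:
      "\<nexists>f :: nat \<Rightarrow> 'a. range f \<subseteq> carrier Q \<and>
         (\<forall>i. gdvd_right Q (f (Suc i)) (f i) \<and> f (Suc i) \<noteq> f i)"

subsection \<open>The monoid generated by a germ\<close>

text \<open>The congruence on words over \<open>Q\<close> generated by the products of \<open>Q\<close>, with the unit of \<open>Q\<close>
  identified with the empty word.\<close>

inductive_set germ_cong :: "('a, 'm) germ_scheme \<Rightarrow> ('a list \<times> 'a list) set"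
  for Q :: "('a, 'm) germ_scheme" where
  refl: "xs \<in> lists (carrier Q) \<Longrightarrow> (xs, xs) \<in> germ_cong Q"
| sym: "(xs, ys) \<in> germ_cong Q \<Longrightarrow> (ys, xs) \<in> germ_cong Q"
| trans: "\<lbrakk>(xs, ys) \<in> germ_cong Q; (ys, zs) \<in> germ_cong Q\<rbrakk> \<Longrightarrow> (xs, zs) \<in> germ_cong Q"
| unit: "\<lbrakk>xs \<in> lists (carrier Q); ys \<in> lists (carrier Q)\<rbrakk>
    \<Longrightarrow> (xs @ [gunit Q] @ ys, xs @ ys) \<in> germ_cong Q"
| product: "\<lbrakk>xs \<in> lists (carrier Q); ys \<in> lists (carrier Q); a \<in> carrier Q; b \<in> carrier Q;
      gprod Q a b = Some c\<rbrakk>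
    \<Longrightarrow> (xs @ [a, b] @ ys, xs @ [c] @ ys) \<in> germ_cong Q"

definition germ_monoid :: "('a, 'm) germ_scheme \<Rightarrow> 'a list set monoid" where
  "germ_monoid Q = \<lparr>carrier = lists (carrier Q) // germ_cong Q,
     mult = (\<lambda>X Y. \<Union>xs\<in>X. \<Union>ys\<in>Y. germ_cong Q `` {xs @ ys}),
     one = germ_cong Q `` {[]}\<rparr>"

definition germ_embed :: "('a, 'm) germ_scheme \<Rightarrow> 'a \<Rightarrow> 'a list set" where
  "germ_embed Q a = germ_cong Q `` {[a]}"

context germ
begin

lemma germ_cong_lists:
  assumes "(xs, ys) \<in> germ_cong Q"
  shows "xs \<in> lists (carrier Q) \<and> ys \<in> lists (carrier Q)"
  using assms by (induction rule: germ_cong.induct) (auto simp: gunit_closed intro: gprod_closed)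

lemma equiv_germ_cong: "equiv (lists (carrier Q)) (germ_cong Q)"
proof (rule equivI)
  show "germ_cong Q \<subseteq> lists (carrier Q) \<times> lists (carrier Q)"
    using germ_cong_lists by (simp add: subset_iff)
  show "refl_on (lists (carrier Q)) (germ_cong Q)"
    by (auto simp: refl_on_def intro: germ_cong.refl)
  show "sym_on UNIV (germ_cong Q)"
    by (auto intro!: symI germ_cong.sym)
  show "trans_on UNIV (germ_cong Q)"
    by (auto intro!: transI intro: germ_cong.trans)
qed

lemma germ_cong_append_left:
  assumes "(xs, ys) \<in> germ_cong Q" and "zs \<in> lists (carrier Q)"
  shows "(zs @ xs, zs @ ys) \<in> germ_cong Q"
  using assms
proof (induction rule: germ_cong.induct)
  case (unit xs ys)
  then show ?case using germ_cong.unit[of "zs @ xs" Q ys] by simp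
next
  case (product xs ys a b c)
  then show ?case using germ_cong.product[of "zs @ xs" Q ys a b c] by simp
next
  case (refl xs)
  then show ?case by (intro germ_cong.refl) (simp add: append_in_lists_conv)
qed (auto intro: germ_cong.sym germ_cong.trans)

lemma germ_cong_append_right:
  assumes "(xs, ys) \<in> germ_cong Q" and "zs \<in> lists (carrier Q)"
  shows "(xs @ zs, ys @ zs) \<in> germ_cong Q"
  using assms
proof (induction rule: germ_cong.induct)
  case (unit xs ys)
  then show ?case using germ_cong.unit[of xs Q "ys @ zs"] by simp
next
  case (product xs ys a b c)
  then show ?case using germ_cong.product[of xs Q "ys @ zs" a b c] by simp
next
  case (refl xs)
  then show ?case by (intro germ_cong.refl) (simp add: append_in_lists_conv)
qed (auto intro: germ_cong.sym germ_cong.trans)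

lemma germ_cong_append:
  assumes "(xs, xs') \<in> germ_cong Q" and "(ys, ys') \<in> germ_cong Q"
  shows "(xs @ ys, xs' @ ys') \<in> germ_cong Q"
  using germ_cong_append_right[OF assms(1)] germ_cong_append_left[OF assms(2)]
    germ_cong_lists assms by (meson germ_cong.trans)

lemma germ_monoid_mult_class:
  assumes "xs \<in> lists (carrier Q)" and "ys \<in> lists (carrier Q)"
  shows "(germ_cong Q `` {xs}) \<otimes>\<^bsub>germ_monoid Q\<^esub> (germ_cong Q `` {ys}) = germ_cong Q `` {xs @ ys}"
proof -
  have "congruent2 (germ_cong Q) (germ_cong Q) (\<lambda>xs ys. germ_cong Q `` {xs @ ys})"
    unfolding congruent2_def using germ_cong_append equiv_class_eq[OF equiv_germ_cong] by blast
  from UN_equiv_class2[OF equiv_germ_cong equiv_germ_cong this assms] show ?thesis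
    by (simp add: germ_monoid_def)
qed

lemma monoid_germ_monoid: "monoid (germ_monoid Q)"
proof (rule monoidI)
  have cl: "\<exists>xs \<in> lists (carrier Q). X = germ_cong Q `` {xs}"
    if "X \<in> carrier (germ_monoid Q)" for X
    using that by (auto simp: germ_monoid_def elim: quotientE)
  have mem: "germ_cong Q `` {xs} \<in> carrier (germ_monoid Q)" if "xs \<in> lists (carrier Q)" for xs
    using that by (simp add: germ_monoid_def quotientI)
  have one: "\<one>\<^bsub>germ_monoid Q\<^esub> = germ_cong Q `` {[]}"
    by (simp add: germ_monoid_def)
  show "\<one>\<^bsub>germ_monoid Q\<^esub> \<in> carrier (germ_monoid Q)"
    unfolding one by (rule mem) simp
  fix X assume "X \<in> carrier (germ_monoid Q)"
  then obtain xs where xs: "xs \<in> lists (carrier Q)" "X = germ_cong Q `` {xs}" using cl by blast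
  show "\<one>\<^bsub>germ_monoid Q\<^esub> \<otimes>\<^bsub>germ_monoid Q\<^esub> X = X"
    using germ_monoid_mult_class[of "[]" xs] xs by (simp add: one)
  show "X \<otimes>\<^bsub>germ_monoid Q\<^esub> \<one>\<^bsub>germ_monoid Q\<^esub> = X"
    using germ_monoid_mult_class[of xs "[]"] xs by (simp add: one)
  fix Y assume "Y \<in> carrier (germ_monoid Q)"
  then obtain ys where ys: "ys \<in> lists (carrier Q)" "Y = germ_cong Q `` {ys}" using cl by blast
  show "X \<otimes>\<^bsub>germ_monoid Q\<^esub> Y \<in> carrier (germ_monoid Q)"
    using xs ys by (simp add: germ_monoid_mult_class mem append_in_lists_conv del: in_lists_conv_set)
  fix Z assume "Z \<in> carrier (germ_monoid Q)"
  then obtain zs where zs: "zs \<in> lists (carrier Q)" "Z = germ_cong Q `` {zs}" using cl by blast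
  show "X \<otimes>\<^bsub>germ_monoid Q\<^esub> Y \<otimes>\<^bsub>germ_monoid Q\<^esub> Z =
      X \<otimes>\<^bsub>germ_monoid Q\<^esub> (Y \<otimes>\<^bsub>germ_monoid Q\<^esub> Z)"
    using xs ys zs by (simp add: germ_monoid_mult_class append_in_lists_conv)
qed

end

subsection \<open>Garside germs\<close>

locale garside_germ = noetherian_germ +
  assumes right_lcm_exists:
      "\<lbrakk>a \<in> carrier Q; b \<in> carrier Q\<rbrakk> \<Longrightarrow>
        \<exists>m \<in> carrier Q. gdvd_left Q a m \<and> gdvd_left Q b m \<and>
          (\<forall>m' \<in> carrier Q. gdvd_left Q a m' \<and> gdvd_left Q b m' \<longrightarrow> gdvd_left Q m m')"
    and cancel_in_monoid:
      "\<lbrakk>m \<in> carrier (germ_monoid Q); a \<in> carrier Q; b \<in> carrier Q;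
        germ_embed Q a \<otimes>\<^bsub>germ_monoid Q\<^esub> m = germ_embed Q b \<otimes>\<^bsub>germ_monoid Q\<^esub> m \<or>
        m \<otimes>\<^bsub>germ_monoid Q\<^esub> germ_embed Q a = m \<otimes>\<^bsub>germ_monoid Q\<^esub> germ_embed Q b\<rbrakk> \<Longrightarrow> a = b"
    and garside_element_exists:
      "\<exists>\<Delta> \<in> carrier Q. \<forall>a \<in> carrier Q. gdvd_left Q a \<Delta> \<and> gdvd_right Q a \<Delta>"

definition fixed_germ :: "('a \<Rightarrow> 'a) \<Rightarrow> ('a, 'm) germ_scheme \<Rightarrow> ('a, 'm) germ_scheme" where
  "fixed_germ \<phi> Q = Q\<lparr>carrier := {w \<in> carrier Q. \<phi> w = w}\<rparr>"


section \<open>The affine Coxeter group of type A and its dual germ\<close>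

definition periodic_perm :: "nat \<Rightarrow> (int \<Rightarrow> int) \<Rightarrow> bool" where
  "periodic_perm n w \<longleftrightarrow> bij w \<and> (\<forall>i. w (i + 2 * int n) = w i + 2 * int n)"

definition total_shift :: "nat \<Rightarrow> (int \<Rightarrow> int) \<Rightarrow> rat" where
  "total_shift n w = 1 / of_nat (2 * n) * (\<Sum>x = 1..2 * int n. of_int (w x - x))"

definition W_affA :: "nat \<Rightarrow> (int \<Rightarrow> int) set" where
  "W_affA n = {w. periodic_perm n w \<and> total_shift n w = 0}"

text \<open>The permutation written \<open>(a, b)\<close>; the definition is meaningful if \<open>a\<close> and \<open>b\<close> are not
  congruent modulo \<open>2n\<close>.\<close>

definition ptransp :: "nat \<Rightarrow> int \<Rightarrow> int \<Rightarrow> int \<Rightarrow> int" where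
  "ptransp n a b = (\<lambda>x. if [x = a] (mod 2 * int n) then x - a + b
     else if [x = b] (mod 2 * int n) then x - b + a else x)"

definition refls :: "nat \<Rightarrow> (int \<Rightarrow> int) set" where
  "refls n = {ptransp n a b | a b. \<not> [a = b] (mod 2 * int n)}"

definition simple_refl :: "nat \<Rightarrow> int \<Rightarrow> int \<Rightarrow> int" where
  "simple_refl n i = ptransp n i (i + 1)"

abbreviation comp_list :: "('a \<Rightarrow> 'a) list \<Rightarrow> 'a \<Rightarrow> 'a" where
  "comp_list ws \<equiv> foldr (\<circ>) ws id"

definition refl_length :: "nat \<Rightarrow> (int \<Rightarrow> int) \<Rightarrow> nat" where
  "refl_length n w = (LEAST k. \<exists>ts. set ts \<subseteq> refls n \<and> length ts = k \<and> comp_list ts = w)"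

text \<open>\<^term>\<open>inv_into UNIV v\<close> is the inverse function of the permutation \<open>v\<close>; its usual notation
  is taken by the inverse in groups.\<close>

definition abs_le :: "nat \<Rightarrow> (int \<Rightarrow> int) \<Rightarrow> (int \<Rightarrow> int) \<Rightarrow> bool" where
  "abs_le n v w \<longleftrightarrow> refl_length n v + refl_length n (inv_into UNIV v \<circ> w) = refl_length n w"

definition coxeter_elt :: "nat \<Rightarrow> int \<Rightarrow> int" where
  "coxeter_elt n = comp_list (map (\<lambda>j. simple_refl n (2 * j)) [1..int n] @
     map (\<lambda>j. simple_refl n (2 * j - 1)) [1..int n])"

definition P_set :: "nat \<Rightarrow> (int \<Rightarrow> int) set" where
  "P_set n = {w \<in> W_affA n. abs_le n w (coxeter_elt n)}"

definition P_germ :: "nat \<Rightarrow> (int \<Rightarrow> int) germ" where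
  "P_germ n = \<lparr>carrier = P_set n,
     gprod = (\<lambda>w w'. if w \<circ> w' \<in> P_set n \<and> refl_length n (w \<circ> w') = refl_length n w + refl_length n w'
       then Some (w \<circ> w') else None),
     gunit = id\<rparr>"

text \<open>Conjugation by the involution \<open>i \<mapsto> 1 - i\<close>.\<close>

definition sigma :: "(int \<Rightarrow> int) \<Rightarrow> int \<Rightarrow> int" where
  "sigma w = (\<lambda>i. 1 - w (1 - i))"


subsection \<open>Agreement of the definitions with the Coxeter-theoretic ones\<close>

lemma periodic_perm_shift:
  assumes "periodic_perm n w"
  shows "w (i + 2 * int n * k) = w i + 2 * int n * k"
proof -
  have nat: "w (i + 2 * int n * int k) = w i + 2 * int n * int k" for i k
  proof (induction k)
    case (Suc k)
    have "w ((i + 2 * int n * int k) + 2 * int n) = w (i + 2 * int n * int k) + 2 * int n"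
      using assms unfolding periodic_perm_def by blast
    with Suc show ?case by (simp add: algebra_simps)
  qed simp
  show ?thesis
  proof (cases "k \<ge> 0")
    case True
    then show ?thesis using nat[of i "nat k"] by simp
  next
    case False
    then show ?thesis using nat[of "i + 2 * int n * k" "nat (- k)"] by simp
  qed
qed

lemma periodic_perm_cong_iff:
  assumes "periodic_perm n w"
  shows "[w x = w y] (mod 2 * int n) \<longleftrightarrow> [x = y] (mod 2 * int n)"
proof
  assume "[x = y] (mod 2 * int n)"
  then obtain k where "y = x + 2 * int n * k" by (auto simp: cong_iff_lin)
  then show "[w x = w y] (mod 2 * int n)"
    using periodic_perm_shift[OF assms, of x k] by (auto simp: cong_iff_lin)
next
  assume "[w x = w y] (mod 2 * int n)"
  then obtain k where "w y = w x + 2 * int n * k" by (auto simp: cong_iff_lin)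
  then have "w y = w (x + 2 * int n * k)" using periodic_perm_shift[OF assms] by simp
  then have "y = x + 2 * int n * k"
    using assms by (meson bij_is_inj injD periodic_perm_def)
  then show "[x = y] (mod 2 * int n)" by (auto simp: cong_iff_lin)
qed

lemma W_affA_comp:
  assumes "n \<ge> 1" and v: "v \<in> W_affA n" and w: "w \<in> W_affA n"
  shows "w \<circ> v \<in> W_affA n"
proof -
  let ?N = "2 * int n"
  define r where "r = (\<lambda>y::int. (y - 1) mod ?N + 1)"
  have N: "?N > 0" using assms(1) by simp
  have pv: "periodic_perm n v" and pw: "periodic_perm n w"
    using v w by (auto simp: W_affA_def)
  have pwv: "periodic_perm n (w \<circ> v)"
    using pv pw by (auto simp: periodic_perm_def bij_comp)
  have rc: "[r y = y] (mod ?N)" for y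
    unfolding r_def cong_def by (metis add.commute diff_add_cancel mod_add_right_eq)
  have rr: "r y \<in> {1..?N}" for y
    using N pos_mod_bound[OF N, of "y - 1"] pos_mod_sign[OF N, of "y - 1"] by (simp add: r_def)
  have uniq: "x = y" if "x \<in> {1..?N}" "y \<in> {1..?N}" "[x = y] (mod ?N)" for x y
  proof -
    have "[x - 1 = y - 1] (mod ?N)" using that(3) by (rule cong_diff) simp
    then show ?thesis using that(1,2) by (simp add: cong_def)
  qed
  have inj: "inj_on (\<lambda>x. r (v x)) {1..?N}"
  proof (rule inj_onI)
    fix x y assume xy: "x \<in> {1..?N}" "y \<in> {1..?N}" "r (v x) = r (v y)"
    then have "[v x = v y] (mod ?N)" using rc by (metis cong_sym cong_trans)
    then show "x = y" using uniq xy periodic_perm_cong_iff[OF pv] by blast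
  qed
  have im: "(\<lambda>x. r (v x)) ` {1..?N} = {1..?N}"
    by (rule card_subset_eq) (use rr inj in \<open>auto simp: card_image\<close>)
  have per: "w (r y) - r y = w y - y" for y
  proof -
    from rc[of y] obtain k where k: "y = r y + ?N * k" by (auto simp: cong_iff_lin)
    then have "w y = w (r y) + ?N * k" using periodic_perm_shift[OF pw, of "r y" k] by simp
    with k show ?thesis by (metis add_diff_cancel_right)
  qed
  have "(\<Sum>x = 1..?N. w (v x) - v x) = (\<Sum>x = 1..?N. w (r (v x)) - r (v x))"
    by (simp add: per)
  also have "\<dots> = (\<Sum>y = 1..?N. w y - y)"
    using sum.reindex[OF inj, of "\<lambda>y. w y - y"] im by (simp add: o_def)
  finally have eq: "(\<Sum>x = 1..?N. w (v x) - v x) = (\<Sum>y = 1..?N. w y - y)" .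
  have shift: "total_shift n u = 0 \<longleftrightarrow> (\<Sum>x = 1..?N. u x - x) = 0" for u
  proof -
    have "total_shift n u = 1 / of_nat (2 * n) * of_int (\<Sum>x = 1..?N. u x - x)"
      by (simp add: total_shift_def)
    also have "\<dots> = 0 \<longleftrightarrow> (\<Sum>x = 1..?N. u x - x) = 0"
      using assms(1) by (simp del: of_int_sum)
    finally show ?thesis .
  qed
  have "(\<Sum>x = 1..?N. (w \<circ> v) x - x) = (\<Sum>x = 1..?N. w (v x) - v x) + (\<Sum>x = 1..?N. v x - x)"
    by (simp flip: sum.distrib)
  then have "total_shift n (w \<circ> v) = 0"
    using eq v w by (simp add: shift W_affA_def)
  with pwv show ?thesis by (simp add: W_affA_def)
qed

lemma ptransp_involution:
  assumes "\<not> [a = b] (mod 2 * int n)"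
  shows "ptransp n a b \<circ> ptransp n a b = id"
proof
  fix x
  have 1: "[x - a + b = b] (mod 2 * int n)" if "[x = a] (mod 2 * int n)"
    using that by (simp add: cong_iff_dvd_diff)
  have 2: "[x - b + a = a] (mod 2 * int n)" if "[x = b] (mod 2 * int n)"
    using that by (simp add: cong_iff_dvd_diff)
  have 3: "\<not> ([y = a] (mod 2 * int n) \<and> [y = b] (mod 2 * int n))" for y
    using assms cong_sym cong_trans by blast
  consider (A) "[x = a] (mod 2 * int n)" | (B) "[x = b] (mod 2 * int n)" "\<not> [x = a] (mod 2 * int n)"
    | (C) "\<not> [x = a] (mod 2 * int n)" "\<not> [x = b] (mod 2 * int n)" by blast
  then show "(ptransp n a b \<circ> ptransp n a b) x = id x"
  proof cases
    case A
    then have "\<not> [x - a + b = a] (mod 2 * int n)" using 1 3 by blast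
    with A 1 show ?thesis by (simp add: ptransp_def)
  next
    case B
    with 2 show ?thesis by (simp add: ptransp_def)
  next
    case C
    then show ?thesis by (simp add: ptransp_def)
  qed
qed

lemma periodic_perm_ptransp:
  assumes "\<not> [a = b] (mod 2 * int n)"
  shows "periodic_perm n (ptransp n a b)"
proof -
  have "[x + 2 * int n = y] (mod 2 * int n) \<longleftrightarrow> [x = y] (mod 2 * int n)" for x y
    by (simp add: cong_def)
  then show ?thesis
    using ptransp_involution[OF assms] unfolding periodic_perm_def
    by (auto intro: o_bij simp: ptransp_def)
qed

lemma ptransp_in_W_affA:
  assumes "n \<ge> 1" and ab: "\<not> [a = b] (mod 2 * int n)"
  shows "ptransp n a b \<in> W_affA n"
proof -
  let ?N = "2 * int n"
  have N: "?N > 0" using assms(1) by simp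
  have one: "card {x \<in> {1..?N}. [x = y] (mod ?N)} = 1" for y
  proof -
    have "{x \<in> {1..?N}. [x = y] (mod ?N)} = {(y - 1) mod ?N + 1}"
    proof (intro equalityI subsetI)
      fix x assume x: "x \<in> {x \<in> {1..?N}. [x = y] (mod ?N)}"
      then have "[x - 1 = y - 1] (mod ?N)" using cong_diff cong_refl by blast
      with x show "x \<in> {(y - 1) mod ?N + 1}" by (simp add: cong_def)
    next
      fix x assume "x \<in> {(y - 1) mod ?N + 1}"
      moreover have "[(y - 1) mod ?N + 1 = y] (mod ?N)"
        unfolding cong_def by (metis add.commute diff_add_cancel mod_add_right_eq)
      ultimately show "x \<in> {x \<in> {1..?N}. [x = y] (mod ?N)}"
        using pos_mod_bound[OF N, of "y - 1"] pos_mod_sign[OF N, of "y - 1"] by simp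
    qed
    then show ?thesis by simp
  qed
  have sum1: "(\<Sum>x = 1..?N. if [x = y] (mod ?N) then d else 0) = d" for y d :: int
    using one[of y] by (simp add: sum.If_cases Int_def)
  have "(\<Sum>x = 1..?N. ptransp n a b x - x) =
      (\<Sum>x = 1..?N. (if [x = a] (mod ?N) then b - a else 0) + (if [x = b] (mod ?N) then a - b else 0))"
    using ab by (intro sum.cong) (auto simp: ptransp_def dest: cong_sym cong_trans)
  also have "\<dots> = 0" by (simp add: sum.distrib sum1)
  finally have "(\<Sum>x = 1..?N. ptransp n a b x - x) = 0" .
  then have "total_shift n (ptransp n a b) = 0"
    unfolding total_shift_def of_int_sum[symmetric] by simp
  with periodic_perm_ptransp[OF ab] show ?thesis by (simp add: W_affA_def)
qed

lemma conjugate_ptransp: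
  assumes pw: "periodic_perm n w"
  shows "w \<circ> ptransp n a b \<circ> inv_into UNIV w = ptransp n (w a) (w b)"
proof
  fix x
  have "bij w" using pw by (simp add: periodic_perm_def)
  then obtain y where y: "x = w y" by (metis bij_pointE)
  have inv: "inv_into UNIV w (w y) = y" using \<open>bij w\<close> by (simp add: bij_is_inj)
  have move: "w (y - c + d) = w y - w c + w d" if "[y = c] (mod 2 * int n)" for c d
  proof -
    from that obtain k where k: "y = c + 2 * int n * k"
      by (metis cong_iff_lin cong_sym)
    then have "w (y - c + d) = w d + 2 * int n * k" "w y = w c + 2 * int n * k"
      using periodic_perm_shift[OF pw, of d k] periodic_perm_shift[OF pw, of c k]
      by (simp_all add: add.commute)
    then show ?thesis by simp
  qed
  show "(w \<circ> ptransp n a b \<circ> inv_into UNIV w) x = ptransp n (w a) (w b) x"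
    by (simp add: y inv ptransp_def periodic_perm_cong_iff[OF pw] move)
qed

lemma ptransp_cong:
  "ptransp n (a + 2 * int n * k) (b + 2 * int n * k) = ptransp n a b"
  by (rule ext) (auto simp: ptransp_def cong_def)

theorem refls_eq_conjugates:
  assumes n: "n \<ge> 2"
  shows "refls n =
    {w \<circ> simple_refl n i \<circ> inv_into UNIV w | w i. w \<in> W_affA n \<and> i \<in> {1..2 * int n}}"
    (is "_ = ?C")
proof (intro equalityI subsetI)
  let ?N = "2 * int n"
  have N: "?N > 0" using n by simp
  have small: "\<not> [x + d = x + e] (mod ?N)" if "d \<in> {0..2}" "e \<in> {0..2}" "d \<noteq> e" for x d e :: int
  proof
    assume "[x + d = x + e] (mod ?N)"
    then have "?N dvd d - e" by (simp add: cong_iff_dvd_diff)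
    then have "\<bar>?N\<bar> \<le> \<bar>d - e\<bar>" using that(3) by (intro dvd_imp_le_int) simp
    moreover have "\<bar>d - e\<bar> \<le> 2" using that by auto
    ultimately show False using n by simp
  qed
  fix t assume "t \<in> ?C"
  then obtain w i where t: "t = w \<circ> simple_refl n i \<circ> inv_into UNIV w" and w: "w \<in> W_affA n"
    by blast
  have pw: "periodic_perm n w" using w by (simp add: W_affA_def)
  have "\<not> [w i = w (i + 1)] (mod ?N)"
    using small[of 0 1 i] by (simp add: periodic_perm_cong_iff[OF pw])
  then show "t \<in> refls n"
    unfolding refls_def t simple_refl_def conjugate_ptransp[OF pw] by blast
next
  let ?N = "2 * int n"
  have N: "?N > 0" "n \<ge> 1" using n by simp_all
  have small: "\<not> [x + d = x + e] (mod ?N)" if "d \<in> {0..2}" "e \<in> {0..2}" "d \<noteq> e" for x d e :: int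
  proof
    assume "[x + d = x + e] (mod ?N)"
    then have "?N dvd d - e" by (simp add: cong_iff_dvd_diff)
    then have "\<bar>?N\<bar> \<le> \<bar>d - e\<bar>" using that(3) by (intro dvd_imp_le_int) simp
    moreover have "\<bar>d - e\<bar> \<le> 2" using that by auto
    ultimately show False using n by simp
  qed
  have fix_pt: "ptransp n c d c = d" "\<lbrakk>\<not> [a = c] (mod ?N); \<not> [a = d] (mod ?N)\<rbrakk> \<Longrightarrow> ptransp n c d a = a"
    for a c d by (simp_all add: ptransp_def)
  fix t assume "t \<in> refls n"
  then obtain a b where t: "t = ptransp n a b" and ab: "\<not> [a = b] (mod ?N)"
    by (auto simp: refls_def)
  have step: "\<exists>v \<in> W_affA n. v a = a \<and> v (a + 1) = c"
    if ac: "\<not> [a = c] (mod ?N)" "\<not> [c = a + 1] (mod ?N)" for c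
  proof (intro bexI conjI)
    have "\<not> [a + 1 = c] (mod ?N)" using ac(2) cong_sym by blast
    then show "ptransp n (a + 1) c \<in> W_affA n" by (rule ptransp_in_W_affA[OF N(2)])
    show "ptransp n (a + 1) c a = a"
      using ac(1) small[of 0 1 a] by (intro fix_pt) simp_all
  qed (rule fix_pt)
  have "\<exists>v \<in> W_affA n. v a = a \<and> v (a + 1) = b"
  proof (cases "[b = a + 1] (mod ?N)")
    case False
    then show ?thesis using step ab by blast
  next
    case True
    have a2: "\<not> [a = a + 2] (mod ?N)" "\<not> [a + 2 = a + 1] (mod ?N)"
      using small[of 0 2 a] small[of 2 1 a] by simp_all
    then obtain v where v: "v \<in> W_affA n" "v a = a" "v (a + 1) = a + 2" using step by blast
    have b2: "\<not> [a + 2 = b] (mod ?N)" using a2(2) True cong_trans by blast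
    have "ptransp n (a + 2) b \<circ> v \<in> W_affA n"
      by (intro W_affA_comp ptransp_in_W_affA N(2) v(1) b2)
    moreover have "(ptransp n (a + 2) b \<circ> v) a = a" "(ptransp n (a + 2) b \<circ> v) (a + 1) = b"
      using v fix_pt(2)[OF a2(1) ab] by (simp_all add: fix_pt(1))
    ultimately show ?thesis by blast
  qed
  then obtain v where v: "v \<in> W_affA n" "v a = a" "v (a + 1) = b" by blast
  then have pv: "periodic_perm n v" by (simp add: W_affA_def)
  define i k where "i = (a - 1) mod ?N + 1" and "k = (a - 1) div ?N"
  have a: "a = i + ?N * k"
    unfolding i_def k_def using mult_div_mod_eq[of ?N "a - 1"] by linarith
  have i: "i \<in> {1..?N}"
    using pos_mod_bound[OF N(1), of "a - 1"] pos_mod_sign[OF N(1), of "a - 1"] by (simp add: i_def)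
  have "simple_refl n i = ptransp n a (a + 1)"
    using ptransp_cong[of n i k "i + 1"] by (simp add: simple_refl_def a algebra_simps)
  then have "t = v \<circ> simple_refl n i \<circ> inv_into UNIV v"
    using conjugate_ptransp[OF pv, of a "a + 1"] v t by simp
  then show "t \<in> ?C" using v(1) i by blast
qed

text \<open>The action of a product of commuting simple reflections, all of whose indices have the same
  parity.\<close>

lemma comp_list_simple_refl:
  assumes n: "n \<ge> 1" and js: "distinct js" "set js \<subseteq> {1..int n}"
  shows "comp_list (map (\<lambda>j. simple_refl n (2 * j - d)) js) x =
    (if \<exists>j\<in>set js. [x = 2 * j - d] (mod 2 * int n) then x + 1
     else if \<exists>j\<in>set js. [x = 2 * j - d + 1] (mod 2 * int n) then x - 1 else x)"
  using js
proof (induction js)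
  case Nil
  then show ?case by simp
next
  case (Cons j js)
  let ?N = "2 * int n"
  let ?P = "\<lambda>x j. [x = 2 * j - d] (mod ?N)" and ?Q = "\<lambda>x j. [x = 2 * j - d + 1] (mod ?N)"
  have diff: "i = i'" if "?N dvd 2 * i - 2 * i'" "i \<in> {1..int n}" "i' \<in> {1..int n}" for i i'
  proof -
    have "2 * i - 2 * i' = 2 * (i - i')" by simp
    with that(1) have "int n dvd i - i'" by (simp only: dvd_mult_cancel_left) simp
    then have "int n dvd (i - 1) - (i' - 1)" by simp
    then have "(i - 1) mod int n = (i' - 1) mod int n" by (simp only: mod_eq_dvd_iff)
    then show ?thesis using that(2,3) by simp
  qed
  have PP: "i = i'" if "?P x i" "?P x i'" "i \<in> {1..int n}" "i' \<in> {1..int n}" for x i i'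
  proof -
    have "[2 * i - d = 2 * i' - d] (mod ?N)" using that(1,2) cong_sym cong_trans by blast
    then show ?thesis using diff that(3,4) by (simp add: cong_iff_dvd_diff)
  qed
  have PQ: "\<not> (?P x i \<and> ?Q x i')" for x i i'
  proof
    assume "?P x i \<and> ?Q x i'"
    then have "[2 * i - d = 2 * i' - d + 1] (mod ?N)" using cong_sym cong_trans by blast
    then have "?N dvd 2 * (i - i') - 1" by (simp add: cong_iff_dvd_diff algebra_simps)
    then have "2 dvd 2 * (i - i') - 1" using dvd_mult_left by blast
    then show False by presburger
  qed
  have sh: "?Q (x + 1) i \<longleftrightarrow> ?P x i" "?P (x - 1) i \<longleftrightarrow> ?Q x i" for x i
    by (simp_all add: cong_iff_dvd_diff algebra_simps)
  have s: "simple_refl n (2 * j - d) x = (if ?P x j then x + 1 else if ?Q x j then x - 1 else x)" for x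
    by (auto simp: simple_refl_def ptransp_def)
  have IH: "comp_list (map (\<lambda>j. simple_refl n (2 * j - d)) js) x =
    (if \<exists>j\<in>set js. ?P x j then x + 1 else if \<exists>j\<in>set js. ?Q x j then x - 1 else x)"
    by (rule Cons.IH) (use Cons.prems in auto)
  have hd: "comp_list (map (\<lambda>j. simple_refl n (2 * j - d)) (j # js)) x =
    simple_refl n (2 * j - d) (comp_list (map (\<lambda>j. simple_refl n (2 * j - d)) js) x)" by simp
  have j: "j \<in> {1..int n}" "j \<notin> set js" "\<And>i. i \<in> set js \<Longrightarrow> i \<in> {1..int n}"
    using Cons.prems by auto
  consider (P) i where "i \<in> set js" "?P x i" | (Q) i where "i \<in> set js" "?Q x i"
    | (N) "\<forall>i\<in>set js. \<not> ?P x i \<and> \<not> ?Q x i" by blast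
  then have "simple_refl n (2 * j - d)
      (if \<exists>j\<in>set js. ?P x j then x + 1 else if \<exists>j\<in>set js. ?Q x j then x - 1 else x) =
    (if \<exists>j\<in>set (j # js). ?P x j then x + 1 else if \<exists>j\<in>set (j # js). ?Q x j then x - 1 else x)"
  proof cases
    case P
    then have 1: "?Q (x + 1) i" "\<not> ?P x j" using sh PP j by blast+
    then have "\<not> ?P (x + 1) j" "\<not> ?Q (x + 1) j" using PQ sh by blast+
    then have "simple_refl n (2 * j - d) (x + 1) = x + 1" by (simp add: s)
    moreover have "\<exists>i\<in>set js. ?P x i" using P by blast
    ultimately show ?thesis by simp
  next
    case Q
    then have 1: "?P (x - 1) i" "\<not> ?P x j" using sh PQ by blast+
    have 2: "\<not> ?P (x - 1) j" using PP[OF 1(1)] Q j by blast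
    have 3: "\<not> ?Q (x - 1) j" using PQ 1 by blast
    have "simple_refl n (2 * j - d) (x - 1) = x - 1" using 2 3 by (simp add: s)
    moreover have "\<exists>i\<in>set js. ?Q x i" "\<not> (\<exists>i\<in>set js. ?P x i)" using Q PQ by blast+
    ultimately show ?thesis using 1 by simp
  next
    case N
    then show ?thesis using s[of x] by auto
  qed
  with hd IH show ?case by (simp only:)
qed

theorem coxeter_elt_eq:
  assumes n: "n \<ge> 1"
  shows "coxeter_elt n i = (if odd i then i + 2 else i - 2)"
proof -
  let ?N = "2 * int n"
  have ex: "\<exists>j\<in>set [1..int n]. [x = 2 * j - d] (mod ?N)" if "even (x + d)" for x d :: int
  proof -
    from that obtain m where m: "x = 2 * m - d" by (metis add_diff_cancel_right' evenE)
    define j where "j = (m - 1) mod int n + 1"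
    have pos: "int n > 0" using n by simp
    have "j \<in> {1..int n}"
      using pos_mod_bound[OF pos, of "m - 1"] pos_mod_sign[OF pos, of "m - 1"] by (simp add: j_def)
    moreover have "x = 2 * j - d + ?N * ((m - 1) div int n)"
    proof -
      have "m - 1 = int n * ((m - 1) div int n) + (m - 1) mod int n" by simp
      then have "m = int n * ((m - 1) div int n) + j" unfolding j_def by linarith
      then show ?thesis unfolding m by (metis (no_types, lifting) add.commute distrib_left
        add_diff_eq mult.assoc)
    qed
    then have "[x = 2 * j - d] (mod ?N)" by (metis cong_iff_lin cong_sym)
    ultimately show ?thesis by auto
  qed
  have par: "even (x + d)" if "[x = 2 * j - d] (mod ?N)" for x d j :: int
  proof -
    have "2 dvd x - (2 * j - d)" using that unfolding cong_iff_dvd_diff using dvd_mult_left by blast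
    then show ?thesis by presburger
  qed
  have ex': "(\<exists>j\<in>set [1..int n]. [x = 2 * j - d] (mod ?N)) \<longleftrightarrow> even (x + d)" for x d :: int
    using ex par by blast
  have ex1: "(\<exists>j\<in>set [1..int n]. [x = 2 * j - d + 1] (mod ?N)) \<longleftrightarrow> odd (x + d)" for x d :: int
    using ex'[of x "d - 1"] by (simp add: algebra_simps)
  have blk: "comp_list (map (\<lambda>j. simple_refl n (2 * j - d)) [1..int n]) x =
      (if even (x + d) then x + 1 else x - 1)" for d x
    by (subst comp_list_simple_refl[OF n]) (simp_all only: ex' ex1, simp_all)
  have app: "comp_list (us @ vs) = comp_list us \<circ> comp_list vs" for us vs :: "(int \<Rightarrow> int) list"
    by (induction us) (simp_all add: comp_assoc)
  show ?thesis
  proof -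
    have "coxeter_elt n i = comp_list (map (\<lambda>j. simple_refl n (2 * j - 0)) [1..int n])
        (comp_list (map (\<lambda>j. simple_refl n (2 * j - 1)) [1..int n]) i)"
      unfolding coxeter_elt_def app by simp
    then show ?thesis unfolding blk by simp
  qed
qed

lemma sigma_simple_refl:
  assumes "n \<ge> 1"
  shows "sigma (simple_refl n i) = simple_refl n (2 * int n - i)"
proof
  fix x
  have nt: "\<not> [i = i + 1] (mod 2 * int n)" for i
    using assms by (auto simp: cong_iff_dvd_diff)
  have 1: "[1 - x = i] (mod 2 * int n) \<longleftrightarrow> [x = 2 * int n - i + 1] (mod 2 * int n)"
  proof -
    have "[1 - x = i] (mod 2 * int n) \<longleftrightarrow> 2 * int n dvd - (1 - x - i)"
      unfolding cong_iff_dvd_diff by (rule dvd_minus_iff[symmetric])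
    also have "- (1 - x - i) = (x - (2 * int n - i + 1)) + 2 * int n" by simp
    finally show ?thesis unfolding cong_iff_dvd_diff by (simp only: dvd_add_left_iff dvd_refl)
  qed
  have 2: "[1 - x = i + 1] (mod 2 * int n) \<longleftrightarrow> [x = 2 * int n - i] (mod 2 * int n)"
  proof -
    have "[1 - x = i + 1] (mod 2 * int n) \<longleftrightarrow> 2 * int n dvd - (1 - x - (i + 1))"
      unfolding cong_iff_dvd_diff by (rule dvd_minus_iff[symmetric])
    also have "- (1 - x - (i + 1)) = (x - (2 * int n - i)) + 2 * int n" by simp
    finally show ?thesis unfolding cong_iff_dvd_diff by (simp only: dvd_add_left_iff dvd_refl)
  qed
  have 3: "\<not> ([x = 2 * int n - i] (mod 2 * int n) \<and> [x = 2 * int n - i + 1] (mod 2 * int n))"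
    using nt cong_sym cong_trans by blast
  show "sigma (simple_refl n i) x = simple_refl n (2 * int n - i) x"
    using 3 by (auto simp: sigma_def simple_refl_def ptransp_def 1 2)
qed

end

theory Submission
  imports Defs
begin

text \<open>Place the odd integers, increasing, before the even integers, decreasing, and regard this
  as a cyclic order on the boundary of a strip, the universal cover of an annulus; then \<open>c\<close> is the
  successor map. An element \<open>w\<close> of the group divides \<open>c\<close> if and only if it is
  noncrossing: no arc from \<open>a\<close> to \<open>w a\<close> separates a point \<open>x\<close> from \<open>w x\<close>. For divisors \<open>v\<close> and
  \<open>w\<close> of \<open>c\<close>, \<open>v\<close> divides \<open>w\<close> if and only if no arc from \<open>a\<close> to \<open>w a\<close> separates a point \<open>x\<close>
  from \<open>v x\<close>.

  Both facts are obtained by moving down from \<open>c\<close> one reflection at a time. Lengths are controlled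
  by the dimension of the space of \<open>w\<close>-invariant functions \<open>h\<close> on the integers with
  \<open>h (x + 2n) = 2 h x\<close>: it has dimension \<open>2n\<close> for the identity and \<open>0\<close> for \<open>c\<close>, and it changes by at
  most one on multiplication by a reflection.

  For a set \<open>M\<close> of \<open>\<sigma>\<close>-fixed divisors of \<open>c\<close>, call two points equivalent if no arc from \<open>a\<close> to
  \<open>m a\<close> with \<open>m \<in> M\<close> separates them. The map sending each point to the next point of its class is
  noncrossing and \<open>\<sigma>\<close>-fixed, hence of total shift \<open>0\<close>, and it is the greatest lower bound of \<open>M\<close>.
  Without \<open>\<sigma>\<close>-invariance the total shift may fail to vanish. Taking for \<open>M\<close> the common upper bounds
  of two elements gives their least common multiple.\<close>

section \<open>Arcs and gaps\<close>

text \<open>Only the order of the values matters: \<open>arctan\<close> places the odd integers, increasing, before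
  the even ones, decreasing.\<close>

definition pos :: "int \<Rightarrow> real" where
  "pos x = (if odd x then arctan (of_int x) else 10 - arctan (of_int x))"

lemma pos_less_iff:
  "pos x < pos y \<longleftrightarrow> (if odd x then even y \<or> x < y else even y \<and> y < x)"
proof -
  define f :: "int \<Rightarrow> real" where "f = (\<lambda>z. arctan (of_int z))"
  have bound: "- 2 < f z" "f z < 2" for z
    using arctan_lbound[of "of_int z"] arctan_ubound[of "of_int z"] pi_less_4
    unfolding f_def by linarith+
  have "10 - f x < 10 - f y \<longleftrightarrow> f y < f x" "f x < 10 - f y" "\<not> 10 - f x < f y"
    using bound[of x] bound[of y] by linarith+
  moreover have "f x < f y \<longleftrightarrow> x < y" "f y < f x \<longleftrightarrow> y < x"
    unfolding f_def by (simp_all only: arctan_less_iff of_int_less_iff)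
  ultimately show ?thesis
    unfolding pos_def f_def[symmetric] fun_cong[OF f_def, symmetric] by argo
qed

lemma pos_eq_iff: "pos x = pos y \<longleftrightarrow> x = y"
proof
  assume "pos x = pos y"
  then have "\<not> pos x < pos y" "\<not> pos y < pos x" by simp_all
  then show "x = y" unfolding pos_less_iff by (auto split: if_splits)
qed simp

text \<open>The degenerate arc from \<open>a\<close> to \<open>a\<close> consists of all points except \<open>a\<close>.\<close>

definition arc :: "int \<Rightarrow> int \<Rightarrow> int \<Rightarrow> bool" where
  "arc a c b \<longleftrightarrow> (if pos a < pos c then pos a < pos b \<and> pos b < pos c
     else pos a < pos b \<or> pos b < pos c)"

text \<open>Splitting by parity replaces the real-valued \<open>pos\<close> by linear inequalities
  between integers, so that later claims about arcs reduce to case distinctions and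
  arithmetic.\<close>

lemma arc_simp:
  "arc a c b \<longleftrightarrow> (if odd a then
      (if odd c then (if a < c then odd b \<and> a < b \<and> b < c else even b \<or> a < b \<or> b < c)
       else (if odd b then a < b else c < b))
    else (if odd c then (if odd b then b < c else b < a)
       else (if c < a then even b \<and> c < b \<and> b < a else odd b \<or> c < b \<or> b < a)))"
  by (auto simp: arc_def pos_less_iff)

lemma arc_translate: "even d \<Longrightarrow> arc (a + d) (c + d) (b + d) \<longleftrightarrow> arc a c b"
  by (simp add: arc_simp)

text \<open>The map i -> 1 - i exchanges the increasing odd row with the decreasing even row, so it
  preserves the cyclic order.\<close>

lemma arc_mirror: "arc (1 - a) (1 - c) (1 - b) \<longleftrightarrow> arc a c b"
  unfolding arc_simp by auto

lemma arc_endpoints [simp]: "\<not> arc a c a" "\<not> arc a c c"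
  by (auto simp: arc_def)

text \<open>For a single periodic noncrossing \<open>w\<close> the classes are the blocks of its
  noncrossing partition: the finite orbits, and all infinite orbits together as one class.\<close>

definition same_gaps :: "(int \<Rightarrow> int) set \<Rightarrow> int \<Rightarrow> int \<Rightarrow> bool" where
  "same_gaps M x y \<longleftrightarrow> (\<forall>m\<in>M. \<forall>a. arc a (m a) x \<longleftrightarrow> arc a (m a) y)"

abbreviation gaprel :: "(int \<Rightarrow> int) \<Rightarrow> int \<Rightarrow> int \<Rightarrow> bool" where
  "gaprel w \<equiv> same_gaps {w}"

text \<open>In particular \<open>below w w\<close> says that \<open>w\<close> is noncrossing.\<close>

definition below :: "(int \<Rightarrow> int) \<Rightarrow> (int \<Rightarrow> int) \<Rightarrow> bool" where
  "below v w \<longleftrightarrow> (\<forall>x. gaprel w x (v x))"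

lemma same_gaps_refl [simp]: "same_gaps M x x"
  by (simp add: same_gaps_def)

lemma same_gaps_sym: "same_gaps M x y \<Longrightarrow> same_gaps M y x"
  by (auto simp: same_gaps_def)

lemma same_gaps_trans [trans]: "same_gaps M x y \<Longrightarrow> same_gaps M y z \<Longrightarrow> same_gaps M x z"
  by (auto simp: same_gaps_def)

lemma gaprel_iff: "gaprel w x y \<longleftrightarrow> (\<forall>a. arc a (w a) x \<longleftrightarrow> arc a (w a) y)"
  by (simp add: same_gaps_def)

text \<open>Every arc is a cyclic interval, so it cannot separate one pair of points from another
  pair with which it interleaves.\<close>

lemma same_gaps_noncrossing:
  assumes "same_gaps M a a'" "same_gaps M b b'" "arc a a' b" "arc a' a b'" "a \<noteq> a'"
  shows "same_gaps M a b"
proof (rule ccontr)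
  assume "\<not> same_gaps M a b"
  then obtain m o' where "m \<in> M" "arc o' (m o') a \<noteq> arc o' (m o') b"
    unfolding same_gaps_def by blast
  then have *: "arc o' (m o') a = arc o' (m o') a'" "arc o' (m o') b = arc o' (m o') b'"
     "arc o' (m o') a \<noteq> arc o' (m o') b"
    using assms unfolding same_gaps_def by blast+
  have ne: "pos a \<noteq> pos a'" using assms(5) pos_eq_iff by simp
  show False
    using * assms(3,4) ne unfolding arc_def
    by (smt (verit))
qed

locale affA =
  fixes n :: nat
  assumes n_pos: "n \<ge> 1"
begin

abbreviation L :: int where "L \<equiv> 2 * int n"

lemma same_gaps_translate:
  assumes "\<And>m. m \<in> M \<Longrightarrow> periodic_perm n m" "same_gaps M x y"
  shows "same_gaps M (x + L * k) (y + L * k)"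
  unfolding same_gaps_def
proof (intro ballI allI)
  fix m a assume m: "m \<in> M"
  have "m (a - L * k + L * k) = m (a - L * k) + L * k"
    using periodic_perm_shift[OF assms(1)[OF m]] by blast
  then have "arc a (m a) (z + L * k) \<longleftrightarrow> arc (a - L * k) (m (a - L * k)) z" for z
    using arc_translate[of "L * k" "a - L * k" "m (a - L * k)" z] by simp
  then show "arc a (m a) (x + L * k) \<longleftrightarrow> arc a (m a) (y + L * k)"
    using assms(2) m by (simp add: same_gaps_def)
qed

lemma same_gaps_translate_iff:
  assumes "\<And>m. m \<in> M \<Longrightarrow> periodic_perm n m"
  shows "same_gaps M (x + L * k) (y + L * k) \<longleftrightarrow> same_gaps M x y"
  using same_gaps_translate[OF assms, of M x y k] same_gaps_translate[OF assms, of M "x + L * k" "y + L * k" "- k"]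
  by auto

text \<open>A class meeting its translate by \<open>k\<close> periods would cross its translate by one period.\<close>

lemma same_gaps_period:
  assumes M: "\<And>m. m \<in> M \<Longrightarrow> periodic_perm n m" and "same_gaps M x y"
    and "even (x - y)" "\<bar>x - y\<bar> \<ge> L"
  shows "same_gaps M x (x + L)"
proof -
  have main: "same_gaps M u (u + L)" if uv: "same_gaps M u v" "even (u - v)" "v \<ge> u + L" for u v
  proof (cases "v = u + L")
    case False
    have uv': "same_gaps M (u + L) (v + L)"
      using same_gaps_translate[OF M uv(1), of 1] by simp
    have "v > u + L" "L > 0" using False uv(3) n_pos by auto
    then have "odd u \<Longrightarrow> arc u v (u + L)" "odd u \<Longrightarrow> arc v u (v + L)"
       "even u \<Longrightarrow> arc v u (u + L)" "even u \<Longrightarrow> arc u v (v + L)" "u \<noteq> v"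
      using uv(2) by (auto simp: arc_simp)
    then show ?thesis
      using same_gaps_noncrossing[OF uv(1) uv'] uv(1)
        same_gaps_noncrossing[OF same_gaps_sym[OF uv(1)] uv'] same_gaps_trans by (cases "odd u") blast+
  qed (use that in simp)
  show ?thesis
  proof (cases "x \<le> y")
    case True
    then show ?thesis using main[of x y] assms by simp
  next
    case False
    then have "same_gaps M y (y + L)"
      using main[of y x] assms same_gaps_sym by simp
    moreover have "same_gaps M (x + L) (y + L)"
      using same_gaps_translate[OF M assms(2), of 1] by simp
    ultimately show ?thesis
      using assms(2) same_gaps_trans same_gaps_sym by blast
  qed
qed

end

section \<open>Cutting a noncrossing permutation by a reflection\<close>

text \<open>Crossing of two arcs is a symmetric relation. The excluded coincidences are a common
  starting point and a common end point, where openness of the arcs breaks the symmetry.\<close>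

lemma arc_cross:
  assumes "x \<noteq> b" "b' \<noteq> y'" "arc b b' x \<longleftrightarrow> arc b b' y'"
  shows "arc x y' b \<longleftrightarrow> arc x y' b'"
proof -
  have "pos x \<noteq> pos b" "pos b' \<noteq> pos y'" using assms by (simp_all add: pos_eq_iff)
  with assms(3) show ?thesis unfolding arc_def by argo
qed

lemma arc_complement: "a \<noteq> c \<Longrightarrow> b \<noteq> a \<Longrightarrow> b \<noteq> c \<Longrightarrow> arc a c b \<longleftrightarrow> \<not> arc c a b"
  using pos_eq_iff[of a c] pos_eq_iff[of b a] pos_eq_iff[of b c] unfolding arc_def by argo

lemma arc_degenerate: "arc a a b \<longleftrightarrow> b \<noteq> a"
  using pos_eq_iff[of a b] unfolding arc_def by argo

text \<open>Otherwise the pairs \<open>x\<close>, \<open>y\<close> and \<open>p\<close>,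
  \<open>q\<close> would interleave, and their classes would coincide.\<close>

lemma same_gaps_arc:
  assumes xy: "same_gaps M x y" and pq: "same_gaps M p q" and "\<not> same_gaps M x p"
  shows "arc x y p \<longleftrightarrow> arc x y q"
proof (cases "x = y")
  case True
  moreover have "p \<noteq> x" "q \<noteq> x" using assms same_gaps_sym same_gaps_refl by blast+
  ultimately show ?thesis by (simp add: arc_degenerate)
next
  case False
  have "p \<noteq> x" "p \<noteq> y" "q \<noteq> x" "q \<noteq> y"
    using assms same_gaps_sym same_gaps_trans by blast+
  moreover have "\<not> same_gaps M x q" using assms same_gaps_sym same_gaps_trans by blast
  ultimately show ?thesis
    using same_gaps_noncrossing[OF xy pq] same_gaps_noncrossing[OF xy same_gaps_sym[OF pq]]
      assms(3) False arc_complement by blast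
qed

context affA
begin

lemma periodic_perm_bij: "periodic_perm n w \<Longrightarrow> bij w"
  by (simp add: periodic_perm_def)

section \<open>Classes that contain translates of their own points\<close>

lemma gaprel_period:
  assumes "periodic_perm n w" "gaprel w x y" "even (x - y)" "\<bar>x - y\<bar> \<ge> L"
  shows "gaprel w x (x + L)"
  using same_gaps_period[of "{w}"] assms by simp

lemma gaprel_translate_iff:
  "periodic_perm n w \<Longrightarrow> gaprel w (x + L * k) (y + L * k) \<longleftrightarrow> gaprel w x y"
  using same_gaps_translate_iff[of "{w}"] by simp

lemma gaprel_period_all:
  assumes "periodic_perm n w" "gaprel w x (x + L)"
  shows "gaprel w x (x + L * k)"
proof -
  have "gaprel w (x + L * j) (x + L * (j + 1))" for j
    using gaprel_translate_iff[OF assms(1), of x j "x + L"] assms(2) by (simp add: algebra_simps)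
  then show ?thesis
  proof (induction k rule: int_induct[where k = 0])
    case (step1 i) then show ?case using same_gaps_trans by blast
  next
    case (step2 i)
    have "gaprel w (x + L * (i - 1)) (x + L * i)" using step2(3)[of "i - 1"] by simp
    then show ?case using step2 same_gaps_trans same_gaps_sym by blast
  qed simp
qed

text \<open>The direction in which the cyclic order runs along the odd, resp. the even integers.\<close>

definition dir :: "int \<Rightarrow> int" where "dir x = (if odd x then 1 else - 1)"

text \<open>No arc contains its starting point \<open>x\<close>, so this arc also misses the
  equivalent points \<open>x + L\<close> and \<open>x - L\<close>. An arc missing both stays in the
  row of \<open>x\<close> and advances by at most one period.\<close>

lemma period_class_step:
  assumes "periodic_perm n w" "below w w" "gaprel w x (x + L)"
  shows "even (w x - x)" "dir x * x < dir x * w x" "dir x * w x \<le> dir x * x + L"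
proof -
  have "gaprel w x (x + L * (- 1))" "L > 0"
    using gaprel_period_all[OF assms(1,3)] n_pos by (blast, simp)
  moreover have "\<not> arc x (w x) x" by simp
  ultimately have *: "\<not> arc x (w x) (x + L)" "\<not> arc x (w x) (x - L)" "L > 0"
    using assms(3) unfolding gaprel_iff by (blast, metis add_uminus_conv_diff mult_minus1_right, simp)
  have "even (w x - x) \<and> dir x * x < dir x * w x \<and> dir x * w x \<le> dir x * x + L"
  proof (cases "w x = x")
    case True
    then show ?thesis using * by (simp add: arc_degenerate)
  next
    case False
    then show ?thesis using * unfolding arc_simp dir_def by (auto split: if_splits)
  qed
  then show "even (w x - x)" "dir x * x < dir x * w x" "dir x * w x \<le> dir x * x + L"
    by blast+
qed

text \<open>Far out in the strip both classes have points beyond the endpoints of any given arc.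
  There the two rows are adjacent in the cyclic order, so the arc cannot separate the
  classes.\<close>

lemma period_class_all:
  assumes pw: "periodic_perm n w" and x: "gaprel w x (x + L)" and y: "gaprel w y (y + L)"
  shows "gaprel w x y"
proof (rule ccontr)
  assume "\<not> gaprel w x y"
  then obtain a where a: "arc a (w a) x \<noteq> arc a (w a) y" unfolding gaprel_iff by blast
  have X: "arc a (w a) (x + L * k) = arc a (w a) x" "arc a (w a) (y + L * k) = arc a (w a) y" for k
    using gaprel_period_all[OF pw x, of k] gaprel_period_all[OF pw y, of k]
    unfolding gaprel_iff by auto
  define K where "K = \<bar>x\<bar> + \<bar>y\<bar> + \<bar>a\<bar> + \<bar>w a\<bar> + 1"
  have L1: "L * K \<ge> K" using n_pos K_def by (simp add: mult_le_cancel_right1)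
  have e: "even (x + L * K) = even x" "even (x - L * K) = even x"
    "even (y + L * K) = even y" "even (y - L * K) = even y" by auto
  define D where "D = L * K"
  have "D \<ge> K" using L1 D_def by simp
  then have "D > \<bar>x\<bar> + \<bar>a\<bar>" "D > \<bar>x\<bar> + \<bar>w a\<bar>" "D > \<bar>y\<bar> + \<bar>a\<bar>" "D > \<bar>y\<bar> + \<bar>w a\<bar>"
    unfolding K_def by linarith+
  then have b: "x + L * K > a" "x + L * K > w a" "y + L * K > a" "y + L * K > w a"
    "x - L * K < a" "x - L * K < w a" "y - L * K < a" "y - L * K < w a"
    unfolding D_def[symmetric] by linarith+
  have "arc a (w a) (x + L * K) = arc a (w a) x" "arc a (w a) (y + L * K) = arc a (w a) y"
    "arc a (w a) (x - L * K) = arc a (w a) x" "arc a (w a) (y - L * K) = arc a (w a) y"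
    using X[of K] X[of "- K"] by auto
  then show False
    using a b unfolding arc_simp e by smt
qed

section \<open>Products of a noncrossing permutation with a transposition\<close>

lemma ptransp_simps:
  assumes "\<not> [x = y] (mod L)"
  shows "ptransp n x y (x + L * k) = y + L * k" "ptransp n x y (y + L * k) = x + L * k"
    "\<not> [z = x] (mod L) \<Longrightarrow> \<not> [z = y] (mod L) \<Longrightarrow> ptransp n x y z = z"
proof -
  have *: "[a + L * k = a] (mod L)" for a by (simp add: cong_iff_dvd_diff)
  then have "\<not> [y + L * k = x] (mod L)" using assms cong_sym cong_trans by blast
  with * show "ptransp n x y (x + L * k) = y + L * k" "ptransp n x y (y + L * k) = x + L * k"
    by (simp_all add: ptransp_def)
qed (simp add: ptransp_def)

lemma cong_cases:
  fixes x y z :: int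
  obtains (x) k where "z = x + L * k" | (y) k where "z = y + L * k"
  | (other) "\<not> [z = x] (mod L)" "\<not> [z = y] (mod L)"
  by (metis cong_iff_lin cong_sym)

lemma ptransp_involution:
  assumes xy: "\<not> [x = y] (mod L)"
  shows "ptransp n x y (ptransp n x y b) = b"
  using ptransp_simps[OF xy] by (cases rule: cong_cases[where z = b and x = x and y = y]) simp_all

text \<open>For noncrossing \<open>w\<close> these are the pairs whose transposition enlarges the
  space of invariant functions, see \<open>splits_rank\<close> and \<open>rank_splits\<close>. The
  distance bound discards the pairs that cut an infinite orbit into two infinite ones.\<close>

definition splits :: "(int \<Rightarrow> int) \<Rightarrow> int \<Rightarrow> int \<Rightarrow> bool" where
  "splits w x y \<longleftrightarrow> \<not> [x = y] (mod L) \<and> gaprel w x y \<and> (even (x - y) \<longrightarrow> \<bar>x - y\<bar> < L)"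

lemma splits_sym: "splits w x y \<Longrightarrow> splits w y x"
  using same_gaps_sym cong_sym by (fastforce simp: splits_def)

lemma ptransp_commute:
  assumes "\<not> [x = y] (mod L)"
  shows "ptransp n x y = ptransp n y x"
  using assms by (intro ext) (auto simp: ptransp_def dest: cong_sym cong_trans)

text \<open>Neither of the arcs of \<open>w\<close> leaving \<open>x\<close> and \<open>y\<close>
  contains the other point, so the cyclic order is \<open>x\<close>, \<open>w x\<close>,
  \<open>y\<close>, \<open>w y\<close>, where \<open>w x = y\<close> and \<open>w y = x\<close> are
  allowed.\<close>

lemma splits_arc_mem:
  assumes pw: "periodic_perm n w" and nc: "below w w" and s: "splits w x y"
  shows "arc x (w y) y" "arc x (w y) (w x)"
proof -
  have xy: "x \<noteq> y" and g: "gaprel w x y" using s by (auto simp: splits_def)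
  have "\<not> arc x (w x) x" "\<not> arc y (w y) y" by simp_all
  then have *: "\<not> arc x (w x) y" "\<not> arc y (w y) x" using g unfolding gaprel_iff by blast+
  have "w x \<noteq> w y" using xy pw by (metis bij_is_inj injD periodic_perm_bij)
  then have "pos x \<noteq> pos y" "pos (w x) \<noteq> pos (w y)" using xy by (simp_all add: pos_eq_iff)
  then show "arc x (w y) y" "arc x (w y) (w x)" using * unfolding arc_def by argo+
qed

text \<open>The new arc joins equivalent points. Translates of \<open>x\<close> and \<open>y\<close>
  in other classes are handled by \<open>same_gaps_arc\<close>, those in the class of
  \<open>x\<close> by explicit bounds; any other \<open>b\<close> keeps its image under
  \<open>w\<close>, and symmetry of crossing applies.\<close>

lemma splits_arc:
  assumes pw: "periodic_perm n w" and nc: "below w w" and s: "splits w x y"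
  shows "arc x (w y) b \<longleftrightarrow> arc x (w y) (w (ptransp n x y b))"
proof -
  have xy: "\<not> [x = y] (mod L)" and g: "gaprel w x y" and d: "even (x - y) \<longrightarrow> \<bar>x - y\<bar> < L"
    using s by (auto simp: splits_def)
  have gw: "gaprel w z (w z)" for z using nc by (simp add: below_def)
  have gwy: "gaprel w x (w y)" using g gw same_gaps_trans by blast
  note t = ptransp_simps[OF xy]
  have shift: "w (z + L * k) = w z + L * k" for z k using periodic_perm_shift[OF pw] .
  \<comment> \<open>When the class contains translates of its own points, noncrossing of distinct
    classes says nothing about the translates of \<open>x\<close> and \<open>y\<close>. Their
    positions follow from \<open>period_class_step\<close> and the distance bound in
    \<open>splits\<close>.\<close>
  have period: "(arc x (w y) (x + L * k) \<longleftrightarrow> arc x (w y) (w y + L * k)) \<and>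
      (arc x (w y) (y + L * k) \<longleftrightarrow> arc x (w y) (w x + L * k))" if x: "gaprel w x (x + L)" and k: "k \<noteq> 0" for k
  proof -
    have "gaprel w (x + L) (y + L)" using gaprel_translate_iff[OF pw, of x 1 y] g by simp
    then have y: "gaprel w y (y + L)" using g x same_gaps_sym same_gaps_trans by blast
    note sx = period_class_step[OF pw nc x] and sy = period_class_step[OF pw nc y]
    have r: "gaprel w y (x + L * j)" "gaprel w x (y + L * j)" for j
      using gaprel_period_all[OF pw x] gaprel_period_all[OF pw y] g same_gaps_sym same_gaps_trans by blast+
    have "\<not> arc x (w x) x" "\<not> arc y (w y) y" by simp_all
    then have *: "\<not> arc x (w x) (y + L * j)" "\<not> arc y (w y) (x + L * j)" for j
      using r unfolding gaprel_iff by blast+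
    have **: "\<not> arc x (w x) (y + L)" "\<not> arc y (w y) (x + L)" "\<not> arc x (w x) (y - L)" "\<not> arc y (w y) (x - L)"
      using *[of 1] *[of "- 1"] by simp_all
    define d where "d = L * k"
    have "L > 0" using n_pos by simp
    then have "L * 1 \<le> L * k \<or> L * k \<le> L * (- 1)"
      using k by (simp only: mult_le_cancel_left) linarith
    then have dk: "d \<ge> L \<or> d \<le> - L" and e: "even d" unfolding d_def by auto
    have e: "even (x + d) = even x" "even (y + d) = even y" "even (w x) = even x" "even (w y) = even y"
       "even (w x + d) = even x" "even (w y + d) = even y" "even (x + L) = even x" "even (y + L) = even y"
       "even (x - L) = even x" "even (y - L) = even y" "even (x - y) \<longleftrightarrow> even x = even y"
      using e sx(1) sy(1) by auto
    \<comment> \<open>The parities are settled by \<open>e\<close>; of the period only its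
      positivity remains relevant, so it becomes a variable.\<close>
    obtain l where l: "l = L" by blast
    have "(arc x (w y) (x + d) \<longleftrightarrow> arc x (w y) (w y + d)) \<and> (arc x (w y) (y + d) \<longleftrightarrow> arc x (w y) (w x + d))"
      using sx(2,3) sy(2,3) ** d dk \<open>L > 0\<close> unfolding arc_simp e
      unfolding l[symmetric] dir_def by (cases "odd x"; cases "odd y"; simp; smt)
    then show ?thesis unfolding d_def .
  qed
  have far: "k \<noteq> 0 \<Longrightarrow> L \<le> \<bar>L * k\<bar>" for k :: int
    using n_pos by (simp add: abs_mult)
  show ?thesis
  proof (cases rule: cong_cases[where z = b and x = x and y = y])
    case (x k)
    show ?thesis
    proof (cases "k = 0")
      case False
      show ?thesis
      proof (cases "gaprel w x b")
        case True
        have "\<bar>x - b\<bar> \<ge> L" using far[OF \<open>k \<noteq> 0\<close>] unfolding x by linarith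
        then have "gaprel w x (x + L)" by (intro gaprel_period[OF pw True]) (simp_all add: x)
        then show ?thesis using period False by (simp add: x t shift)
      next
        case False
        have "gaprel w b (w y + L * k)" using gaprel_translate_iff[OF pw, of x k "w y"] gwy x by simp
        then show ?thesis
          using same_gaps_arc[OF gwy, of b "w y + L * k"] False by (simp add: x t shift)
      qed
    qed (use x t(1)[of 0] in simp)
  next
    case (y k)
    show ?thesis
    proof (cases "k = 0")
      case True
      then show ?thesis using splits_arc_mem[OF assms] y t(2)[of 0] by simp
    next
      case False
      show ?thesis
      proof (cases "gaprel w x b")
        case True
        then have "gaprel w y (y + L * k)" using same_gaps_sym[OF g] same_gaps_trans y by blast
        moreover have "\<bar>y - (y + L * k)\<bar> \<ge> L" using far[OF \<open>k \<noteq> 0\<close>] by linarith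
        ultimately have "gaprel w y (y + L)" by (intro gaprel_period[OF pw, of y "y + L * k"]) simp_all
        moreover have "gaprel w (x + L) (y + L)" using gaprel_translate_iff[OF pw, of x 1 y] g by simp
        ultimately have "gaprel w x (x + L)" using g same_gaps_sym same_gaps_trans by blast
        then show ?thesis using period False by (simp add: y t shift)
      next
        case False
        have "gaprel w y (w x)" using same_gaps_sym[OF g] gw same_gaps_trans by blast
        then have "gaprel w b (w x + L * k)" using gaprel_translate_iff[OF pw, of y k "w x"] y by simp
        then show ?thesis
          using same_gaps_arc[OF gwy, of b "w x + L * k"] False by (simp add: y t shift)
      qed
    qed
  next
    case other
    then have tb: "ptransp n x y b = b" by (rule t(3))
    have "x \<noteq> b" "y \<noteq> b" using other by auto
    moreover have "w b \<noteq> w y" using calculation pw by (metis bij_is_inj injD periodic_perm_bij)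
    moreover have "arc b (w b) x \<longleftrightarrow> arc b (w b) (w y)"
      using gwy unfolding gaprel_iff by blast
    ultimately show ?thesis unfolding tb using arc_cross[of x b "w b" "w y"] by blast
  qed
qed


lemma periodic_perm_comp: "periodic_perm n v \<Longrightarrow> periodic_perm n w \<Longrightarrow> periodic_perm n (v \<circ> w)"
  by (auto simp: periodic_perm_def bij_comp)

text \<open>The gaps of \<open>w \<circ> (x, y)\<close> are those of \<open>w\<close>, except for the translates of the gaps at
  \<open>x\<close> and \<open>y\<close>.\<close>

lemma below_splitI:
  assumes pw: "periodic_perm n w" and pu: "periodic_perm n u" and s: "splits w x y"
    and uw: "below u w"
    and x: "\<And>b. arc x (w y) b \<longleftrightarrow> arc x (w y) (u b)"
    and y: "\<And>b. arc y (w x) b \<longleftrightarrow> arc y (w x) (u b)"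
  shows "below u (w \<circ> ptransp n x y)"
  unfolding below_def gaprel_iff
proof (intro allI)
  fix b a
  have xy: "\<not> [x = y] (mod L)" using s by (simp add: splits_def)
  note t = ptransp_simps[OF xy]
  have tr: "arc (p + L * k) (q + L * k) b \<longleftrightarrow> arc p q (b - L * k)" for p q k b
    using arc_translate[of "L * k" p q "b - L * k"] by simp
  have ub: "u b - L * k = u (b - L * k)" for k
    using periodic_perm_shift[OF pu, of "b - L * k" k] by simp
  have sh: "w (z + L * k) = w z + L * k" for z k by (rule periodic_perm_shift[OF pw])
  show "arc a ((w \<circ> ptransp n x y) a) b \<longleftrightarrow> arc a ((w \<circ> ptransp n x y) a) (u b)"
  proof (cases rule: cong_cases[where z = a and x = x and y = y])
    case (x k)
    then show ?thesis using assms(5)[of "b - L * k"] by (simp add: t sh tr ub)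
  next
    case (y k)
    then show ?thesis using assms(6)[of "b - L * k"] by (simp add: t sh tr ub)
  next
    case other
    then show ?thesis using uw t(3)[OF other] by (simp add: below_def gaprel_iff)
  qed
qed

lemma gaprel_ptransp:
  assumes pw: "periodic_perm n w" and s: "splits w x y"
  shows "gaprel w b (ptransp n x y b)"
proof -
  have xy: "\<not> [x = y] (mod L)" and g: "gaprel w x y" using s by (simp_all add: splits_def)
  note t = ptransp_simps[OF xy]
  show ?thesis
    using gaprel_translate_iff[OF pw] g same_gaps_sym
    by (cases rule: cong_cases[where z = b and x = x and y = y]) (auto simp: t)
qed

lemma splits_below:
  assumes "periodic_perm n w" "below w w" "splits w x y"
  shows "below (w \<circ> ptransp n x y) w"
  using gaprel_ptransp[OF assms(1,3)] assms(2) same_gaps_trans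
  unfolding below_def by (metis comp_apply)

lemma splits_periodic:
  "periodic_perm n w \<Longrightarrow> splits w x y \<Longrightarrow> periodic_perm n (w \<circ> ptransp n x y)"
  by (simp add: periodic_perm_comp periodic_perm_ptransp splits_def)

lemma splits_nc:
  assumes "periodic_perm n w" "below w w" "splits w x y"
  shows "below (w \<circ> ptransp n x y) (w \<circ> ptransp n x y)"
proof (rule below_splitI[OF assms(1) _ assms(3)])
  have "ptransp n y x = ptransp n x y"
    using assms(3) ptransp_commute unfolding splits_def by metis
  then show "arc y (w x) b \<longleftrightarrow> arc y (w x) ((w \<circ> ptransp n x y) b)" for b
    using splits_arc[OF assms(1,2) splits_sym[OF assms(3)], of b] by simp
qed (use assms splits_below splits_periodic splits_arc[OF assms] in auto)

text \<open>The new arc from \<open>x\<close> to \<open>w y\<close> contains \<open>y\<close> but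
  not its own starting point.\<close>

lemma splits_separates:
  assumes "periodic_perm n w" "below w w" "splits w x y"
  shows "\<not> gaprel (w \<circ> ptransp n x y) x y"
proof -
  have "(w \<circ> ptransp n x y) x = w y"
    using ptransp_simps(1)[of x y 0] assms(3) by (simp add: splits_def)
  then show ?thesis
    using splits_arc_mem(1)[OF assms] arc_endpoints(1)[of x "w y"] unfolding gaprel_iff by metis
qed

text \<open>In the cyclic order \<open>x\<close>, \<open>x'\<close>, \<open>y\<close>,
  \<open>y'\<close> both sides describe the complement of the closed interval from \<open>x'\<close>
  to \<open>y\<close>. A map respecting the other three arcs therefore respects the one from
  \<open>y\<close> to \<open>x'\<close>.\<close>

lemma arc_decompose:
  assumes "\<not> arc x x' y" "\<not> arc y y' x" "x \<noteq> y" "x' \<noteq> y'"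
  shows "arc y x' b \<longleftrightarrow> \<not> (arc x y' b \<and> \<not> arc x x' b \<and> \<not> arc y y' b)"
proof -
  have "pos x \<noteq> pos y" "pos x' \<noteq> pos y'" using assms(3,4) by (simp_all add: pos_eq_iff)
  with assms(1,2) show ?thesis unfolding arc_def by argo
qed

text \<open>With \<open>w y = v x\<close> the product agrees with \<open>v\<close> at
  \<open>x\<close>. Its arc from \<open>x\<close> is thus an arc of \<open>v\<close>, and the other
  new arc, from \<open>y\<close> to \<open>w x\<close>, is covered by
  \<open>arc_decompose\<close>.\<close>

lemma split_step:
  assumes pw: "periodic_perm n w" and pv: "periodic_perm n v"
    and nc: "below w w" "below v v" and vw: "below v w"
    and x: "v x \<noteq> w x" and y: "w y = v x" and xy: "\<not> [x = y] (mod L)"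
  shows "splits w x y" "below v (w \<circ> ptransp n x y)"
proof -
  have g: "gaprel w x y"
  proof -
    have "gaprel w x (w y)" "gaprel w y (w y)" using vw nc y unfolding below_def by metis+
    then show ?thesis using same_gaps_sym same_gaps_trans by blast
  qed
  \<comment> \<open>Otherwise the class is infinite, and the arc of \<open>v\<close> from
    \<open>x\<close> to \<open>w y\<close> is so long, forwards or backwards, that it crosses a
    translate of itself.\<close>
  have "\<bar>x - y\<bar> < L" if e: "even (x - y)"
  proof (rule ccontr)
    assume "\<not> \<bar>x - y\<bar> < L"
    then have px: "gaprel w x (x + L)" using gaprel_period[OF pw g e] by simp
    have "gaprel w (x + L) (y + L)" using gaprel_translate_iff[OF pw, of x 1 y] g by simp
    then have py: "gaprel w y (y + L)" using g px same_gaps_sym same_gaps_trans by blast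
    note sx = period_class_step[OF pw nc(1) px] and sy = period_class_step[OF pw nc(1) py]
    have "\<not> arc y (w y) y" by simp
    moreover have "gaprel w y (x + L * j)" for j
      using gaprel_period_all[OF pw px] g same_gaps_sym same_gaps_trans by blast
    ultimately have "\<not> arc y (w y) (x + L * j)" for j
      unfolding gaprel_iff by blast
    from this[of 1] this[of "- 1"] have a: "\<not> arc y (w y) (x + L)" "\<not> arc y (w y) (x - L)"
      by simp_all
    have "arc x (v x) (x + L * k) \<longleftrightarrow> arc x (v x) (v x + L * k)" for k
      using nc(2) periodic_perm_shift[OF pv, of x k] unfolding below_def gaprel_iff by metis
    from this[of 1] this[of "- 1"] have b: "arc x (v x) (x + L) \<longleftrightarrow> arc x (v x) (v x + L)"
      "arc x (v x) (x - L) \<longleftrightarrow> arc x (v x) (v x - L)" by simp_all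
    have "\<not> [x = y + L * k] (mod L)" for k
      using xy by (simp add: cong_def)
    then have ne: "x \<noteq> y + L * k" for k by (metis cong_refl)
    have ne: "x \<noteq> y + L" "x \<noteq> y - L" using ne[of 1] ne[of "- 1"] by simp_all
    have p: "even (w y) = even x" "even y = even x" "even (w y + L) = even x" "even (w y - L) = even x"
      "even (x + L) = even x" "even (x - L) = even x"
      using sy(1) e by auto
    obtain l where l: "l = L" by blast
    have "l > 0" using l n_pos by simp
    then show False
      using sx(2,3) sy(2,3) \<open>\<not> \<bar>x - y\<bar> < L\<close> a b ne
      unfolding y[symmetric] arc_simp p unfolding dir_def p unfolding l[symmetric]
      by (cases "odd x"; simp; smt)
  qed
  then show s: "splits w x y" using g xy by (simp add: splits_def)
  have vb: "gaprel w b (v b)" "gaprel v b (v b)" for b using vw nc(2) by (simp_all add: below_def)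
  have A: "arc x (w y) b \<longleftrightarrow> arc x (w y) (v b)" for b
    using vb(2) y unfolding gaprel_iff by metis
  show "below v (w \<circ> ptransp n x y)"
  proof (rule below_splitI[OF pw pv s vw A])
    fix b
    have "\<not> arc x (w x) x" "\<not> arc y (w y) y" by simp_all
    then have "\<not> arc x (w x) y" "\<not> arc y (w y) x" using g unfolding gaprel_iff by blast+
    moreover have "x \<noteq> y" using xy by auto
    ultimately have D: "arc y (w x) b \<longleftrightarrow> \<not> (arc x (w y) b \<and> \<not> arc x (w x) b \<and> \<not> arc y (w y) b)" for b
      using x y by (intro arc_decompose) auto
    show "arc y (w x) b \<longleftrightarrow> arc y (w x) (v b)"
      unfolding D using A vb(1) unfolding gaprel_iff by metis
  qed
qed


section \<open>Permutations that differ by whole periods\<close>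

lemma nc_same_parity_bound:
  assumes pv: "periodic_perm n v" and nc: "below v v" and e: "even (v x - x)"
  shows "dir x * x - L < dir x * v x" "dir x * v x \<le> dir x * x + L"
proof -
  \<comment> \<open>A longer arc within one row would cross its translates by one period. A step of
    exactly one period is possible forwards but not backwards.\<close>
  have "arc x (v x) (x + L * k) \<longleftrightarrow> arc x (v x) (v x + L * k)" for k
    using nc periodic_perm_shift[OF pv, of x k] unfolding below_def gaprel_iff by metis
  from this[of 1] this[of "- 1"] have b: "arc x (v x) (x + L) \<longleftrightarrow> arc x (v x) (v x + L)"
    "arc x (v x) (x - L) \<longleftrightarrow> arc x (v x) (v x - L)" by simp_all
  have p: "even (v x) = even x" "even (x + L) = even x" "even (x - L) = even x"
     "even (v x + L) = even x" "even (v x - L) = even x"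
    using e by auto
  obtain l where l: "l = L" by blast
  have "l > 0" using l n_pos by simp
  then have "dir x * x - L < dir x * v x \<and> dir x * v x \<le> dir x * x + L"
    using b unfolding arc_simp p unfolding dir_def unfolding l[symmetric]
    by (cases "odd x"; simp; smt)
  then show "dir x * x - L < dir x * v x" "dir x * v x \<le> dir x * x + L" by blast+
qed

lemma W_affA_periodic: "w \<in> W_affA n \<Longrightarrow> periodic_perm n w"
  by (simp add: W_affA_def)

lemma W_affA_sum:
  assumes "w \<in> W_affA n"
  shows "(\<Sum>x = 1..L. w x - x) = 0"
proof -
  have "1 / of_nat (2 * n) * rat_of_int (\<Sum>x = 1..L. w x - x) = 0"
    using assms unfolding W_affA_def total_shift_def of_int_sum by blast
  then have "rat_of_int (\<Sum>x = 1..L. w x - x) = 0"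
    using n_pos by (simp only: mult_eq_0_iff) simp
  then show ?thesis by (simp only: of_int_eq_0_iff)
qed

lemma period_bracket: "\<exists>k. x + L * k < b \<and> b \<le> x + L * k + L"
proof (intro exI conjI)
  have "L > 0" using n_pos by simp
  from pos_mod_bound[OF this, of "b - x - 1"] pos_mod_sign[OF this, of "b - x - 1"]
    mult_div_mod_eq[of L "b - x - 1"]
  show "x + L * ((b - x - 1) div L) < b" "b \<le> x + L * ((b - x - 1) div L) + L"
    by linarith+
qed

text \<open>The translates of the arc of \<open>w\<close> from \<open>x\<close> and the complements
  of the translates of the arc of \<open>v\<close> from \<open>x\<close> cover the row by intervals
  that \<open>v\<close> preserves. Each of them lies on one side of \<open>x\<close> and on one side
  of \<open>w x\<close>.\<close>

lemma winding_block:
  assumes pw: "periodic_perm n w" and pv: "periodic_perm n v" and nc: "below w w" "below v v"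
    and vw: "below v w" and x: "v x = w x - dir x * L" and e: "even (w x - x)"
    and w: "dir x * x < dir x * w x" "dir x * w x \<le> dir x * x + L" and b: "even (b - x)"
  shows "even (v b - x)" "dir x * x < dir x * b \<longleftrightarrow> dir x * x < dir x * v b"
     "dir x * b < dir x * w x \<longleftrightarrow> dir x * v b < dir x * w x"
proof -
  obtain k where "dir x * x + L * k < dir x * b" "dir x * b \<le> dir x * x + L * k + L"
    using period_bracket by blast
  moreover define d where "d = L * k"
  ultimately have k: "dir x * x + d < dir x * b" "dir x * b \<le> dir x * x + d + L" by simp_all
  have "even d" and L: "L > 0" using n_pos by (simp_all add: d_def)
  have "k \<ge> 0 \<or> k \<le> - 1" by linarith
  then have dk: "d = 0 \<or> d \<ge> L \<or> d \<le> - L"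
    using L unfolding d_def by (smt (verit) mult_less_cancel_left2 mult_minus_right mult_le_cancel_left1)
  have wd: "w (x + dir x * d) = w x + dir x * d"
    using periodic_perm_shift[OF pw, of x "dir x * k"] by (simp add: d_def algebra_simps)
  have vd: "v (x + dir x * (d + L)) = w x + dir x * d"
    using periodic_perm_shift[OF pv, of x "dir x * (k + 1)"] x by (simp add: d_def algebra_simps)
  have 1: "arc (x + dir x * d) (w x + dir x * d) b \<longleftrightarrow> arc (x + dir x * d) (w x + dir x * d) (v b)"
    using vw wd unfolding below_def gaprel_iff by metis
  have 2: "arc (x + dir x * (d + L)) (w x + dir x * d) b \<longleftrightarrow> arc (x + dir x * (d + L)) (w x + dir x * d) (v b)"
    using nc(2) vd unfolding below_def gaprel_iff by metis
  have p: "even (x + dir x * d) = even x" "even (w x + dir x * d) = even x"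
    "even (x + dir x * (d + L)) = even x" "even b = even x"
    using e b \<open>even d\<close> by auto
  obtain l where l: "l = L" by blast
  have "even (v b - x) \<and> (dir x * x < dir x * b \<longleftrightarrow> dir x * x < dir x * v b) \<and>
     (dir x * b < dir x * w x \<longleftrightarrow> dir x * v b < dir x * w x)"
    using 1 2 k w dk L unfolding arc_simp p unfolding dir_def l[symmetric]
    by (cases "odd x"; simp; smt)
  then show "even (v b - x)" "dir x * x < dir x * b \<longleftrightarrow> dir x * x < dir x * v b"
     "dir x * b < dir x * w x \<longleftrightarrow> dir x * v b < dir x * w x" by blast+
qed

text \<open>In an infinite class \<open>w\<close> advances each point by a positive amount up to one
  period, while \<open>v\<close> advances it by more than minus one period and at most one. Hence a
  nonzero defect is exactly one period backwards.\<close>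

lemma winding_defect:
  assumes pw: "periodic_perm n w" and pv: "periodic_perm n v" and nc: "below w w" "below v v"
    and vw: "below v w" and k: "v x = w x + L * k" and ne: "v x \<noteq> w x"
  shows "gaprel w x (x + L)" "v x = w x - dir x * L"
proof -
  have k0: "k \<noteq> 0" using k ne by auto
  have wk: "w (x + L * k) = v x" using periodic_perm_shift[OF pw, of x k] k by simp
  have "gaprel w x (v x)" "gaprel w (x + L * k) (v x)"
    using vw nc(1) wk unfolding below_def by metis+
  then have "gaprel w x (x + L * k)" using same_gaps_sym same_gaps_trans by blast
  moreover have "\<bar>x - (x + L * k)\<bar> \<ge> L" using k0 n_pos by (simp add: abs_mult)
  ultimately show px: "gaprel w x (x + L)" by (intro gaprel_period[OF pw, of x "x + L * k"]) simp_all
  note sx = period_class_step[OF pw nc(1) px]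
  have "even (v x - x)" using sx(1) k by simp
  note bx = nc_same_parity_bound[OF pv nc(2) this]
  have "L > 0" using n_pos by simp
  have dk: "dir x * v x = dir x * w x + L * (dir x * k)" by (simp add: k algebra_simps)
  then have "L * (dir x * k) > L * (- 2)" "L * (dir x * k) < L * 1" using sx bx by linarith+
  then have "dir x * k > - 2" "dir x * k < 1" using \<open>L > 0\<close> by (simp_all only: mult_less_cancel_left)
  moreover have "dir x * k \<noteq> 0" using k0 by (simp add: dir_def)
  ultimately have "dir x * k = - 1" by linarith
  then have "k = - dir x" by (auto simp: dir_def split: if_splits)
  then show "v x = w x - dir x * L" by (simp add: k)
qed

lemma periodic_eqI:
  assumes pv: "periodic_perm n v" and pw: "periodic_perm n w"
    and eq: "\<And>x. 1 \<le> x \<Longrightarrow> x \<le> L \<Longrightarrow> v x = w x"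
  shows "v = w"
proof
  fix z
  obtain k where "0 + L * k < z" "z \<le> 0 + L * k + L" using period_bracket by blast
  then have "v (z - L * k) = w (z - L * k)" using eq by simp
  then show "v z = w z"
    using periodic_perm_shift[OF pv, of "z - L * k" k] periodic_perm_shift[OF pw, of "z - L * k" k] by simp
qed

text \<open>Unless \<open>split_step\<close> applies, \<open>v\<close> and \<open>w\<close> differ
  by whole periods only, always against the direction of the row. Total shift 0 forces such defects
  in both rows, and transposing a defect in the odd row with one in the even row cuts across the
  strip; \<open>v\<close> respects the two new arcs by \<open>winding_block\<close>.\<close>

lemma splits_exists:
  assumes v: "v \<in> W_affA n" and w: "w \<in> W_affA n" and nc: "below w w" "below v v"
    and vw: "below v w" and ne: "v \<noteq> w"
  shows "\<exists>x y. splits w x y \<and> below v (w \<circ> ptransp n x y)"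
proof (cases "\<exists>x y. v x \<noteq> w x \<and> w y = v x \<and> \<not> [x = y] (mod L)")
  case True
  then show ?thesis
    using split_step[OF W_affA_periodic[OF w] W_affA_periodic[OF v] nc vw] by blast
next
  case False
  note pw = W_affA_periodic[OF w] and pv = W_affA_periodic[OF v]
  have "\<exists>k. v x = w x + L * k" for x
  proof -
    obtain y where y: "w y = v x" using periodic_perm_bij[OF pw] by (metis bij_pointE)
    then have "v x \<noteq> w x \<Longrightarrow> [x = y] (mod L)" using False by blast
    then have "v x \<noteq> w x \<Longrightarrow> \<exists>k. y = x + L * k" by (metis cong_iff_lin)
    then have "v x \<noteq> w x \<Longrightarrow> \<exists>k. v x = w x + L * k"
      using periodic_perm_shift[OF pw, of x] y by metis
    moreover have "v x = w x + L * 0" if "v x = w x" using that by simp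
    ultimately show ?thesis by blast
  qed
  then have defect: "gaprel w x (x + L)" "v x = w x - dir x * L" if "v x \<noteq> w x" for x
    using winding_defect[OF pw pv nc vw _ that] by blast+
  have sum: "(\<Sum>x = 1..L. v x - w x) = 0"
  proof -
    have "(\<Sum>x = 1..L. v x - w x) = (\<Sum>x = 1..L. v x - x) - (\<Sum>x = 1..L. w x - x)"
      by (simp add: sum_subtractf)
    then show ?thesis by (simp only: W_affA_sum[OF v] W_affA_sum[OF w])
  qed
  have "L > 0" using n_pos by simp
  \<comment> \<open>Defects confined to one row would all have the same sign, but they sum to 0 over
    a period.\<close>
  have "\<exists>x. odd x \<and> v x \<noteq> w x"
  proof (rule ccontr)
    assume "\<not> ?thesis"
    then have par: "even x" if "v x \<noteq> w x" for x using that by blast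
    have "v x - w x \<ge> 0" for x
    proof (cases "v x = w x")
      case False
      then show ?thesis using defect(2)[OF False] par[OF False] by (simp add: dir_def)
    qed simp
    then have "\<forall>x\<in>{1..L}. v x - w x = 0"
      using sum sum_nonneg_eq_0_iff[of "{1..L}" "\<lambda>x. v x - w x"] by simp
    then show False using periodic_eqI[OF pv pw] ne by simp
  qed
  then obtain x where x: "odd x" "v x \<noteq> w x" by blast
  have "\<exists>x. even x \<and> v x \<noteq> w x"
  proof (rule ccontr)
    assume "\<not> ?thesis"
    then have par: "odd x" if "v x \<noteq> w x" for x using that by blast
    have "w x - v x \<ge> 0" for x
    proof (cases "v x = w x")
      case False
      then show ?thesis using defect(2)[OF False] par[OF False] by (simp add: dir_def)
    qed simp
    moreover have "(\<Sum>x = 1..L. w x - v x) = 0" using sum by (simp add: sum_subtractf)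
    ultimately have "\<forall>x\<in>{1..L}. w x - v x = 0"
      using sum_nonneg_eq_0_iff[of "{1..L}" "\<lambda>x. w x - v x"] by simp
    then show False using periodic_eqI[OF pv pw] ne by simp
  qed
  then obtain y where y: "even y" "v y \<noteq> w y" by blast
  note px = defect[OF x(2)] and py = defect[OF y(2)]
  note sx = period_class_step[OF pw nc(1) px(1)] and sy = period_class_step[OF pw nc(1) py(1)]
  have "\<not> [x = y] (mod L)"
  proof
    assume "[x = y] (mod L)"
    then have "2 dvd x - y" unfolding cong_iff_dvd_diff using dvd_mult_left by blast
    then show False using x y by simp
  qed
  then have s: "splits w x y"
    using period_class_all[OF pw px(1) py(1)] x y by (simp add: splits_def)
  note wx_block = winding_block[OF pw pv nc vw px(2) sx] and wy_block = winding_block[OF pw pv nc vw py(2) sy]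
  have e: "odd (w x)" "even (w y)" using sx(1) sy(1) x y by auto
  have dx: "dir x = 1" "dir y = - 1" using x(1) y(1) by (simp_all add: dir_def)
  have "odd (v b) \<and> (x < b \<longleftrightarrow> x < v b) \<and> (b < w x \<longleftrightarrow> v b < w x)" if "odd b" for b
  proof -
    have "even (b - x)" using that x(1) by simp
    from wx_block[OF this] show ?thesis unfolding dx using x(1) by simp
  qed
  moreover have "even (v b) \<and> (b < y \<longleftrightarrow> v b < y) \<and> (w y < b \<longleftrightarrow> w y < v b)" if "even b" for b
  proof -
    have "even (b - y)" using that y(1) by simp
    from wy_block[OF this] show ?thesis unfolding dx using y(1) by simp
  qed
  moreover have "arc x (w y) b \<longleftrightarrow> (if odd b then x < b else w y < b)"
    "arc y (w x) b \<longleftrightarrow> (if odd b then b < w x else b < y)" for b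
    using e x(1) y(1) by (simp_all add: arc_simp)
  ultimately have "arc x (w y) b \<longleftrightarrow> arc x (w y) (v b)" "arc y (w x) b \<longleftrightarrow> arc y (w x) (v b)" for b
    by metis+
  then have "below v (w \<circ> ptransp n x y)"
    by (rule below_splitI[OF pw pv s vw])
  with s show ?thesis by blast
qed

end

section \<open>Dimension of the space of invariant functions\<close>

definition lin :: "(('a \<Rightarrow> real) \<Rightarrow> real) \<Rightarrow> bool" where
  "lin \<phi> \<longleftrightarrow> (\<forall>f g a b. \<phi> (\<lambda>x. a * f x + b * g x) = a * \<phi> f + b * \<phi> g)"

definition subsp :: "('a \<Rightarrow> real) set \<Rightarrow> bool" where
  "subsp S \<longleftrightarrow> (\<forall>f\<in>S. \<forall>g\<in>S. \<forall>a b. (\<lambda>x. a * f x + b * g x) \<in> S)"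

text \<open>Encodes dimension at most \<open>d\<close> by functionals instead of bases: passing to
  or from a hyperplane then means dropping or adding one functional.\<close>

definition separated :: "nat \<Rightarrow> ('a \<Rightarrow> real) set \<Rightarrow> bool" where
  "separated d S \<longleftrightarrow> (\<exists>\<phi>s. length \<phi>s = d \<and> (\<forall>\<phi>\<in>set \<phi>s. lin \<phi>) \<and>
     (\<forall>h\<in>S. (\<forall>\<phi>\<in>set \<phi>s. \<phi> h = 0) \<longrightarrow> h = (\<lambda>_. 0)))"

text \<open>The dimension, if \<open>S\<close> is a subspace of finite dimension.\<close>

definition rank :: "('a \<Rightarrow> real) set \<Rightarrow> nat" where
  "rank S = (LEAST d. separated d S)"

lemma linD: "lin \<phi> \<Longrightarrow> \<phi> (\<lambda>x. a * f x + b * g x) = a * \<phi> f + b * \<phi> g"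
  by (simp add: lin_def)

lemma lin_zero: "lin \<phi> \<Longrightarrow> \<phi> (\<lambda>_. 0) = 0"
  using linD[of \<phi> 0 "\<lambda>_. 0" 0 "\<lambda>_. 0"] by simp

lemma separated_rank: "separated d S \<Longrightarrow> separated (rank S) S"
  unfolding rank_def by (rule LeastI)

lemma rank_le: "separated d S \<Longrightarrow> rank S \<le> d"
  unfolding rank_def by (rule Least_le)

lemma separated_mono: "separated d T \<Longrightarrow> S \<subseteq> T \<Longrightarrow> separated d S"
  unfolding separated_def by blast

lemma rank_mono: "separated d T \<Longrightarrow> S \<subseteq> T \<Longrightarrow> rank S \<le> rank T"
  using separated_rank separated_mono rank_le by metis

lemma rank_hyperplane_le:
  assumes "separated d S" "lin \<phi>"
  shows "rank S \<le> rank {h \<in> S. \<phi> h = 0} + 1"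
proof -
  have "separated d {h \<in> S. \<phi> h = 0}" by (rule separated_mono[OF assms(1)]) blast
  then have "separated (rank {h \<in> S. \<phi> h = 0}) {h \<in> S. \<phi> h = 0}" by (rule separated_rank)
  then obtain \<phi>s where "length \<phi>s = rank {h \<in> S. \<phi> h = 0}" "\<forall>\<phi>\<in>set \<phi>s. lin \<phi>"
    "\<forall>h\<in>{h \<in> S. \<phi> h = 0}. (\<forall>\<phi>\<in>set \<phi>s. \<phi> h = 0) \<longrightarrow> h = (\<lambda>_. 0)"
    unfolding separated_def by blast
  then have "separated (rank {h \<in> S. \<phi> h = 0} + 1) S"
    unfolding separated_def using assms(2) by (intro exI[of _ "\<phi> # \<phi>s"]) auto
  then show ?thesis by (rule rank_le)
qed

text \<open>Gaussian elimination: a separating functional that is nonzero at \<open>h\<close> serves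
  as pivot and is dropped, the others being corrected so as to vanish at \<open>h\<close>.\<close>

lemma rank_hyperplane_less:
  assumes sep: "separated d S" and S: "subsp S" and \<phi>: "lin \<phi>" and h: "h \<in> S" "\<phi> h \<noteq> 0"
  shows "rank {h \<in> S. \<phi> h = 0} < rank S"
proof -
  obtain \<phi>s where \<phi>s: "length \<phi>s = rank S" "\<forall>\<phi>\<in>set \<phi>s. lin \<phi>"
    "\<And>h. h \<in> S \<Longrightarrow> (\<forall>\<phi>\<in>set \<phi>s. \<phi> h = 0) \<Longrightarrow> h = (\<lambda>_. 0)"
    using separated_rank[OF sep] unfolding separated_def by metis
  have "h \<noteq> (\<lambda>_. 0)" using h(2) lin_zero[OF \<phi>] by auto
  then obtain \<psi> where "\<psi> \<in> set \<phi>s" and \<psi>h: "\<psi> h \<noteq> 0" using \<phi>s(3)[OF h(1)] by blast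
  then obtain as bs where split: "\<phi>s = as @ \<psi> # bs" by (metis split_list)
  define red where "red = (\<lambda>\<chi> g. \<chi> g - (\<chi> h / \<psi> h) * \<psi> g :: real)"
  have lin: "lin \<chi>" if "\<chi> \<in> set (as @ bs) \<or> \<chi> = \<psi>" for \<chi> using that \<phi>s(2) split by auto
  have "separated (length (as @ bs)) {h \<in> S. \<phi> h = 0}"
    unfolding separated_def
  proof (intro exI[of _ "map red (as @ bs)"] conjI ballI impI)
    fix \<chi> assume "\<chi> \<in> set (map red (as @ bs))"
    then obtain \<chi>' where \<chi>': "\<chi> = red \<chi>'" "lin \<chi>'" using lin by auto
    have "lin \<psi>" using lin by blast
    with \<chi>'(2) have "lin (\<lambda>g. \<chi>' g - r * \<psi> g)" for r by (simp add: lin_def algebra_simps)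
    then show "lin \<chi>" unfolding \<chi>'(1) red_def .
  next
    fix g assume g: "g \<in> {h \<in> S. \<phi> h = 0}" and z: "\<forall>\<chi>\<in>set (map red (as @ bs)). \<chi> g = 0"
    \<comment> \<open>This factor makes the pivot vanish on \<open>g + r h\<close>; the corrected
      functionals being 0 at \<open>g\<close>, the remaining ones vanish there too. So
      \<open>g + r h\<close> is 0, and applying \<open>\<phi>\<close> yields
      \<open>r = 0\<close>.\<close>
    define r where "r = - (\<psi> g / \<psi> h)"
    have "(\<lambda>x. 1 * g x + r * h x) = (\<lambda>_. 0)"
    proof (rule \<phi>s(3))
      show "(\<lambda>x. 1 * g x + r * h x) \<in> S" using S g h(1) unfolding subsp_def by blast
      show "\<forall>\<chi>\<in>set \<phi>s. \<chi> (\<lambda>x. 1 * g x + r * h x) = 0"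
      proof
        fix \<chi> assume "\<chi> \<in> set \<phi>s"
        then have mem: "\<chi> \<in> set (as @ bs) \<or> \<chi> = \<psi>" using split by auto
        have e: "\<chi> (\<lambda>x. 1 * g x + r * h x) = 1 * \<chi> g + r * \<chi> h"
          by (rule linD[OF lin[OF mem]])
        from mem show "\<chi> (\<lambda>x. 1 * g x + r * h x) = 0"
        proof
          assume 2: "\<chi> \<in> set (as @ bs)"
          then have "red \<chi> g = 0" using z by auto
          then show ?thesis unfolding e by (simp add: r_def red_def)
        qed (use \<psi>h e in \<open>simp add: r_def\<close>)
      qed
    qed
    moreover from this have "1 * \<phi> g + r * \<phi> h = 0" using linD[OF \<phi>, of 1 g r h] lin_zero[OF \<phi>] by simp
    then have "r = 0" using g h(2) by simp
    ultimately show "g = (\<lambda>_. 0)" by simp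
  qed simp
  then have "rank {h \<in> S. \<phi> h = 0} \<le> length (as @ bs)" by (rule rank_le)
  then show ?thesis using split \<phi>s(1) by simp
qed

lemma lin_diff_eval: "lin (\<lambda>h. h x - h y)"
  by (simp add: lin_def algebra_simps)

lemma lin_eval: "lin (\<lambda>h. h x)"
  by (simp add: lin_def)

section \<open>Quasi-periodic functions and their dimension\<close>

context affA
begin

text \<open>The factor \<open>2\<close>, for which any number of infinite order would do, makes invariant functions
  vanish on infinite orbits.\<close>

definition qper :: "(int \<Rightarrow> real) set" where
  "qper = {h. \<forall>x. h (x + L) = 2 * h x}"

definition Fix :: "(int \<Rightarrow> int) \<Rightarrow> (int \<Rightarrow> real) set" where
  "Fix w = {h \<in> qper. \<forall>x. h (w x) = h x}"

lemma qper_shift: "h \<in> qper \<Longrightarrow> h (x + L * k) = 2 powi k * h x"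
proof (induction k rule: int_induct[where k = 0])
  case (step1 i)
  have "h (x + L * i + L) = 2 * h (x + L * i)" using step1(3) by (simp add: qper_def)
  then show ?case using step1 by (simp add: algebra_simps power_int_add)
next
  case (step2 i)
  have "h (x + L * (i - 1) + L) = 2 * h (x + L * (i - 1))" using step2(3) by (simp add: qper_def)
  then have "h (x + L * i) = 2 * h (x + L * (i - 1))" by (simp add: algebra_simps)
  then show ?case using step2 by (simp add: power_int_diff)
qed simp

lemma subsp_qper: "subsp qper"
  by (simp add: subsp_def qper_def algebra_simps)

lemma subsp_Fix: "subsp (Fix w)"
  by (simp add: subsp_def Fix_def qper_def algebra_simps)

lemma qper_zeroI:
  assumes "h \<in> qper" "\<And>x. 1 \<le> x \<Longrightarrow> x \<le> L \<Longrightarrow> h x = 0"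
  shows "h = (\<lambda>_. 0)"
proof
  fix z
  obtain k where "0 + L * k < z" "z \<le> 0 + L * k + L" using period_bracket by blast
  then have "h (z - L * k) = 0" using assms(2) by simp
  then show "h z = 0" using qper_shift[OF assms(1), of "z - L * k" k] by simp
qed

lemma separated_qper: "separated (2 * n) qper"
  unfolding separated_def
proof (intro exI[of _ "map (\<lambda>i h. h i) [1..L]"] conjI ballI impI)
  fix h assume "h \<in> qper" "\<forall>\<phi>\<in>set (map (\<lambda>i h. h i) [1..L]). \<phi> h = 0"
  then show "h = (\<lambda>_. 0)" by (intro qper_zeroI) auto
qed (auto simp: lin_eval)

lemma separated_Fix: "separated (2 * n) (Fix w)"
  by (rule separated_mono[OF separated_qper]) (auto simp: Fix_def)

text \<open>Intended for \<open>B\<close> with at most one point in each residue class: the function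
  in \<open>qper\<close> that is 1 on \<open>B\<close> and 0 off the translates of \<open>B\<close>.
  The chosen \<open>k\<close> is then unique.\<close>

definition spread :: "int set \<Rightarrow> int \<Rightarrow> real" where
  "spread B x = (if \<exists>k. x - L * k \<in> B then 2 powi (SOME k. x - L * k \<in> B) else 0)"

lemma spread_shift:
  assumes B: "\<And>b k. b \<in> B \<Longrightarrow> b + L * k \<in> B \<Longrightarrow> k = 0" and b: "b \<in> B"
  shows "spread B (b + L * k) = 2 powi k"
proof -
  have "(b + L * k) - L * k \<in> B" using b by simp
  moreover have "j = k" if "(b + L * k) - L * j \<in> B" for j
    using B[OF b, of "k - j"] that by (simp add: algebra_simps)
  ultimately have "(SOME j. (b + L * k) - L * j \<in> B) = k" by (metis (mono_tags, lifting) someI)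
  then show ?thesis unfolding spread_def using b by (auto intro!: exI[of _ k])
qed

lemma spread_qper:
  assumes B: "\<And>b k. b \<in> B \<Longrightarrow> b + L * k \<in> B \<Longrightarrow> k = 0"
  shows "spread B \<in> qper"
  unfolding qper_def
proof (intro CollectI allI)
  fix x
  show "spread B (x + L) = 2 * spread B x"
  proof (cases "\<exists>k. x - L * k \<in> B")
    case True
    then obtain k where k: "x - L * k \<in> B" by blast
    have "spread B (x - L * k + L * k) = 2 powi k" "spread B (x - L * k + L * (k + 1)) = 2 powi (k + 1)"
      by (intro spread_shift B k; assumption)+
    then show ?thesis by (simp add: algebra_simps power_int_add)
  next
    case False
    have "\<nexists>k. x + L - L * k \<in> B"
    proof
      assume "\<exists>k. x + L - L * k \<in> B"
      then obtain k where "x + L - L * k \<in> B" by blast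
      then have "x - L * (k - 1) \<in> B" by (simp add: algebra_simps)
      with False show False by blast
    qed
    with False show ?thesis by (simp add: spread_def)
  qed
qed

text \<open>The functions vanishing at 1, ..., i form a strictly decreasing flag of length
  \<open>2 * n\<close>, as \<open>spread {i + 1}\<close> vanishes at 1, ..., i but not at i +
  1.\<close>

lemma rank_qper: "rank qper \<ge> 2 * n"
proof -
  define S where "S = (\<lambda>i::nat. {h \<in> qper. \<forall>j\<in>{1..int i}. h j = 0})"
  have sub: "S i \<subseteq> qper" for i by (auto simp: S_def)
  have "i \<le> 2 * n \<Longrightarrow> rank (S (2 * n - i)) \<ge> i" for i
  proof (induction i)
    case (Suc i)
    define m where "m = 2 * n - Suc i"
    have m: "2 * n - i = Suc m" "int m + 1 \<le> L" using Suc.prems by (simp_all add: m_def)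
    have B: "k = 0" if "b \<in> {int m + 1}" "b + L * k \<in> {int m + 1}" for b k using that n_pos by simp
    have "spread {int m + 1} (int m + 1 + L * 0) = 2 powi 0"
      by (rule spread_shift) (rule B, assumption+, rule singletonI)
    then have 1: "spread {int m + 1} (int m + 1) = 1" by simp
    have "spread {int m + 1} \<in> S m"
      unfolding S_def
    proof (intro CollectI conjI ballI spread_qper B)
      fix j assume j: "j \<in> {1..int m}"
      have "j - L * k \<noteq> int m + 1" for k
      proof
        assume a: "j - L * k = int m + 1"
        then have "L * k < 0" "L * k > - L" using j m(2) by (simp_all only: atLeastAtMost_iff) linarith+
        then have "L * k < L * 0" "L * k > L * (- 1)" by simp_all
        then have "k < 0" "k > - 1" using n_pos by (simp_all only: mult_less_cancel_left)
        then show False by simp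
      qed
      then show "spread {int m + 1} j = 0" by (simp add: spread_def)
    qed
    moreover have "subsp (S m)" using subsp_qper by (simp add: subsp_def S_def)
    ultimately have "rank {h \<in> S m. h (int m + 1) = 0} < rank (S m)"
      using 1 by (intro rank_hyperplane_less[OF separated_mono[OF separated_qper sub] _ lin_eval]) auto
    moreover have "{h \<in> S m. h (int m + 1) = 0} = S (Suc m)"
    proof -
      have "{1..int (Suc m)} = insert (int m + 1) {1..int m}" by auto
      then show ?thesis unfolding S_def by auto
    qed
    ultimately show ?case using Suc m by (simp add: m_def[symmetric])
  qed simp
  from this[of "2 * n"] have "2 * n \<le> rank (S 0)" by simp
  also have "\<dots> \<le> rank qper" by (rule rank_mono[OF separated_qper sub])
  finally show ?thesis .
qed

end

lemma powi_2_eq_1: "(2::real) powi k = 1 \<longleftrightarrow> k = 0"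
proof
  assume a: "(2::real) powi k = 1"
  show "k = 0"
  proof (rule ccontr)
    assume "k \<noteq> 0"
    then have "(1::real) < 2 powi k \<or> (1::real) < 2 powi (- k)"
      by (cases "k > 0") (simp_all only: one_less_power_int, simp_all add: one_less_power_int)
    then show False using a by (simp add: power_int_minus)
  qed
qed simp

context affA
begin

section \<open>Classes as level sets of invariant functions\<close>

lemma dir_cong: "even (a - b) \<Longrightarrow> dir a = dir b"
  by (auto simp: dir_def)

lemma gaprel_period_cong:
  assumes "periodic_perm n w" "gaprel w x y" "gaprel w x (x + L)"
  shows "gaprel w y (y + L)"
proof -
  have "gaprel w (x + L) (y + L)" using gaprel_translate_iff[OF assms(1), of x 1 y] assms(2) by simp
  then show ?thesis using assms(2,3) same_gaps_sym same_gaps_trans by blast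
qed

lemma gaprel_translate_period:
  assumes "periodic_perm n w" "gaprel w x (x + L * k)" "k \<noteq> 0"
  shows "gaprel w x (x + L)"
proof -
  have "\<bar>x - (x + L * k)\<bar> \<ge> L" using assms(3) n_pos by (simp add: abs_mult)
  then show ?thesis by (intro gaprel_period[OF assms(1), of x "x + L * k"]) (simp_all add: assms(2))
qed

text \<open>Iterating \<open>w\<close> advances along the row and cannot jump over \<open>q\<close>,
  since no arc of \<open>w\<close> leaving a point of the class contains an equivalent point.
  Invariance is demanded on the traversed segment only, so that \<open>h\<close> may be invariant
  under a modification of \<open>w\<close> instead.\<close>

lemma period_chain:
  assumes pw: "periodic_perm n w" and nc: "below w w"
    and p: "gaprel w p (p + L)" and q: "gaprel w p q" "even (q - p)" "dir p * p \<le> dir p * q"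
    and h: "\<And>b. even (b - p) \<Longrightarrow> dir p * p \<le> dir p * b \<Longrightarrow> dir p * b < dir p * q \<Longrightarrow> h (w b) = h b"
  shows "h p = h q"
  using assms(3-)
proof (induction "nat (dir p * q - dir p * p)" arbitrary: p rule: less_induct)
  case less
  show ?case
  proof (cases "p = q")
    case False
    then have "dir p * p \<noteq> dir p * q" by (auto simp: dir_def)
    with less.prems(4) have lt: "dir p * p < dir p * q" by linarith
    note s = period_class_step[OF pw nc less.prems(1)]
    have g: "gaprel w p (w p)" using nc by (simp add: below_def)
    have d: "dir (w p) = dir p" by (rule dir_cong[OF s(1)])
    have "\<not> arc p (w p) p" by simp
    then have "\<not> arc p (w p) q" using less.prems(2) unfolding gaprel_iff by blast
    moreover have "even q = even p" "even (w p) = even p" using less.prems(3) s(1) by auto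
    ultimately have le: "dir p * w p \<le> dir p * q"
      using s(2) lt unfolding arc_simp dir_def by (cases "odd p"; simp)
    have "h (w p) = h q"
    proof (rule less.hyps)
      show "nat (dir (w p) * q - dir (w p) * w p) < nat (dir p * q - dir p * p)"
        unfolding d using s(2) lt by simp
      show "gaprel w (w p) (w p + L)" by (rule gaprel_period_cong[OF pw g less.prems(1)])
      show "gaprel w (w p) q" using g less.prems(2) same_gaps_sym same_gaps_trans by blast
      show "even (q - w p)" using less.prems(3) s(1) by auto
      show "dir (w p) * w p \<le> dir (w p) * q" unfolding d by (rule le)
      fix b assume "even (b - w p)" "dir (w p) * w p \<le> dir (w p) * b" "dir (w p) * b < dir (w p) * q"
      then show "h (w b) = h b" using s(1,2) unfolding d by (intro less.prems(5)) auto
    qed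
    moreover have "h (w p) = h p" using lt by (intro less.prems(5)) auto
    ultimately show ?thesis by simp
  qed simp
qed

text \<open>The orbit of \<open>x\<close> reaches a translate of \<open>x\<close> by one period,
  where \<open>h\<close> takes twice or half the value.\<close>

lemma Fix_period_zero:
  assumes pw: "periodic_perm n w" and nc: "below w w" and h: "h \<in> Fix w" and x: "gaprel w x (x + L)"
  shows "h x = 0"
proof -
  have "h x = h (x + L * dir x)"
  proof (rule period_chain[OF pw nc x gaprel_period_all[OF pw x]])
    show "dir x * x \<le> dir x * (x + L * dir x)" by (simp add: dir_def)
  qed (use h in \<open>auto simp: Fix_def\<close>)
  also have "\<dots> = 2 powi dir x * h x" using h by (intro qper_shift) (simp add: Fix_def)
  finally have "h x = 2 powi dir x * h x" .
  moreover have "dir x \<noteq> 0" by (simp add: dir_def)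
  ultimately show ?thesis using powi_2_eq_1[of "dir x"] by simp
qed

lemma finite_class:
  assumes pw: "periodic_perm n w" and x: "\<not> gaprel w x (x + L)"
  shows "finite {b. gaprel w x b}"
proof -
  have "finite {b. gaprel w x b \<and> even (b - e)}" for e
  proof (cases "\<exists>c. gaprel w x c \<and> even (c - e)")
    case True
    then obtain c where c: "gaprel w x c" "even (c - e)" by blast
    have "{b. gaprel w x b \<and> even (b - e)} \<subseteq> {c - L..c + L}"
    proof
      fix b assume b: "b \<in> {b. gaprel w x b \<and> even (b - e)}"
      have "gaprel w c b" using b c(1) same_gaps_sym same_gaps_trans by blast
      moreover have "even (c - b)" using b c(2) by auto
      moreover have "\<not> gaprel w c (c + L)"
        using gaprel_period_cong[OF pw same_gaps_sym[OF c(1)]] x by blast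
      ultimately have "\<bar>c - b\<bar> < L" using gaprel_period[OF pw] by fastforce
      then show "b \<in> {c - L..c + L}" by auto
    qed
    then show ?thesis by (rule finite_subset) simp
  next
    case False
    then have "{b. gaprel w x b \<and> even (b - e)} = {}" by blast
    then show ?thesis by (simp only: finite.emptyI)
  qed
  then have "finite ({b. gaprel w x b \<and> even (b - 0)} \<union> {b. gaprel w x b \<and> even (b - 1)})"
    by (intro finite_UnI)
  moreover have "{b. gaprel w x b} \<subseteq> {b. gaprel w x b \<and> even (b - 0)} \<union> {b. gaprel w x b \<and> even (b - 1)}"
    by auto
  ultimately show ?thesis by (rule rev_finite_subset)
qed

text \<open>On infinite classes \<open>h\<close> is 0. In a finite class \<open>w\<close> increases
  \<open>pos\<close> at every point but the last, because no arc leaving an earlier point contains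
  the last one; hence all orbits in the class reach the last point.\<close>

lemma Fix_gaprel:
  assumes pw: "periodic_perm n w" and nc: "below w w" and h: "h \<in> Fix w" and xy: "gaprel w x y"
  shows "h x = h y"
proof (cases "gaprel w x (x + L)")
  case True
  then show ?thesis
    using Fix_period_zero[OF pw nc h] gaprel_period_cong[OF pw xy] by simp
next
  case False
  define C where "C = {b. gaprel w x b}"
  have fin: "finite C" unfolding C_def by (rule finite_class[OF pw False])
  have C: "x \<in> C" "y \<in> C" using xy by (simp_all add: C_def)
  have "Max (pos ` C) \<in> pos ` C" by (rule Max_in) (use fin C in auto)
  then obtain q where q: "q \<in> C" "pos q = Max (pos ` C)" by force
  have le: "pos b \<le> pos q" if "b \<in> C" for b unfolding q(2) using fin that by simp
  have "h p = h q" if "p \<in> C" for p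
    using that
  proof (induction "card {b \<in> C. pos p < pos b}" arbitrary: p rule: less_induct)
    case less
    show ?case
    proof (cases "p = q")
      case False
      have wp: "gaprel w p (w p)" using nc by (simp add: below_def)
      then have wC: "w p \<in> C" using less.prems same_gaps_trans unfolding C_def by blast
      have "gaprel w p q" using less.prems q(1) same_gaps_sym same_gaps_trans unfolding C_def by blast
      moreover have "\<not> arc p (w p) p" by simp
      ultimately have "\<not> arc p (w p) q" unfolding gaprel_iff by blast
      moreover have "pos p \<noteq> pos q" using False by (simp add: pos_eq_iff)
      ultimately have "pos p < pos (w p)" using le[OF less.prems] unfolding arc_def by argo
      then have "{b \<in> C. pos (w p) < pos b} \<subset> {b \<in> C. pos p < pos b}" using wC by auto
      then have "card {b \<in> C. pos (w p) < pos b} < card {b \<in> C. pos p < pos b}"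
        by (rule psubset_card_mono[rotated]) (use fin in simp)
      then have "h (w p) = h q" using less.hyps wC by blast
      moreover have "h (w p) = h p" using h by (simp add: Fix_def)
      ultimately show ?thesis by simp
    qed simp
  qed
  then show ?thesis using C by metis
qed

text \<open>The function \<open>spread\<close> of the class of \<open>x\<close> is invariant and
  takes the value 1 exactly on that class.\<close>

lemma Fix_separates_finite:
  assumes pw: "periodic_perm n w" and nc: "below w w" and x: "\<not> gaprel w x (x + L)"
    and eq: "\<And>h. h \<in> Fix w \<Longrightarrow> h x = h y"
  shows "gaprel w x y"
proof -
  define C where "C = {b. gaprel w x b}"
  have sep: "k = 0" if "b \<in> C" "b + L * k \<in> C" for b k
  proof (rule ccontr)
    assume "k \<noteq> 0"
    have "gaprel w b (b + L * k)" using that same_gaps_sym same_gaps_trans unfolding C_def by blast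
    then have "gaprel w b (b + L)" using gaprel_translate_period[OF pw] \<open>k \<noteq> 0\<close> by blast
    then show False using gaprel_period_cong[OF pw same_gaps_sym] that(1) x unfolding C_def by blast
  qed
  have val: "spread C (b + L * k) = 2 powi k" if "b \<in> C" for b k
    by (rule spread_shift) (use sep that in blast)+
  have wC: "w b \<in> C \<longleftrightarrow> b \<in> C" for b
    using nc same_gaps_sym same_gaps_trans unfolding C_def below_def by blast
  have "spread C \<in> Fix w"
    unfolding Fix_def
  proof (intro CollectI conjI allI)
    show "spread C \<in> qper" by (rule spread_qper) (use sep in blast)
    fix b
    have "w b - L * k = w (b - L * k)" for k
      using periodic_perm_shift[OF pw, of "b - L * k" k] by simp
    then have wb: "w b - L * k \<in> C \<longleftrightarrow> b - L * k \<in> C" for k by (simp add: wC)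
    show "spread C (w b) = spread C b"
    proof (cases "\<exists>k. b - L * k \<in> C")
      case True
      then obtain k where "b - L * k \<in> C" by blast
      then show ?thesis using val[of "b - L * k" k] val[of "w b - L * k" k] wb by simp
    next
      case False
      then show ?thesis using wb by (simp add: spread_def)
    qed
  qed
  then have "spread C x = spread C y" by (rule eq)
  moreover have "x \<in> C" by (simp add: C_def)
  then have "spread C x = 1" using val[of x 0] by simp
  ultimately have y: "spread C y = 1" by simp
  then obtain k where k: "y - L * k \<in> C" unfolding spread_def by (metis zero_neq_one)
  then have "2 powi k = (1::real)" using val[of "y - L * k" k] y by simp
  then show ?thesis using k by (simp add: powi_2_eq_1 C_def)
qed

text \<open>Invariants separate any class not containing translates of its points from all other
  points. The points left over form a single class by \<open>period_class_all\<close>.\<close>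

lemma gaprel_iff_Fix:
  assumes pw: "periodic_perm n w" and nc: "below w w"
  shows "gaprel w x y \<longleftrightarrow> (\<forall>h\<in>Fix w. h x = h y)"
proof
  assume eq: "\<forall>h\<in>Fix w. h x = h y"
  show "gaprel w x y"
  proof (cases "gaprel w x (x + L) \<and> gaprel w y (y + L)")
    case True
    then show ?thesis using period_class_all[OF pw] by blast
  next
    case False
    then have "gaprel w x y \<or> gaprel w y x"
      using Fix_separates_finite[OF pw nc] eq by metis
    then show ?thesis using same_gaps_sym by blast
  qed
qed (use Fix_gaprel[OF pw nc] in blast)

lemma below_Fix:
  assumes "periodic_perm n w" "below w w" "below v w"
  shows "Fix w \<subseteq> Fix v"
proof
  fix h assume h: "h \<in> Fix w"
  have "h (v x) = h x" for x
    using Fix_gaprel[OF assms(1,2) h, of x "v x"] assms(3) by (simp add: below_def)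
  then show "h \<in> Fix v" using h by (simp add: Fix_def)
qed

lemma below_trans:
  assumes pv: "periodic_perm n v" "below v v" and pw: "periodic_perm n w" "below w w"
    and "below u v" "below v w"
  shows "below u w"
  using assms(5) below_Fix[OF pw assms(6)] gaprel_iff_Fix[OF pv] gaprel_iff_Fix[OF pw]
  unfolding below_def by blast

section \<open>Invariant functions after multiplication by a transposition\<close>

lemma qper_ptransp:
  assumes "h \<in> qper" "\<not> [x = y] (mod L)" "h x = h y"
  shows "h (ptransp n x y b) = h b"
  using qper_shift[OF assms(1)] ptransp_simps[OF assms(2)] assms(3)
  by (cases rule: cong_cases[where z = b and x = x and y = y]) simp_all

text \<open>A function in \<open>qper\<close> with \<open>h x = h y\<close> is invariant under the
  transposition itself. So the two spaces have a common hyperplane section, and their dimensions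
  differ by at most one.\<close>

lemma Fix_ptransp:
  assumes xy: "\<not> [x = y] (mod L)"
  shows "{h \<in> Fix (w \<circ> ptransp n x y). h x - h y = 0} = {h \<in> Fix w. h x - h y = 0}"
proof -
  have "(\<forall>b. h (w (ptransp n x y b)) = h b) \<longleftrightarrow> (\<forall>b. h (w b) = h b)" if "h \<in> qper" "h x = h y" for h
    using qper_ptransp[OF that(1) xy that(2)] ptransp_involution[OF xy] by metis
  then show ?thesis by (auto simp: Fix_def)
qed

lemma rank_Fix_ptransp:
  assumes xy: "\<not> [x = y] (mod L)"
  shows "rank (Fix w) \<le> rank (Fix (w \<circ> ptransp n x y)) + 1"
proof -
  have "rank (Fix w) \<le> rank {h \<in> Fix w. h x - h y = 0} + 1"
    by (rule rank_hyperplane_le[OF separated_Fix lin_diff_eval])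
  also have "{h \<in> Fix w. h x - h y = 0} \<subseteq> Fix (w \<circ> ptransp n x y)"
    using Fix_ptransp[OF xy, of w] by blast
  then have "rank {h \<in> Fix w. h x - h y = 0} \<le> rank (Fix (w \<circ> ptransp n x y))"
    by (rule rank_mono[OF separated_Fix])
  finally show ?thesis by simp
qed

text \<open>With the hyperplane section in common, the dimension can only grow if the hyperplane
  contains the old space and properly cuts the new one.\<close>

lemma rank_Fix_increase:
  assumes xy: "\<not> [x = y] (mod L)" and less: "rank (Fix w) < rank (Fix (w \<circ> ptransp n x y))"
  shows "h \<in> Fix w \<Longrightarrow> h x = h y" "\<exists>h\<in>Fix (w \<circ> ptransp n x y). h x \<noteq> h y"
proof -
  let ?v = "w \<circ> ptransp n x y"
  assume h: "h \<in> Fix w"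
  show "h x = h y"
  proof (rule ccontr)
    assume "h x \<noteq> h y"
    then have "rank {h \<in> Fix w. h x - h y = 0} < rank (Fix w)"
      by (intro rank_hyperplane_less[OF separated_Fix subsp_Fix lin_diff_eval h]) simp
    moreover have "rank (Fix ?v) \<le> rank {h \<in> Fix ?v. h x - h y = 0} + 1"
      by (rule rank_hyperplane_le[OF separated_Fix lin_diff_eval])
    ultimately show False using less unfolding Fix_ptransp[OF xy, of w] by simp
  qed
next
  let ?v = "w \<circ> ptransp n x y"
  show "\<exists>h\<in>Fix ?v. h x \<noteq> h y"
  proof (rule ccontr)
    assume "\<not> ?thesis"
    then have "Fix ?v \<subseteq> Fix w" using Fix_ptransp[OF xy, of w] by auto
    then show False using rank_mono[OF separated_Fix, of "Fix ?v" w] less by simp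
  qed
qed

lemma splits_rank:
  assumes pw: "periodic_perm n w" and nc: "below w w" and s: "splits w x y"
  shows "rank (Fix w) < rank (Fix (w \<circ> ptransp n x y))"
proof -
  let ?v = "w \<circ> ptransp n x y"
  have xy: "\<not> [x = y] (mod L)" and g: "gaprel w x y" using s by (simp_all add: splits_def)
  obtain h where h: "h \<in> Fix ?v" "h x \<noteq> h y"
    using splits_separates[OF pw nc s] gaprel_iff_Fix[OF splits_periodic[OF pw s] splits_nc[OF pw nc s]]
    by blast
  have "{h \<in> Fix w. h x - h y = 0} = Fix w" using Fix_gaprel[OF pw nc _ g] by auto
  then have "rank (Fix w) = rank {h \<in> Fix w. h x - h y = 0}" by simp
  also have "\<dots> < rank (Fix ?v)"
    unfolding Fix_ptransp[OF xy, of w, symmetric]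
    by (rule rank_hyperplane_less[OF separated_Fix subsp_Fix lin_diff_eval h(1)]) (use h(2) in simp)
  finally show ?thesis .
qed

text \<open>Points of an infinite orbit that are more than one period apart: the transposition cuts
  the orbit into two orbits that are still infinite.\<close>

lemma Fix_far_ptransp:
  assumes pw: "periodic_perm n w" and nc: "below w w" and xy: "\<not> [x = y] (mod L)"
    and g: "gaprel w x y" and e: "even (x - y)" and far: "dir x * x + L \<le> dir x * y"
    and h: "h \<in> Fix (w \<circ> ptransp n x y)"
  shows "h x = h y"
proof -
  have L: "L > 0" using n_pos by simp
  have small: "m = 0" if "\<bar>L * m\<bar> < L" for m
    using that L by (simp add: abs_mult)
  note t = ptransp_simps[OF xy]
  have hq: "h \<in> qper" and hw: "h (w (ptransp n x y b)) = h b" for b using h by (auto simp: Fix_def)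
  define s where "s = dir x"
  have s: "s = 1 \<or> s = - 1" "s * s = 1" by (auto simp: s_def dir_def)
  have px: "gaprel w x (x + L)"
    using far by (intro gaprel_period[OF pw g e]) (auto simp: dir_def split: if_splits)
  obtain k where k: "s * x + L * k < s * y" "s * y \<le> s * x + L * k + L" using period_bracket by blast
  \<comment> \<open>The translate of \<open>y\<close> less than one period ahead of
    \<open>x\<close>. Strictly between \<open>x\<close> and its translate by one period ahead,
    \<open>a\<close> is the only point moved by the transposition.\<close>
  define a where "a = y + L * (- (s * k))"
  have sa: "s * a = s * y - L * k" using s(2) by (simp add: a_def algebra_simps)
  have "s * a \<noteq> s * x + L"
  proof
    assume "s * a = s * x + L"
    then have "s * (s * a) = s * (s * x + L)" by simp
    then have "a = x + L * s" using s(1) by auto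
    then have "y = x + L * (s + s * k)" by (simp add: a_def algebra_simps)
    then show False using xy by (simp add: cong_def)
  qed
  with k sa have a: "s * x < s * a" "s * a < s * x + L" by linarith+
  have "L * k > L * 0" using far a sa unfolding s_def by linarith
  then have "k \<ge> 1" using L by (simp only: mult_less_cancel_left) simp
  have ga: "gaprel w x a"
    using gaprel_period_all[OF pw gaprel_period_cong[OF pw g px]] g same_gaps_trans
    unfolding a_def by blast
  have ea: "even (a - x)" using e by (auto simp: a_def)
  then have da: "dir a = s" unfolding s_def by (rule dir_cong)
  have pa: "gaprel w a (a + L)" by (rule gaprel_period_cong[OF pw ga px])
  note sx = period_class_step[OF pw nc px, folded s_def] and sa' = period_class_step[OF pw nc pa, unfolded da]
  have dw: "dir (w x) = s" "dir (w a) = s" using dir_cong[OF sx(1)] dir_cong[OF sa'(1)] da s_def by simp_all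
  have y: "y = a + L * (s * k)" by (simp add: a_def)
  have wy: "w y = w a + L * (s * k)" unfolding y by (rule periodic_perm_shift[OF pw])
  have hb: "h (w b) = h b" if b: "s * x < s * b" "s * b < s * x + L" "b \<noteq> a" for b
  proof -
    have nx: "b \<noteq> x + L * m" for m
    proof
      assume m: "b = x + L * m"
      then have "s * b = s * x + L * (s * m)" by (simp add: algebra_simps)
      then have "L * (s * m) > 0" "L * (s * m) < L" using b by linarith+
      then have "s * m = 0" by (intro small) linarith
      then show False using \<open>L * (s * m) > 0\<close> by (simp only: mult_zero_right)
    qed
    have ny: "b \<noteq> y + L * m" for m
    proof
      assume m: "b = y + L * m"
      then have m': "b = a + L * (s * k + m)" by (simp add: a_def algebra_simps)
      then have "s * b = s * a + L * (s * (s * k + m))" by (simp add: algebra_simps)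
      then have "\<bar>L * (s * (s * k + m))\<bar> < L" using b a by linarith
      then have "s * (s * k + m) = 0" by (rule small)
      then have "s * k + m = 0" using s(1) by auto
      then show False using m' b(3) by simp
    qed
    have "ptransp n x y b = b"
    proof (cases rule: cong_cases[where z = b and x = x and y = y])
      case other
      then show ?thesis by (rule t(3))
    qed (simp_all only: nx ny)
    then show ?thesis using hw[of b] by simp
  qed
  have nle: "s * w x \<le> s * a" "s * w a \<le> s * x + L"
  proof -
    have "\<not> arc x (w x) x" "\<not> arc a (w a) a" by simp_all
    moreover have r: "gaprel w a (x + L * j)" for j
      using same_gaps_trans[OF same_gaps_sym[OF ga] gaprel_period_all[OF pw px]] .
    ultimately have "\<not> arc x (w x) a" "\<not> arc a (w a) (x + L * j)" for j
      using ga unfolding gaprel_iff by metis+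
    from this(1) this(2)[of 1] this(2)[of "- 1"]
    have *: "\<not> arc x (w x) a" "\<not> arc a (w a) (x + L)" "\<not> arc a (w a) (x - L)" by simp_all
    have p: "even a = even x" "even (w a) = even x" "even (w x) = even x" "even (x + L) = even x"
        "even (x - L) = even x"
      using ea sx(1) sa'(1) by auto
    obtain l where l: "l = L" by blast
    have "s * w x \<le> s * a \<and> s * w a \<le> s * x + L"
      using * a sx(2) sa'(2) unfolding arc_simp p unfolding s_def dir_def l[symmetric]
      by (cases "odd x"; simp; smt)
    then show "s * w x \<le> s * a" "s * w a \<le> s * x + L" by blast+
  qed
  have wx: "gaprel w x (w x)" "gaprel w a (w a)" using nc by (simp_all add: below_def)
  \<comment> \<open>The orbit from \<open>w x\<close> runs to \<open>a\<close> untouched by the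
    transposition. As \<open>h y = h (w x)\<close> and \<open>y\<close> is a nontrivial translate of
    \<open>a\<close>, the value \<open>h y\<close> is a proper multiple of itself.\<close>
  have "h (w x) = h a"
  proof (rule period_chain[OF pw nc gaprel_period_cong[OF pw wx(1) px], unfolded dw])
    show "gaprel w (w x) a" using wx ga same_gaps_sym same_gaps_trans by blast
    show "even (a - w x)" using ea sx(1) by auto
    fix b assume "s * w x \<le> s * b" "s * b < s * a"
    then show "h (w b) = h b" using sx a by (intro hb) auto
  qed (rule nle)
  moreover have "h (w x) = h y" using hw[of y] t(2)[of 0] by simp
  moreover have "h y = 2 powi (s * k) * h a" unfolding y by (rule qper_shift[OF hq])
  moreover have "2 powi (s * k) \<noteq> (1::real)" using \<open>k \<ge> 1\<close> s(1) by (auto simp: powi_2_eq_1)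
  ultimately have "h y = 0" by simp
  \<comment> \<open>Likewise the orbit from \<open>w a\<close> runs to the translate of
    \<open>x\<close> by one period, which makes \<open>h x\<close> equal to
    \<open>2 powi (s * k + s)\<close> times itself.\<close>
  have "h (w a) = h (x + L * s)"
  proof (rule period_chain[OF pw nc gaprel_period_cong[OF pw wx(2) pa], unfolded dw])
    show "gaprel w (w a) (x + L * s)"
      using gaprel_period_all[OF pw px] wx ga same_gaps_sym same_gaps_trans by blast
    show "even (x + L * s - w a)" using ea sa'(1) by auto
    have e: "s * (x + L * s) = s * x + L" using s(2) by (simp add: algebra_simps)
    show "s * w a \<le> s * (x + L * s)" unfolding e by (rule nle)
    fix b assume "s * w a \<le> s * b" "s * b < s * (x + L * s)"
    then show "h (w b) = h b" using sa' a unfolding e by (intro hb) auto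
  qed
  moreover have "h (x + L * s) = 2 powi s * h x" by (rule qper_shift[OF hq])
  moreover have "h x = h (w y)" using hw[of x] t(1)[of 0] by simp
  moreover have "h (w y) = 2 powi (s * k) * h (w a)" unfolding wy by (rule qper_shift[OF hq])
  ultimately have "h x = (2 powi (s * k) * 2 powi s) * h x" by (metis mult.assoc)
  also have "2 powi (s * k) * 2 powi s = (2::real) powi (s * k + s)" by (simp add: power_int_add)
  finally have "h x = 2 powi (s * k + s) * h x" .
  moreover have "s * k + s \<noteq> 0" using \<open>k \<ge> 1\<close> s(1) by auto
  then have "2 powi (s * k + s) \<noteq> (1::real)" by (simp add: powi_2_eq_1)
  ultimately have "h x = 0" by simp
  then show ?thesis using \<open>h y = 0\<close> by simp
qed

text \<open>Growth of the dimension means that all invariants of \<open>w\<close> agree at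
  \<open>x\<close> and \<open>y\<close>, so these are equivalent; pairs too far apart are excluded
  by \<open>Fix_far_ptransp\<close>.\<close>

lemma rank_splits:
  assumes pw: "periodic_perm n w" and nc: "below w w" and xy: "\<not> [x = y] (mod L)"
    and less: "rank (Fix w) < rank (Fix (w \<circ> ptransp n x y))"
  shows "splits w x y"
proof -
  have g: "gaprel w x y"
    using gaprel_iff_Fix[OF pw nc] rank_Fix_increase(1)[OF xy less] by blast
  obtain h where h: "h \<in> Fix (w \<circ> ptransp n x y)" "h x \<noteq> h y"
    using rank_Fix_increase(2)[OF xy less] by blast
  have "\<bar>x - y\<bar> < L" if e: "even (x - y)"
  proof (rule ccontr)
    assume "\<not> \<bar>x - y\<bar> < L"
    then consider "dir x * x + L \<le> dir x * y" | "dir x * y + L \<le> dir x * x"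
      by (cases "odd x") (auto simp: dir_def abs_if split: if_splits)
    then show False
    proof cases
      case 1
      then show False using Fix_far_ptransp[OF pw nc xy g e _ h(1)] h(2) by blast
    next
      case 2
      have "\<not> [y = x] (mod L)" using xy cong_sym by blast
      moreover have "even (y - x)" using e by simp
      moreover have "dir y = dir x" by (rule dir_cong) (use e in simp)
      ultimately show False
        using Fix_far_ptransp[OF pw nc _ same_gaps_sym[OF g], of h] h 2 ptransp_commute[OF xy] by simp
    qed
  qed
  then show ?thesis using g xy by (simp add: splits_def)
qed

end

section \<open>Reflection length and the divisors of the Coxeter element\<close>

abbreviation finv :: "(int \<Rightarrow> int) \<Rightarrow> int \<Rightarrow> int" where
  "finv \<equiv> inv_into UNIV"

lemma comp_list_append: "comp_list (us @ vs) = comp_list us \<circ> comp_list vs"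
  by (induction us) (simp_all add: comp_assoc)

declare foldr_append [simp del]

context affA
begin

abbreviation W :: "(int \<Rightarrow> int) set" where "W \<equiv> W_affA n"
abbreviation len :: "(int \<Rightarrow> int) \<Rightarrow> nat" where "len \<equiv> refl_length n"
abbreviation cox :: "int \<Rightarrow> int" where "cox \<equiv> coxeter_elt n"

lemma W_bij: "w \<in> W \<Longrightarrow> bij w"
  by (simp add: W_affA_def periodic_perm_def)

lemma finv_comp: "w \<in> W \<Longrightarrow> finv w \<circ> w = id" "w \<in> W \<Longrightarrow> w \<circ> finv w = id"
  using W_bij by (auto simp: bij_is_inj bij_is_surj surj_f_inv_f fun_eq_iff)

lemma finv_comp': "w \<in> W \<Longrightarrow> finv w \<circ> (w \<circ> f) = f" "w \<in> W \<Longrightarrow> w \<circ> (finv w \<circ> f) = f"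
  using finv_comp by (simp_all add: comp_assoc[symmetric])

lemma id_W: "id \<in> W"
  by (simp add: W_affA_def periodic_perm_def total_shift_def)

lemma reflsE:
  assumes "t \<in> refls n"
  obtains x y where "t = ptransp n x y" "\<not> [x = y] (mod L)"
  using assms by (auto simp: refls_def)

lemma refls_W: "t \<in> refls n \<Longrightarrow> t \<in> W"
  using ptransp_in_W_affA[OF n_pos] by (auto simp: refls_def)

lemma refls_involution:
  assumes "t \<in> refls n"
  shows "t \<circ> t = id" "t \<circ> (t \<circ> f) = f"
proof -
  show "t \<circ> t = id"
    using assms by (elim reflsE) (simp add: fun_eq_iff ptransp_involution)
  then show "t \<circ> (t \<circ> f) = f" by (simp add: comp_assoc[symmetric])
qed

lemma comp_list_W: "set ts \<subseteq> refls n \<Longrightarrow> comp_list ts \<in> W"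
  by (induction ts) (simp_all add: id_W W_affA_comp[OF n_pos] refls_W)

lemma comp_list_rev:
  assumes "set ts \<subseteq> refls n"
  shows "comp_list ts \<circ> comp_list (rev ts) = id" "comp_list (rev ts) \<circ> comp_list ts = id"
proof -
  have *: "set ts \<subseteq> refls n \<Longrightarrow> comp_list ts \<circ> comp_list (rev ts) = id" for ts
  proof (induction ts)
    case (Cons t ts)
    have "comp_list (t # ts) \<circ> comp_list (rev (t # ts)) = t \<circ> (comp_list ts \<circ> comp_list (rev ts)) \<circ> t"
      by (simp add: comp_list_append comp_assoc)
    also have "comp_list ts \<circ> comp_list (rev ts) = id" by (rule Cons.IH) (use Cons.prems in auto)
    also have "t \<circ> id \<circ> t = id" using Cons.prems by (simp add: refls_involution)
    finally show ?case .
  qed simp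
  show "comp_list ts \<circ> comp_list (rev ts) = id" "comp_list (rev ts) \<circ> comp_list ts = id"
    using *[of ts] *[of "rev ts"] assms by simp_all
qed

section \<open>Generation by reflections\<close>

lemma W_periodic_eq_idI: "w \<in> W \<Longrightarrow> (\<And>x. 1 \<le> x \<Longrightarrow> x \<le> L \<Longrightarrow> w x = x) \<Longrightarrow> w = id"
  using periodic_eqI[OF W_affA_periodic W_affA_periodic[OF id_W]] by simp

text \<open>Induction on the number of moved points in a period. A point with incongruent image is
  repaired by one reflection. If all images are congruent to their points, total shift 0 provides a
  second moved point, and two reflections bring the first one back.\<close>

lemma refls_generate:
  assumes "w \<in> W"
  shows "\<exists>ts. set ts \<subseteq> refls n \<and> comp_list ts = w"
  using assms
proof (induction "card {x \<in> {1..L}. w x \<noteq> x}" arbitrary: w rule: less_induct)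
  case less
  note pw = W_affA_periodic[OF less.prems]
  have inj: "w a = w b \<longleftrightarrow> a = b" for a b
    using W_bij[OF less.prems] by (metis bij_is_inj injD)
  have reduce: ?case
    if ts: "set us \<subseteq> refls n" and x: "x \<in> {1..L}" "w x \<noteq> x" "(comp_list us \<circ> w) x = x"
      and fixed: "\<And>z. w z = z \<Longrightarrow> comp_list us z = z" for us x
  proof -
    let ?v = "comp_list us \<circ> w"
    have "{x \<in> {1..L}. ?v x \<noteq> x} \<subset> {x \<in> {1..L}. w x \<noteq> x}"
      using x fixed by (auto simp: comp_def)
    then have "card {x \<in> {1..L}. ?v x \<noteq> x} < card {x \<in> {1..L}. w x \<noteq> x}"
      by (rule psubset_card_mono[rotated]) (rule finite_subset[of _ "{1..L}"], auto)
    moreover have "?v \<in> W" by (rule W_affA_comp[OF n_pos less.prems comp_list_W[OF ts]])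
    ultimately obtain vs where vs: "set vs \<subseteq> refls n" "comp_list vs = ?v" using less.hyps by blast
    have "comp_list (rev us @ vs) = w"
      unfolding comp_list_append vs(2) comp_assoc[symmetric] comp_list_rev[OF ts] by simp
    then show ?thesis using ts vs by (intro exI[of _ "rev us @ vs"]) auto
  qed
  have fixed_cong: "w x = x" if "w z = z" "x = z + L * k" for x z k
    using that periodic_perm_shift[OF pw, of z k] by simp
  show ?case
  proof (cases "\<exists>x\<in>{1..L}. \<not> [w x = x] (mod L)")
    case True
    then obtain x where x: "x \<in> {1..L}" "\<not> [x = w x] (mod L)" using cong_sym by blast
    note t = ptransp_simps[OF x(2)]
    have wx: "w x \<noteq> x" using x(2) by auto
    show ?thesis
    proof (rule reduce[of "[ptransp n x (w x)]", OF _ x(1) wx])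
      show "set [ptransp n x (w x)] \<subseteq> refls n" using x(2) by (auto simp: refls_def)
      show "(comp_list [ptransp n x (w x)] \<circ> w) x = x" using t(2)[of 0] by simp
      fix z assume z: "w z = z"
      then have "ptransp n x (w x) z = z"
      proof (cases rule: cong_cases[where z = z and x = x and y = "w x"])
        case (x k)
        then have "w x = x" using fixed_cong[OF z, of x "- k"] by simp
        then show ?thesis using wx by simp
      next
        case (y k)
        then have "w (w x) = w x" using fixed_cong[OF z, of "w x" "- k"] by simp
        then show ?thesis using wx inj by simp
      next
        case other
        then show ?thesis by (rule t(3))
      qed
      then show "comp_list [ptransp n x (w x)] z = z" by simp
    qed
  next
    case False
    show ?thesis
    proof (cases "w = id")
      case True
      then show ?thesis by (intro exI[of _ "[]"]) simp
    next
      case nid: False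
      then obtain x where x: "x \<in> {1..L}" "w x \<noteq> x" using W_periodic_eq_idI[OF less.prems] by auto
      have "\<exists>y\<in>{1..L} - {x}. w y \<noteq> y"
      proof (rule ccontr)
        assume "\<not> ?thesis"
        then have "(\<Sum>y\<in>{1..L} - {x}. w y - y) = 0" by simp
        then have "(\<Sum>y=1..L. w y - y) = w x - x" using x(1) by (simp add: sum.remove)
        then show False using W_affA_sum[OF less.prems] x(2) by simp
      qed
      then obtain y where y: "y \<in> {1..L}" "y \<noteq> x" "w y \<noteq> y" by blast
      have xy: "\<not> [x = y] (mod L)"
      proof
        assume "[x = y] (mod L)"
        then have "L dvd x - y" by (simp add: cong_iff_dvd_diff)
        then have "\<bar>L\<bar> \<le> \<bar>x - y\<bar>" using y(2) by (intro dvd_imp_le_int) simp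
        then show False using x(1) y(1) by auto
      qed
      obtain k where k: "w x = x + L * k" using False x(1) by (metis cong_iff_lin cong_sym)
      have xy': "\<not> [x = y + L * k] (mod L)" using xy by (simp add: cong_def)
      note t = ptransp_simps[OF xy] and t' = ptransp_simps[OF xy']
      \<comment> \<open>\<open>ptransp n x y\<close> takes \<open>w x = x + L * k\<close> to
        \<open>y + L * k\<close>, which the other reflection takes to \<open>x\<close>. Points
        congruent to neither \<open>x\<close> nor \<open>y\<close> stay fixed.\<close>
      show ?thesis
      proof (rule reduce[of "[ptransp n x (y + L * k), ptransp n x y]", OF _ x])
        show "set [ptransp n x (y + L * k), ptransp n x y] \<subseteq> refls n"
          using xy xy' by (auto simp: refls_def)
        show "(comp_list [ptransp n x (y + L * k), ptransp n x y] \<circ> w) x = x"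
          using t(1)[of k] t'(2)[of 0] by (simp add: k)
        fix z assume z: "w z = z"
        have "\<not> [z = x] (mod L)" "\<not> [z = y] (mod L)"
          using fixed_cong[OF z] x(2) y(3) by (metis cong_iff_lin)+
        moreover from this have "\<not> [z = y + L * k] (mod L)" by (simp add: cong_def)
        ultimately show "comp_list [ptransp n x (y + L * k), ptransp n x y] z = z"
          using t(3) t'(3) by simp
      qed
    qed
  qed
qed

section \<open>Reflection length\<close>

lemma len_witness:
  assumes "w \<in> W"
  obtains ts where "set ts \<subseteq> refls n" "length ts = len w" "comp_list ts = w"
proof -
  obtain ts where "set ts \<subseteq> refls n" "comp_list ts = w" using refls_generate[OF assms] by blast
  then have "\<exists>k. \<exists>ts. set ts \<subseteq> refls n \<and> length ts = k \<and> comp_list ts = w" by blast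
  from LeastI_ex[OF this] show ?thesis using that unfolding refl_length_def by blast
qed

lemma len_le: "set ts \<subseteq> refls n \<Longrightarrow> comp_list ts = w \<Longrightarrow> len w \<le> length ts"
  unfolding refl_length_def by (rule Least_le) blast

lemma W_comp: "v \<in> W \<Longrightarrow> w \<in> W \<Longrightarrow> v \<circ> w \<in> W"
  using W_affA_comp[OF n_pos] by blast

lemma W_finv:
  assumes "w \<in> W"
  shows "finv w \<in> W"
proof -
  obtain ts where ts: "set ts \<subseteq> refls n" "comp_list ts = w" using refls_generate[OF assms] by blast
  have "finv w = finv w \<circ> (w \<circ> comp_list (rev ts))"
    unfolding ts(2)[symmetric] comp_list_rev(1)[OF ts(1)] by simp
  also have "\<dots> = comp_list (rev ts)" using assms by (rule finv_comp')
  finally show ?thesis using comp_list_W[of "rev ts"] ts(1) by simp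
qed

lemma len_comp:
  assumes "v \<in> W" "w \<in> W"
  shows "len (v \<circ> w) \<le> len v + len w"
proof -
  obtain ts us where "set ts \<subseteq> refls n" "length ts = len v" "comp_list ts = v"
    "set us \<subseteq> refls n" "length us = len w" "comp_list us = w"
    using len_witness[OF assms(1)] len_witness[OF assms(2)] by metis
  then show ?thesis using len_le[of "ts @ us" "v \<circ> w"] by (simp add: comp_list_append)
qed

lemma len_id: "len id = 0"
  using len_le[of "[]" id] by simp

lemma conj_comp_list:
  assumes "w \<in> W"
  shows "w \<circ> comp_list ts \<circ> finv w = comp_list (map (\<lambda>t. w \<circ> t \<circ> finv w) ts)"
proof (induction ts)
  case Nil
  then show ?case using finv_comp[OF assms] by simp
next
  case (Cons t ts)
  have "w \<circ> comp_list (t # ts) \<circ> finv w = (w \<circ> t \<circ> finv w) \<circ> (w \<circ> comp_list ts \<circ> finv w)"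
    by (simp add: comp_assoc finv_comp'[OF assms])
  also have "\<dots> = comp_list (map (\<lambda>t. w \<circ> t \<circ> finv w) (t # ts))"
    unfolding Cons.IH by simp
  finally show ?case .
qed

lemma len_conj:
  assumes w: "w \<in> W" and v: "v \<in> W"
  shows "len (w \<circ> v \<circ> finv w) \<le> len v"
proof -
  obtain ts where ts: "set ts \<subseteq> refls n" "length ts = len v" "comp_list ts = v"
    using len_witness[OF v] by blast
  have "w \<circ> t \<circ> finv w \<in> refls n" if "t \<in> refls n" for t
    using that
  proof (rule reflsE)
    fix x y assume t: "t = ptransp n x y" "\<not> [x = y] (mod L)"
    have "\<not> [w x = w y] (mod L)" using t(2) periodic_perm_cong_iff[OF W_affA_periodic[OF w]] by blast
    then show "w \<circ> t \<circ> finv w \<in> refls n"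
      unfolding t conjugate_ptransp[OF W_affA_periodic[OF w]] refls_def by blast
  qed
  then have "set (map (\<lambda>t. w \<circ> t \<circ> finv w) ts) \<subseteq> refls n" using ts(1) by auto
  from len_le[OF this conj_comp_list[OF w, symmetric]] show ?thesis using ts by simp
qed

section \<open>The Coxeter element and chains of splittings below it\<close>

lemma cox_eq: "cox i = (if odd i then i + 2 else i - 2)"
  by (rule coxeter_elt_eq[OF n_pos])

lemma cox_W: "cox \<in> W"
proof -
  have "\<not> [j = j + 1] (mod L)" for j using n_pos by (auto simp: cong_iff_dvd_diff)
  then have "simple_refl n j \<in> refls n" for j unfolding simple_refl_def refls_def by blast
  then have "set (map (\<lambda>j. simple_refl n (2 * j)) [1..int n] @ map (\<lambda>j. simple_refl n (2 * j - 1)) [1..int n]) \<subseteq> refls n"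
    by auto
  then show ?thesis unfolding coxeter_elt_def by (rule comp_list_W)
qed

text \<open>The arcs of the successor map are empty.\<close>

lemma below_cox: "below v cox"
proof -
  have "\<not> arc a (cox a) b" for a b
    by (cases "odd a") (auto simp: arc_simp cox_eq, presburger+)
  then show ?thesis by (simp add: below_def gaprel_iff)
qed

lemma below_id: "below id w"
  by (simp add: below_def)

lemma rank_Fix_comp_list:
  "set ts \<subseteq> refls n \<Longrightarrow> rank (Fix w) \<le> rank (Fix (w \<circ> comp_list ts)) + length ts"
proof (induction ts arbitrary: w)
  case (Cons t ts)
  have "rank (Fix w) \<le> rank (Fix (w \<circ> t)) + 1"
    using Cons.prems rank_Fix_ptransp by (auto elim: reflsE)
  also have "rank (Fix (w \<circ> t)) \<le> rank (Fix (w \<circ> t \<circ> comp_list ts)) + length ts"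
    by (rule Cons.IH) (use Cons.prems in auto)
  also have "w \<circ> t \<circ> comp_list ts = w \<circ> comp_list (t # ts)" by (simp add: comp_assoc)
  finally show ?case unfolding list.size by linarith
qed simp

lemma rank_Fix_id: "rank (Fix id) = 2 * n"
proof -
  have "Fix id = qper" by (auto simp: Fix_def)
  then show ?thesis using rank_qper rank_le[OF separated_qper] by simp
qed

text \<open>An invariant function has period 2, hence period \<open>2 * n\<close>, against the
  factor 2 in \<open>qper\<close>.\<close>

lemma rank_Fix_cox: "rank (Fix cox) = 0"
proof -
  have "h = (\<lambda>_. 0)" if h: "h \<in> Fix cox" for h
  proof
    fix x
    have hc: "h (cox i) = h i" for i using h by (simp add: Fix_def)
    have step: "h (i + 2) = h i" for i
      using hc[of i] hc[of "i + 2"] by (cases "odd i") (simp_all add: cox_eq)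
    have "h (x + 2 * int m) = h x" for m
    proof (induction m)
      case (Suc m)
      then show ?case using step[of "x + 2 * int m"] by (simp add: algebra_simps)
    qed simp
    from this[of n] show "h x = 0" using h by (simp add: Fix_def qper_def)
  qed
  then have "separated 0 (Fix cox)" unfolding separated_def by simp
  then show ?thesis using rank_le by fastforce
qed

lemma len_cox_ge: "2 * n \<le> len cox"
proof -
  obtain ts where "set ts \<subseteq> refls n" "length ts = len cox" "comp_list ts = cox"
    using len_witness[OF cox_W] by blast
  then show ?thesis using rank_Fix_comp_list[of ts id] by (simp add: rank_Fix_id rank_Fix_cox)
qed

text \<open>Descend from \<open>w\<close> to \<open>v\<close> by splittings: each costs one
  reflection and raises the dimension of the space of invariants by at least one.\<close>

lemma below_len:
  assumes v: "v \<in> W" "below v v" and w: "w \<in> W" "below w w" and vw: "below v w"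
  shows "len (finv v \<circ> w) + rank (Fix w) \<le> rank (Fix v)"
  using w vw
proof (induction "2 * n - rank (Fix w)" arbitrary: w rule: less_induct)
  case less
  show ?case
  proof (cases "v = w")
    case True
    then show ?thesis using finv_comp(1)[OF v(1)] len_id by simp
  next
    case False
    obtain x y where s: "splits w x y" and b: "below v (w \<circ> ptransp n x y)"
      using splits_exists[OF v(1) less.prems(1,2) v(2) less.prems(3) False] by blast
    define t where "t = ptransp n x y"
    have t: "t \<in> refls n" using s by (auto simp: t_def splits_def refls_def)
    note pw = W_affA_periodic[OF less.prems(1)]
    have wt: "w \<circ> t \<in> W" by (rule W_comp[OF less.prems(1) refls_W[OF t]])
    have rk: "rank (Fix w) < rank (Fix (w \<circ> t))"
      unfolding t_def by (rule splits_rank[OF pw less.prems(2) s])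
    moreover have "rank (Fix (w \<circ> t)) \<le> 2 * n" by (rule rank_le[OF separated_Fix])
    ultimately have "len (finv v \<circ> (w \<circ> t)) + rank (Fix (w \<circ> t)) \<le> rank (Fix v)"
      using splits_nc[OF pw less.prems(2) s] b wt unfolding t_def by (intro less.hyps) auto
    moreover have "len (finv v \<circ> w) \<le> len (finv v \<circ> (w \<circ> t)) + len t"
    proof -
      have "finv v \<circ> w = (finv v \<circ> (w \<circ> t)) \<circ> t" using refls_involution[OF t] by (simp add: comp_assoc)
      then show ?thesis using len_comp[OF W_comp[OF W_finv[OF v(1)] wt] refls_W[OF t]] by simp
    qed
    moreover have "len t \<le> 1" using len_le[of "[t]" t] t by simp
    ultimately show ?thesis using rk by linarith
  qed
qed

text \<open>Chains of splittings from \<open>w\<close> down to \<open>id\<close> and from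
  \<open>cox\<close> down to \<open>w\<close>. The bounds add up to \<open>2 * n\<close>, the length
  of \<open>cox\<close>, so subadditivity makes both of them equalities.\<close>

lemma nc_len:
  assumes w: "w \<in> W" "below w w"
  shows "len w + rank (Fix w) \<le> 2 * n" "len (finv w \<circ> cox) \<le> rank (Fix w)"
  using below_len[OF id_W below_id w below_id] below_len[OF w cox_W below_cox below_cox]
  by (simp_all add: rank_Fix_id rank_Fix_cox)

lemma len_cox: "len cox = 2 * n"
  using nc_len(1)[OF cox_W below_cox] len_cox_ge by simp

lemma len_factor:
  assumes "v \<in> W" "w \<in> W"
  shows "len w \<le> len v + len (finv v \<circ> w)"
  using len_comp[OF assms(1) W_comp[OF W_finv[OF assms(1)] assms(2)]]
  unfolding finv_comp'(2)[OF assms(1)] .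

lemma nc_P_set:
  assumes w: "w \<in> W" "below w w"
  shows "w \<in> P_set n"
  using nc_len[OF w] len_cox len_factor[OF w(1) cox_W] w(1) unfolding P_set_def abs_le_def by simp

lemma below_abs_le:
  assumes v: "v \<in> W" "below v v" and w: "w \<in> W" "below w w" and vw: "below v w"
  shows "abs_le n v w"
proof -
  have "len w + len (finv w \<circ> cox) = 2 * n"
    using nc_P_set[OF w] len_cox by (simp add: P_set_def abs_le_def)
  then have "len v + len (finv v \<circ> w) \<le> len w"
    using below_len[OF v w vw] nc_len[OF v] nc_len[OF w] by linarith
  then show ?thesis using len_factor[OF v(1) w(1)] unfolding abs_le_def by simp
qed

text \<open>Reflections are stripped from the right end of the word for \<open>cox\<close>. Each
  removal raises the dimension, so by \<open>rank_splits\<close> it is a splitting and leaves a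
  noncrossing permutation.\<close>

lemma reduced_cox_prefix:
  assumes "set (us @ vs) \<subseteq> refls n" "comp_list (us @ vs) = cox" "length (us @ vs) = 2 * n"
  shows "below (comp_list us) (comp_list us)"
    and "vs \<noteq> [] \<Longrightarrow> below (comp_list us) (comp_list (us @ [hd vs]))"
proof -
  have "below (comp_list us) (comp_list us) \<and> (vs \<noteq> [] \<longrightarrow> below (comp_list us) (comp_list (us @ [hd vs])))"
    using assms
  proof (induction vs arbitrary: us)
    case Nil
    then show ?case using below_cox by simp
  next
    case (Cons t vs)
    define w where "w = comp_list (us @ [t])"
    have t: "t \<in> refls n" and us: "set us \<subseteq> refls n" "set vs \<subseteq> refls n" using Cons.prems by auto
    have w: "w \<in> W" unfolding w_def by (rule comp_list_W) (use t us in auto)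
    have "us @ t # vs = (us @ [t]) @ vs" by simp
    note prems = Cons.prems[unfolded this]
    have nc: "below w w" using Cons.IH[OF prems] unfolding w_def by blast
    have wt: "comp_list us = w \<circ> t"
      using refls_involution[OF t] by (simp add: w_def comp_list_append comp_assoc)
    have "w \<circ> comp_list vs = cox" using prems(2) unfolding w_def comp_list_append[of _ vs] .
    \<comment> \<open>One reflection changes the dimension by at most one, so \<open>2 * n\<close>
      of them lead from \<open>2 * n\<close> to 0 only if each lowers it.\<close>
    then have "rank (Fix w) \<le> length vs"
      using rank_Fix_comp_list[OF us(2), of w] rank_Fix_cox by simp
    moreover have "2 * n \<le> rank (Fix (w \<circ> t)) + length us"
      using rank_Fix_comp_list[OF us(1), of id] unfolding id_comp wt rank_Fix_id .
    ultimately have less: "rank (Fix w) < rank (Fix (w \<circ> t))" using Cons.prems(3) by simp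
    obtain x y where xy: "t = ptransp n x y" "\<not> [x = y] (mod L)" using t by (rule reflsE)
    note pw = W_affA_periodic[OF w]
    have s: "splits w x y" by (rule rank_splits[OF pw nc xy(2) less[unfolded xy(1)]])
    have "below (w \<circ> t) (w \<circ> t)" "below (w \<circ> t) w"
      using splits_nc[OF pw nc s] splits_below[OF pw nc s] unfolding xy(1) by blast+
    then show ?case unfolding wt list.sel w_def by blast
  qed
  then show "below (comp_list us) (comp_list us)"
    and "vs \<noteq> [] \<Longrightarrow> below (comp_list us) (comp_list (us @ [hd vs]))" by blast+
qed

lemma reduced_cox_prefix_below:
  assumes "set (us @ vs @ zs) \<subseteq> refls n" "comp_list (us @ vs @ zs) = cox" "length (us @ vs @ zs) = 2 * n"
  shows "below (comp_list us) (comp_list (us @ vs))"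
  using assms
proof (induction vs arbitrary: zs rule: rev_induct)
  case Nil
  then have "below (comp_list us) (comp_list us)"
    unfolding append_Nil by (rule reduced_cox_prefix(1))
  then show ?case unfolding append_Nil2 .
next
  case (snoc v vs)
  have "us @ (vs @ [v]) @ zs = (us @ vs) @ v # zs" "us @ (vs @ [v]) @ zs = (us @ vs @ [v]) @ zs"
    by simp_all
  note r = snoc.prems[unfolded this(1)] and r' = snoc.prems[unfolded this(2)]
  have p: "periodic_perm n (comp_list (us @ vs))" "periodic_perm n (comp_list (us @ vs @ [v]))"
    by (rule W_affA_periodic[OF comp_list_W]; use snoc.prems in auto)+
  have "below (comp_list us) (comp_list (us @ vs))" by (rule snoc.IH[of "v # zs"]) (use snoc.prems in \<open>simp_all only: append_assoc append.simps\<close>)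
  moreover have "below (comp_list (us @ vs)) (comp_list (us @ vs @ [v]))"
    using reduced_cox_prefix(2)[OF r] unfolding list.sel append_assoc by blast
  ultimately show ?case
    using below_trans[OF p(1) reduced_cox_prefix(1)[OF r] p(2) reduced_cox_prefix(1)[OF r']] by blast
qed

text \<open>Shortest words for \<open>v\<close>, \<open>finv v \<circ> w\<close> and
  \<open>finv w \<circ> cox\<close> concatenate to a word of length \<open>2 * n\<close> for
  \<open>cox\<close>, of which \<open>v\<close> and \<open>w\<close> are prefixes.\<close>

lemma abs_le_below:
  assumes v: "v \<in> W" and w: "w \<in> P_set n" and le: "abs_le n v w"
  shows "below v w"
proof -
  have wW: "w \<in> W" using w by (simp add: P_set_def)
  obtain us vs zs where ts: "set us \<subseteq> refls n" "length us = len v" "comp_list us = v"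
     "set vs \<subseteq> refls n" "length vs = len (finv v \<circ> w)" "comp_list vs = finv v \<circ> w"
     "set zs \<subseteq> refls n" "length zs = len (finv w \<circ> cox)" "comp_list zs = finv w \<circ> cox"
    using len_witness[OF v] len_witness[OF W_comp[OF W_finv[OF v] wW]]
      len_witness[OF W_comp[OF W_finv[OF wW] cox_W]] by metis
  have e: "comp_list (us @ vs) = w" by (simp add: comp_list_append ts finv_comp'[OF v])
  then have "comp_list (us @ vs @ zs) = cox"
    using finv_comp'[OF wW] ts(9) by (metis append_assoc comp_list_append)
  moreover have "length (us @ vs @ zs) = 2 * n"
    using w le len_cox by (simp add: ts P_set_def abs_le_def)
  ultimately show ?thesis
    using reduced_cox_prefix_below[of us vs zs] ts e by simp
qed

lemma P_set_iff: "w \<in> P_set n \<longleftrightarrow> w \<in> W \<and> below w w"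
proof
  assume w: "w \<in> P_set n"
  then have wW: "w \<in> W" by (simp add: P_set_def)
  have "abs_le n w w" using finv_comp(1)[OF wW] len_id by (simp add: abs_le_def)
  then show "w \<in> W \<and> below w w" using abs_le_below[OF wW w] wW by blast
qed (use nc_P_set in blast)

lemma abs_le_iff:
  assumes "v \<in> P_set n" "w \<in> P_set n"
  shows "abs_le n v w \<longleftrightarrow> below v w"
  using assms below_abs_le abs_le_below unfolding P_set_iff by blast

end

section \<open>Least common multiples and the Garside property\<close>

lemma arc_next_unique: "\<not> arc x y z \<Longrightarrow> \<not> arc x z y \<Longrightarrow> y = z"
  using pos_eq_iff[of y z] unfolding arc_def by argo

lemma arc_prev_unique: "\<not> arc x z y \<Longrightarrow> \<not> arc y z x \<Longrightarrow> x = y"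
  using pos_eq_iff[of x y] unfolding arc_def by argo

lemma sigma_comp: "sigma (v \<circ> w) = sigma v \<circ> sigma w"
  by (simp add: sigma_def fun_eq_iff)

lemma sigma_fixed_iff: "sigma w = w \<longleftrightarrow> (\<forall>x. w (1 - x) = 1 - w x)"
  unfolding sigma_def fun_eq_iff by (metis add_diff_cancel_left' diff_add_cancel diff_diff_eq2)

lemma sigma_fixed_arc: "sigma m = m \<Longrightarrow> arc a (m a) (1 - x) \<longleftrightarrow> arc (1 - a) (m (1 - a)) x"
  using arc_mirror[of "1 - a" "1 - m a" x] by (simp add: sigma_fixed_iff)

lemma same_gaps_mirror:
  assumes "\<And>m. m \<in> M \<Longrightarrow> sigma m = m"
  shows "same_gaps M (1 - x) (1 - y) \<longleftrightarrow> same_gaps M x y"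
proof -
  have *: "same_gaps M (1 - x) (1 - y)" if "same_gaps M x y" for x y
    using that unfolding same_gaps_def by (simp add: sigma_fixed_arc[OF assms])
  show ?thesis using *[of x y] *[of "1 - x" "1 - y"] by auto
qed

section \<open>The successor map on the classes of a family\<close>

context affA
begin

text \<open>A one-element class needs no separate case: the degenerate arc from \<open>x\<close> to
  \<open>x\<close> contains every point but \<open>x\<close>, so \<open>z = x\<close> is allowed
  exactly there.\<close>

definition is_next :: "(int \<Rightarrow> int) set \<Rightarrow> int \<Rightarrow> int \<Rightarrow> bool" where
  "is_next M x z \<longleftrightarrow> same_gaps M x z \<and> (\<forall>b. same_gaps M x b \<longrightarrow> \<not> arc x z b)"

lemma is_next_unique: "is_next M x y \<Longrightarrow> is_next M x z \<Longrightarrow> y = z"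
  unfolding is_next_def using arc_next_unique by blast

text \<open>Going forward from \<open>x\<close>, take the nearest larger odd point, else the largest
  even point, else the smallest odd point of the class. In the last two cases \<open>x + L\<close>
  is not in the class, so the class is bounded in each row.\<close>

lemma is_next_ex_odd:
  assumes M: "\<And>m. m \<in> M \<Longrightarrow> periodic_perm n m" and x: "odd x"
  shows "\<exists>z. is_next M x z"
proof (cases "\<exists>y>x. odd y \<and> same_gaps M x y")
  case True
  then obtain y where y: "y > x" "odd y" "same_gaps M x y" by blast
  define S where "S = {x<..y} \<inter> {b. odd b \<and> same_gaps M x b}"
  have "y \<in> S" using y by (simp add: S_def)
  then have fin: "finite S" "S \<noteq> {}" by (simp add: S_def, blast)
  define z where "z = Min S"
  have z: "z \<in> S" "\<And>b. b \<in> S \<Longrightarrow> z \<le> b" unfolding z_def using fin by simp_all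
  have "\<not> arc x z b" if b: "same_gaps M x b" for b
  proof
    assume "arc x z b"
    then have "odd b" "x < b" "b < z" using x z(1) by (auto simp: arc_simp S_def)
    then have "b \<in> S" using b z(1) by (auto simp: S_def)
    then show False using z(2) \<open>b < z\<close> by fastforce
  qed
  then show ?thesis using z(1) by (auto simp: is_next_def S_def)
next
  case False
  have "L > 0" using n_pos by simp
  then have "x + L > x" "odd (x + L)" using x by simp_all
  then have np: "\<not> same_gaps M x (x + L)" using False by blast
  have near: "\<bar>a - b\<bar> < L" if ab: "same_gaps M x a" "same_gaps M x b" "even (a - b)" for a b
  proof (rule ccontr)
    assume "\<not> \<bar>a - b\<bar> < L"
    then have "same_gaps M a (a + L)"
      using same_gaps_period[OF M same_gaps_trans[OF same_gaps_sym[OF ab(1)] ab(2)] ab(3)] by simp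
    moreover have "same_gaps M (x + L) (a + L)" using same_gaps_translate[OF M ab(1), of 1] by simp
    ultimately show False using np ab(1) same_gaps_sym same_gaps_trans by blast
  qed
  show ?thesis
  proof (cases "\<exists>e. even e \<and> same_gaps M x e")
    case True
    then obtain e where e: "even e" "same_gaps M x e" by blast
    \<comment> \<open>By \<open>near\<close> the class has no even point above this window, which
      only serves to make the set finite.\<close>
    define S where "S = {e..e + L} \<inter> {b. even b \<and> same_gaps M x b}"
    have "e \<in> S" using e by (simp add: S_def)
    then have fin: "finite S" "S \<noteq> {}" by (simp add: S_def, blast)
    define z where "z = Max S"
    have z: "z \<in> S" "\<And>b. b \<in> S \<Longrightarrow> b \<le> z" unfolding z_def using fin by simp_all
    have "\<not> arc x z b" if b: "same_gaps M x b" for b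
    proof
      assume a: "arc x z b"
      then have "even b" "z < b" using x z(1) False b by (auto simp: arc_simp S_def split: if_splits)
      then have "b \<in> S" using b z(1) near[OF e(2) b] e(1) by (auto simp: S_def)
      then show False using z(2) \<open>z < b\<close> by fastforce
    qed
    then show ?thesis using z(1) by (auto simp: is_next_def S_def)
  next
    case noeven: False
    define S where "S = {x - L..x} \<inter> {b. odd b \<and> same_gaps M x b}"
    have "x \<in> S" using x by (simp add: S_def)
    then have fin: "finite S" "S \<noteq> {}" by (simp add: S_def, blast)
    define z where "z = Min S"
    have z: "z \<in> S" "\<And>b. b \<in> S \<Longrightarrow> z \<le> b" unfolding z_def using fin by simp_all
    have "\<not> arc x z b" if b: "same_gaps M x b" for b
    proof
      assume a: "arc x z b"
      have ob: "odd b" using noeven b by blast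
      then have "\<not> x < b" using False b by blast
      then have "b < z" using x z(1) a ob by (auto simp: arc_simp S_def split: if_splits)
      then have "b \<in> S" using b z(1) near[OF same_gaps_refl b] ob x by (auto simp: S_def)
      then show False using z(2) \<open>b < z\<close> by fastforce
    qed
    then show ?thesis using z(1) by (auto simp: is_next_def S_def)
  qed
qed

lemma is_next_mirror:
  assumes "\<And>m. m \<in> M \<Longrightarrow> sigma m = m" "is_next M x z"
  shows "is_next M (1 - x) (1 - z)"
  unfolding is_next_def
proof (intro conjI allI impI)
  show "same_gaps M (1 - x) (1 - z)"
    using assms(2) same_gaps_mirror[of M x z] assms(1) unfolding is_next_def by blast
  fix b assume "same_gaps M (1 - x) b"
  then have "same_gaps M x (1 - b)" using same_gaps_mirror[of M x "1 - b"] assms(1) by simp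
  then show "\<not> arc (1 - x) (1 - z) b"
    using assms(2) arc_mirror[of x z "1 - b"] by (simp add: is_next_def)
qed

lemma is_next_translate:
  assumes M: "\<And>m. m \<in> M \<Longrightarrow> periodic_perm n m" and z: "is_next M x z"
  shows "is_next M (x + L) (z + L)"
  unfolding is_next_def
proof (intro conjI allI impI)
  show "same_gaps M (x + L) (z + L)"
    using z same_gaps_translate[OF M, of M x z 1] by (simp add: is_next_def)
  fix b assume "same_gaps M (x + L) b"
  then have "same_gaps M x (b - L)" using same_gaps_translate[OF M, of M "x + L" b "- 1"] by simp
  then show "\<not> arc (x + L) (z + L) b"
    using z arc_translate[of L x z "b - L"] by (simp add: is_next_def)
qed

lemma is_next_ex:
  assumes "\<And>m. m \<in> M \<Longrightarrow> periodic_perm n m" "\<And>m. m \<in> M \<Longrightarrow> sigma m = m"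
  shows "\<exists>z. is_next M x z"
proof (cases "odd x")
  case False
  then obtain z where "is_next M (1 - x) z" using is_next_ex_odd[OF assms(1), of M "1 - x"] by auto
  then have "is_next M (1 - (1 - x)) (1 - z)" using is_next_mirror[of M] assms(2) by blast
  then show ?thesis by auto
qed (use is_next_ex_odd[OF assms(1)] in blast)

definition nxt :: "(int \<Rightarrow> int) set \<Rightarrow> int \<Rightarrow> int" where
  "nxt M x = (SOME z. is_next M x z)"

text \<open>The induced map on residues is an injection of a finite set into itself, hence
  surjective.\<close>

lemma periodic_bijI:
  assumes inj: "inj w" and per: "\<And>x. w (x + L) = w x + L"
  shows "periodic_perm n w"
proof -
  have shift: "w (x + L * k) = w x + L * k" for x k
  proof (induction k rule: int_induct[where k = 0])
    case (step1 i)
    then show ?case using per[of "x + L * i"] by (simp add: algebra_simps)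
  next
    case (step2 i)
    then show ?case using per[of "x + L * (i - 1)"] by (simp add: algebra_simps)
  qed simp
  define r where "r = (\<lambda>i. w i mod L)"
  have L: "L > 0" using n_pos by simp
  have "inj_on r {0..<L}"
  proof (rule inj_onI)
    fix i j assume ij: "i \<in> {0..<L}" "j \<in> {0..<L}" and "r i = r j"
    then have "[w j = w i] (mod L)" by (simp add: r_def cong_def)
    then obtain k where "w i = w j + L * k" by (auto simp: cong_iff_lin)
    then have "w i = w (j + L * k)" by (simp add: shift)
    then have "i = j + L * k" using inj by (simp add: inj_eq)
    then have "i mod L = j mod L" by simp
    then show "i = j" using ij by simp
  qed
  moreover have "r ` {0..<L} \<subseteq> {0..<L}" using L by (auto simp: r_def)
  ultimately have im: "r ` {0..<L} = {0..<L}" by (intro endo_inj_surj) simp_all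
  have "\<exists>x. w x = y" for y
  proof -
    have "y mod L \<in> r ` {0..<L}" unfolding im using L by simp
    then obtain i where "y mod L = w i mod L" by (auto simp: r_def)
    then have "[w i = y] (mod L)" by (simp add: cong_def)
    then obtain k where "y = w i + L * k" by (auto simp: cong_iff_lin)
    then show ?thesis using shift by metis
  qed
  then have "surj w" by (metis surjI)
  then show ?thesis using inj per by (simp add: periodic_perm_def bij_def)
qed

text \<open>The displacements at \<open>x\<close> and \<open>L + 1 - x\<close> are opposite, so they
  cancel over a period.\<close>

lemma sigma_fixed_W:
  assumes pw: "periodic_perm n w" and s: "sigma w = w"
  shows "w \<in> W"
proof -
  have d: "w (L + 1 - x) - (L + 1 - x) = - (w x - x)" for x
    using periodic_perm_shift[OF pw, of "1 - x" 1] s by (simp add: sigma_fixed_iff algebra_simps)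
  have "(\<Sum>x = 1..L. w x - x) = (\<Sum>x = 1..L. w (L + 1 - x) - (L + 1 - x))"
    by (rule sum.reindex_bij_witness[of _ "\<lambda>x. L + 1 - x" "\<lambda>x. L + 1 - x"]) auto
  also have "\<dots> = - (\<Sum>x = 1..L. w x - x)" unfolding d by (simp only: sum_negf)
  finally have "(\<Sum>x = 1..L. w x - x) = 0" by linarith
  then have "total_shift n w = 0" unfolding total_shift_def of_int_sum[symmetric] by simp
  then show ?thesis using pw by (simp add: W_affA_def)
qed

lemma nxt_lub:
  assumes M: "\<And>m. m \<in> M \<Longrightarrow> periodic_perm n m" "\<And>m. m \<in> M \<Longrightarrow> sigma m = m"
  shows "nxt M \<in> P_set n" "sigma (nxt M) = nxt M"
    "\<And>m. m \<in> M \<Longrightarrow> below (nxt M) m"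
    "\<And>v. (\<And>m. m \<in> M \<Longrightarrow> below v m) \<Longrightarrow> below v (nxt M)"
proof -
  have nx: "is_next M x (nxt M x)" for x
    unfolding nxt_def using is_next_ex[OF M] by (rule someI_ex)
  then have g: "same_gaps M x (nxt M x)" and na: "same_gaps M x b \<Longrightarrow> \<not> arc x (nxt M x) b" for x b
    by (simp_all add: is_next_def)
  show s: "sigma (nxt M) = nxt M"
    unfolding sigma_fixed_iff using is_next_unique[OF nx is_next_mirror[OF M(2) nx]] by blast
  have per: "nxt M (x + L) = nxt M x + L" for x
    using is_next_unique[OF nx is_next_translate[OF M(1) nx]] by blast
  have "inj (nxt M)"
  proof (rule injI)
    fix x y assume e: "nxt M x = nxt M y"
    then have "same_gaps M x y" using g[of x] g[of y] same_gaps_sym same_gaps_trans by metis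
    then have "\<not> arc x (nxt M x) y" "\<not> arc y (nxt M x) x" using na same_gaps_sym e by metis+
    then show "x = y" by (rule arc_prev_unique)
  qed
  then have p: "periodic_perm n (nxt M)" using per by (rule periodic_bijI)
  \<comment> \<open>The arc to the next point contains no point of its own class, and by noncrossing
    it does not separate two points of another class.\<close>
  have coarser: "gaprel (nxt M) x y" if xy: "same_gaps M x y" for x y
    unfolding gaprel_iff
  proof
    fix a show "arc a (nxt M a) x \<longleftrightarrow> arc a (nxt M a) y"
    proof (cases "same_gaps M a x")
      case True
      then show ?thesis using na xy same_gaps_trans by blast
    next
      case False
      then show ?thesis using same_gaps_arc[OF g xy] by blast
    qed
  qed
  have "below (nxt M) (nxt M)" unfolding below_def using coarser g by blast
  then show "nxt M \<in> P_set n" using nc_P_set sigma_fixed_W[OF p s] by blast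
  show "below (nxt M) m" if "m \<in> M" for m
    using g that unfolding below_def gaprel_iff same_gaps_def by blast
  show "below v (nxt M)" if "\<And>m. m \<in> M \<Longrightarrow> below v m" for v
  proof -
    have "same_gaps M x (v x)" for x
      using that unfolding same_gaps_def below_def gaprel_iff by blast
    then show ?thesis unfolding below_def using coarser by blast
  qed
qed

section \<open>The germ axioms\<close>

definition Q :: "(int \<Rightarrow> int) germ" where
  "Q = fixed_germ sigma (P_germ n)"

lemma carrier_Q: "w \<in> carrier Q \<longleftrightarrow> w \<in> P_set n \<and> sigma w = w"
  by (simp add: Q_def fixed_germ_def P_germ_def)

lemma gprod_Q: "gprod Q v w =
    (if v \<circ> w \<in> P_set n \<and> len (v \<circ> w) = len v + len w then Some (v \<circ> w) else None)"
  by (simp add: Q_def fixed_germ_def P_germ_def)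

lemma gunit_Q: "gunit Q = id"
  by (simp add: Q_def fixed_germ_def P_germ_def)

lemma P_set_W: "w \<in> P_set n \<Longrightarrow> w \<in> W"
  by (simp add: P_set_def)

lemma P_set_len: "w \<in> P_set n \<Longrightarrow> len w + len (finv w \<circ> cox) = 2 * n"
  by (simp add: P_set_def abs_le_def len_cox)

lemma finv_finv: "w \<in> W \<Longrightarrow> finv (finv w) = w"
  using W_bij inv_inv_eq by blast

lemma sigma_finv:
  assumes w: "w \<in> W" and s: "sigma w = w"
  shows "sigma (finv w) = finv w"
  unfolding sigma_fixed_iff
proof
  fix y
  obtain x where y: "y = w x" using W_bij[OF w] by (metis bij_pointE)
  have "finv w (w z) = z" for z using W_bij[OF w] by (simp add: bij_is_inj)
  then show "finv w (1 - y) = 1 - finv w y" using s unfolding sigma_fixed_iff y by metis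
qed

text \<open>Conjugating \<open>u\<close> past \<open>v\<close> turns \<open>v\<close> into a prefix
  of \<open>cox\<close>, and conjugation does not increase the length of \<open>u\<close>.\<close>

lemma middle_factor_P_set:
  assumes W: "u \<in> W" "v \<in> W" "z \<in> W" and e: "u \<circ> (v \<circ> z) = cox" and le: "len u + len v + len z \<le> 2 * n"
  shows "v \<in> P_set n"
proof -
  have "finv v \<circ> cox = (finv v \<circ> u \<circ> finv (finv v)) \<circ> z"
    unfolding finv_finv[OF W(2)] e[symmetric] by (simp add: comp_assoc)
  then have "len (finv v \<circ> cox) \<le> len u + len z"
    using len_comp[of "finv v \<circ> u \<circ> finv (finv v)" z] len_conj[OF W_finv[OF W(2)] W(1)] W
    by (simp add: W_comp W_finv)
  then show ?thesis
    using le len_factor[OF W(2) cox_W] W(2) by (simp add: P_set_def abs_le_def len_cox)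
qed

text \<open>The cofactor \<open>finv a \<circ> b\<close> is a middle factor between \<open>a\<close>
  and \<open>finv b \<circ> cox\<close>, hence in \<open>P_set n\<close>, and it inherits invariance
  under \<open>sigma\<close>. So divisibility in the fixed germ is the restricted order of the whole
  germ.\<close>

lemma gdvd_left_Q:
  assumes a: "a \<in> carrier Q" and b: "b \<in> carrier Q"
  shows "gdvd_left Q a b \<longleftrightarrow> below a b"
proof -
  have P: "a \<in> P_set n" "b \<in> P_set n" and W: "a \<in> W" "b \<in> W" and s: "sigma a = a" "sigma b = b"
    using a b P_set_W by (auto simp: carrier_Q)
  have "gdvd_left Q a b \<longleftrightarrow> abs_le n a b"
  proof
    assume "gdvd_left Q a b"
    then obtain c where c: "b = a \<circ> c" "len b = len a + len c"
      by (auto simp: gdvd_left_def gprod_Q split: if_splits)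
    moreover from c(1) have "finv a \<circ> b = c" using finv_comp'[OF W(1)] by simp
    ultimately show "abs_le n a b" by (simp add: abs_le_def)
  next
    assume le: "abs_le n a b"
    define c where "c = finv a \<circ> b"
    have cW: "c \<in> W" unfolding c_def by (intro W_comp W_finv W)
    have ac: "a \<circ> c = b" unfolding c_def by (rule finv_comp'(2)[OF W(1)])
    have "c \<in> P_set n"
    proof (rule middle_factor_P_set[OF W(1) cW W_comp[OF W_finv[OF W(2)] cox_W]])
      show "a \<circ> (c \<circ> (finv b \<circ> cox)) = cox"
        using finv_comp'(2)[OF W(2), of cox] ac by (metis comp_assoc)
      show "len a + len c + len (finv b \<circ> cox) \<le> 2 * n"
        using le P_set_len[OF P(2)] by (simp add: abs_le_def c_def)
    qed
    moreover have "sigma c = c" unfolding c_def sigma_comp sigma_finv[OF W(1) s(1)] s(2) ..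
    ultimately have "c \<in> carrier Q" by (simp add: carrier_Q)
    moreover have "gprod Q a c = Some b"
      using le P(2) ac by (simp add: gprod_Q abs_le_def c_def)
    ultimately show "gdvd_left Q a b" unfolding gdvd_left_def by blast
  qed
  then show ?thesis using abs_le_iff[OF P] by simp
qed

lemma cox_Q: "cox \<in> carrier Q"
proof -
  have "sigma cox = cox" by (auto simp: sigma_fixed_iff cox_eq)
  then show ?thesis using nc_P_set[OF cox_W below_cox] by (simp add: carrier_Q)
qed

lemma id_Q: "id \<in> carrier Q"
  using nc_P_set[OF id_W below_id] by (simp add: carrier_Q sigma_fixed_iff)

lemma germ_Q: "germ Q"
proof
  fix a b c assume "a \<in> carrier Q" "b \<in> carrier Q" "gprod Q a b = Some c"
  then show "c \<in> carrier Q" by (auto simp: gprod_Q carrier_Q sigma_comp split: if_splits)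
next
  show "gunit Q \<in> carrier Q" by (simp add: gunit_Q id_Q)
next
  fix p assume "p \<in> carrier Q"
  then show "gprod Q (gunit Q) p = Some p" "gprod Q p (gunit Q) = Some p"
    by (simp_all add: gprod_Q gunit_Q carrier_Q len_id)
qed

text \<open>Both sides say that the triple product lies in \<open>P_set n\<close> with additive
  length; the partial products are then middle factors of \<open>cox\<close>.\<close>

lemma product_len_iff:
  assumes W: "a \<in> W" "b \<in> W" "c \<in> W"
  defines "ok \<equiv> \<lambda>v w. v \<circ> w \<in> P_set n \<and> len (v \<circ> w) = len v + len w"
  shows "ok b c \<and> ok a (b \<circ> c) \<longleftrightarrow> ok a b \<and> ok (a \<circ> b) c"
proof -
  let ?abc = "a \<circ> (b \<circ> c)"
  let ?all = "?abc \<in> P_set n \<and> len ?abc = len a + len b + len c"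
  have le: "len (a \<circ> b) \<le> len a + len b" "len (b \<circ> c) \<le> len b + len c"
    "len ?abc \<le> len a + len (b \<circ> c)" "len ?abc \<le> len (a \<circ> b) + len c"
    using len_comp[OF W(1,2)] len_comp[OF W(2,3)] len_comp[OF W(1) W_comp[OF W(2,3)]]
      len_comp[OF W_comp[OF W(1,2)] W(3)] by (simp_all only: comp_assoc)
  have "ok b c \<and> ok a b" if all: ?all
  proof -
    define z where "z = finv ?abc \<circ> cox"
    have abcW: "?abc \<in> W" by (intro W_comp W)
    have z: "z \<in> W" unfolding z_def by (intro W_comp W_finv cox_W W)
    have e: "a \<circ> ((b \<circ> c) \<circ> z) = cox"
      using finv_comp'(2)[OF abcW, of cox] unfolding z_def by (simp only: comp_assoc)
    have lz: "len a + len b + len c + len z = 2 * n"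
      using P_set_len[of ?abc] all unfolding z_def by simp
    have "b \<circ> c \<in> P_set n"
      by (rule middle_factor_P_set[OF W(1) W_comp[OF W(2,3)] z e]) (use lz le in linarith)
    moreover have "a \<circ> b \<in> P_set n"
    proof (rule middle_factor_P_set[OF id_W W_comp[OF W(1,2)] W_comp[OF W(3) z]])
      show "id \<circ> (a \<circ> b \<circ> (c \<circ> z)) = cox" using e by (simp only: comp_assoc id_comp)
      show "len id + len (a \<circ> b) + len (c \<circ> z) \<le> 2 * n"
        using len_comp[OF W(3) z] lz le(1) len_id by linarith
    qed
    moreover have "len (b \<circ> c) = len b + len c" "len (a \<circ> b) = len a + len b"
      using le all by linarith+
    ultimately show ?thesis unfolding ok_def by blast
  qed
  moreover have "ok b c \<and> ok a (b \<circ> c) \<longleftrightarrow> ok b c \<and> ?all"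
    unfolding ok_def by auto
  moreover have "ok a b \<and> ok (a \<circ> b) c \<longleftrightarrow> ok a b \<and> ?all"
    unfolding ok_def comp_assoc by auto
  ultimately show ?thesis by blast
qed

lemma associative_Q: "associative_germ Q"
proof -
  interpret germ Q by (rule germ_Q)
  show ?thesis
  proof
    fix a b c assume abc: "a \<in> carrier Q" "b \<in> carrier Q" "c \<in> carrier Q"
    then have "a \<in> W" "b \<in> W" "c \<in> W" using P_set_W by (auto simp: carrier_Q)
    from product_len_iff[OF this]
    show "Option.bind (gprod Q b c) (\<lambda>x. gprod Q a x) = Option.bind (gprod Q a b) (\<lambda>y. gprod Q y c)"
      unfolding gprod_Q by (cases "b \<circ> c \<in> P_set n \<and> len (b \<circ> c) = len b + len c";
        cases "a \<circ> b \<in> P_set n \<and> len (a \<circ> b) = len a + len b") (simp_all add: comp_assoc)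
  qed
qed

lemma len_0_iff: "w \<in> W \<Longrightarrow> len w = 0 \<longleftrightarrow> w = id"
  using len_id by (metis len_witness length_0_conv foldr.simps(1) id_apply)

lemma len_no_descent: "\<nexists>f :: nat \<Rightarrow> int \<Rightarrow> int. \<forall>i. len (f (Suc i)) < len (f i)"
  using wf_measure[of len] unfolding wf_iff_no_infinite_down_chain by simp

text \<open>A proper divisor on either side leaves a cofactor of positive length, so it is strictly
  shorter.\<close>

lemma noetherian_Q: "noetherian_germ Q"
proof -
  interpret associative_germ Q by (rule associative_Q)
  have pos: "len c > 0" if "c \<in> carrier Q" "c \<noteq> id" for c
    using that len_0_iff[OF P_set_W] by (auto simp: carrier_Q)
  have left: "len a < len b" if "gdvd_left Q a b" "a \<noteq> b" for a b
    using that pos by (fastforce simp: gdvd_left_def gprod_Q split: if_splits)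
  have right: "len a < len b" if "gdvd_right Q a b" "a \<noteq> b" for a b
    using that pos by (fastforce simp: gdvd_right_def gprod_Q split: if_splits)
  show ?thesis
  proof
    show "\<nexists>f :: nat \<Rightarrow> int \<Rightarrow> int. range f \<subseteq> carrier Q \<and>
        (\<forall>i. gdvd_left Q (f (Suc i)) (f i) \<and> f (Suc i) \<noteq> f i)"
      using left len_no_descent by metis
    show "\<nexists>f :: nat \<Rightarrow> int \<Rightarrow> int. range f \<subseteq> carrier Q \<and>
        (\<forall>i. gdvd_right Q (f (Suc i)) (f i) \<and> f (Suc i) \<noteq> f i)"
      using right len_no_descent by metis
  qed
qed

text \<open>Evaluating words in the group is well defined on the generated monoid, which therefore
  inherits cancellation of germ elements from the group.\<close>

lemma germ_cong_Q: "(xs, ys) \<in> germ_cong Q \<Longrightarrow> comp_list xs = comp_list ys"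
proof (induction rule: germ_cong.induct)
  case (product xs ys a b c)
  then have "c = a \<circ> b" by (simp add: gprod_Q split: if_splits)
  then show ?case unfolding comp_list_append by (simp add: comp_assoc)
next
  case (unit xs ys)
  then show ?case unfolding comp_list_append by (simp add: gunit_Q)
qed simp_all

lemma comp_list_Q: "xs \<in> lists (carrier Q) \<Longrightarrow> comp_list xs \<in> W"
  by (induction xs) (auto simp: id_W carrier_Q intro: W_comp P_set_W)

lemma monoid_cancel_Q:
  assumes m: "m \<in> carrier (germ_monoid Q)" and ab: "a \<in> carrier Q" "b \<in> carrier Q"
    and eq: "germ_embed Q a \<otimes>\<^bsub>germ_monoid Q\<^esub> m = germ_embed Q b \<otimes>\<^bsub>germ_monoid Q\<^esub> m \<or>
      m \<otimes>\<^bsub>germ_monoid Q\<^esub> germ_embed Q a = m \<otimes>\<^bsub>germ_monoid Q\<^esub> germ_embed Q b"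
  shows "a = b"
proof -
  interpret germ Q by (rule germ_Q)
  have "m \<in> lists (carrier Q) // germ_cong Q" using m by (simp add: germ_monoid_def)
  then obtain ms where ms: "ms \<in> lists (carrier Q)" "m = germ_cong Q `` {ms}"
    by (rule quotientE)
  define v where "v = comp_list ms"
  have v: "v \<in> W" unfolding v_def by (rule comp_list_Q[OF ms(1)])
  have abl: "[a] \<in> lists (carrier Q)" "[b] \<in> lists (carrier Q)" using ab by simp_all
  have rel: "comp_list xs = comp_list ys"
    if "germ_cong Q `` {xs} = germ_cong Q `` {ys}" "ys \<in> lists (carrier Q)" for xs ys
  proof -
    have "ys \<in> germ_cong Q `` {ys}" using germ_cong.refl[OF that(2)] by simp
    then have "(xs, ys) \<in> germ_cong Q" unfolding that(1)[symmetric] by simp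
    then show ?thesis by (rule germ_cong_Q)
  qed
  have "a \<circ> v = b \<circ> v \<or> v \<circ> a = v \<circ> b"
    using eq
  proof
    assume "germ_embed Q a \<otimes>\<^bsub>germ_monoid Q\<^esub> m = germ_embed Q b \<otimes>\<^bsub>germ_monoid Q\<^esub> m"
    then have "germ_cong Q `` {[a] @ ms} = germ_cong Q `` {[b] @ ms}"
      unfolding germ_embed_def ms(2) by (simp only: germ_monoid_mult_class[OF abl(1) ms(1)] germ_monoid_mult_class[OF abl(2) ms(1)])
    then have "comp_list ([a] @ ms) = comp_list ([b] @ ms)"
      by (rule rel) (use ab ms in simp)
    then show ?thesis unfolding comp_list_append by (simp add: v_def)
  next
    assume "m \<otimes>\<^bsub>germ_monoid Q\<^esub> germ_embed Q a = m \<otimes>\<^bsub>germ_monoid Q\<^esub> germ_embed Q b"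
    then have "germ_cong Q `` {ms @ [a]} = germ_cong Q `` {ms @ [b]}"
      unfolding germ_embed_def ms(2) by (simp only: germ_monoid_mult_class[OF ms(1) abl(1)] germ_monoid_mult_class[OF ms(1) abl(2)])
    then have "comp_list (ms @ [a]) = comp_list (ms @ [b])"
      by (rule rel) (use ab ms in simp)
    then show ?thesis unfolding comp_list_append by (simp add: v_def)
  qed
  then show ?thesis
  proof
    assume "a \<circ> v = b \<circ> v"
    then have "a \<circ> (v \<circ> finv v) = b \<circ> (v \<circ> finv v)" by (simp only: comp_assoc[symmetric])
    then show ?thesis using finv_comp(2)[OF v] by simp
  next
    assume "v \<circ> a = v \<circ> b"
    then have "finv v \<circ> (v \<circ> a) = finv v \<circ> (v \<circ> b)" by simp
    then show ?thesis unfolding finv_comp'(1)[OF v] .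
  qed
qed

lemma right_lcm_Q:
  assumes a: "a \<in> carrier Q" and b: "b \<in> carrier Q"
  shows "\<exists>m \<in> carrier Q. gdvd_left Q a m \<and> gdvd_left Q b m \<and>
    (\<forall>m' \<in> carrier Q. gdvd_left Q a m' \<and> gdvd_left Q b m' \<longrightarrow> gdvd_left Q m m')"
proof -
  define M where "M = {m \<in> carrier Q. below a m \<and> below b m}"
  have "m \<in> M \<Longrightarrow> periodic_perm n m" "m \<in> M \<Longrightarrow> sigma m = m" for m
    by (auto simp: M_def carrier_Q intro: W_affA_periodic P_set_W)
  note lub = nxt_lub[of M, OF this]
  have m: "nxt M \<in> carrier Q" using lub(1,2) by (simp add: carrier_Q)
  moreover have "below a (nxt M)" "below b (nxt M)" by (rule lub(4); simp add: M_def)+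
  moreover have "below (nxt M) m'" if "m' \<in> carrier Q" "below a m'" "below b m'" for m'
  proof -
    have "m' \<in> M" using that unfolding M_def by blast
    then show ?thesis using lub(3) by blast
  qed
  ultimately show ?thesis using a b gdvd_left_Q by blast
qed

lemma garside_element_Q:
  assumes a: "a \<in> carrier Q"
  shows "gdvd_left Q a cox" "gdvd_right Q a cox"
proof -
  show "gdvd_left Q a cox" using gdvd_left_Q[OF a cox_Q] below_cox by simp
  have P: "a \<in> P_set n" and W: "a \<in> W" and s: "sigma a = a" using a P_set_W by (auto simp: carrier_Q)
  define c where "c = cox \<circ> finv a"
  have cW: "c \<in> W" unfolding c_def by (intro W_comp W_finv W cox_W)
  have ca: "c \<circ> a = cox" unfolding c_def using finv_comp(1)[OF W] by (simp add: comp_assoc)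
  \<comment> \<open>The left complement of \<open>a\<close> is conjugate to its right complement,
    whose length is known.\<close>
  have "c = a \<circ> (finv a \<circ> cox) \<circ> finv a" unfolding c_def finv_comp'(2)[OF W] ..
  then have "len c \<le> len (finv a \<circ> cox)" using len_conj[OF W W_comp[OF W_finv[OF W] cox_W]] by simp
  then have le: "len c + len a \<le> 2 * n" using P_set_len[OF P] by linarith
  have "c \<in> P_set n"
    by (rule middle_factor_P_set[OF id_W cW W]) (use ca le len_id in simp_all)
  moreover have "sigma cox = cox" using cox_Q by (simp add: carrier_Q)
  then have "sigma c = c" unfolding c_def sigma_comp sigma_finv[OF W s] by simp
  moreover have "len cox = len c + len a"
    using le len_comp[OF cW W] ca len_cox by simp
  ultimately show "gdvd_right Q a cox"
    using cox_Q ca unfolding gdvd_right_def by (intro bexI[of _ c]) (simp_all add: carrier_Q gprod_Q)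
qed

lemma garside_Q: "garside_germ Q"
proof -
  interpret noetherian_germ Q by (rule noetherian_Q)
  show ?thesis
  proof
    show "\<exists>\<Delta>\<in>carrier Q. \<forall>a\<in>carrier Q. gdvd_left Q a \<Delta> \<and> gdvd_right Q a \<Delta>"
      using cox_Q garside_element_Q by blast
  qed (use right_lcm_Q monoid_cancel_Q in blast)+
qed

end

theorem theorem4p1:
  fixes n :: nat
  assumes "n \<ge> 2"
  shows "garside_germ (fixed_germ sigma (P_germ n))"
proof -
  interpret affA n by unfold_locales (use assms in simp)
  show ?thesis using garside_Q unfolding Q_def .
qed

end
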